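(* Let $k$ be a field, $p\in k[t]$ monic irreducible, $m\ge1$, and write $K=k[t]/p$, $S=k[t]/p^{m+1}$. A complete set of representatives (one for each orbit) for the $G_{(m+1,1,1)}(p)$-orbits in $E_{(m+1,1,1)}(p)$ is given by the following, where in (3)–(8) $x$ runs over a fixed set of representatives in $S$ of the residue classes in $k[t]/p^m$ that are divisible by $p$: (1) $\begin{pmatrix} x & 0 \\ 0 & W \end{pmatrix}$, where $x\in S$ with $p\mid x$, and $W\in M_2(K)$ is in rational normal form; the isotropy group is $\left\{\begin{pmatrix} a & p^m\vec b^{T} \\ \vec c & D \end{pmatrix}\;\middle|\;a\in S^*,\ \vec b,\vec c\in K^2,\ D\in Z_{\mathrm{GL}_2(K)}(W)\right\}$. (2) $\begin{pmatrix} x & 0 \\ 0 & W \end{pmatrix}$, where $x\in S$ with $(x,p)=1$, and $W\in M_2(K)$ is in rational normal form; the isotropy group is $\left\{\begin{pmatrix} a & 0 \\ 0 & D \end{pmatrix}\;\middle|\;a\in S^*,\ D\in Z_{\mathrm{GL}_2(K)}(W)\right\}$. (3) $\begin{pmatrix} x & 1 & 0 \\ r & u & 0 \\ 0 & 0 & v \end{pmatrix}$, where $r,u,v\in K$ with $r\ne0$; isotropy group $\left\{\begin{pmatrix} a & p^m b & 0 \\ b r & a & 0 \\ 0 & 0 & d \end{pmatrix}\;\middle|\;a\in S^*,\ b\in K,\ d\in K^*\right\}$. (4) $\begin{pmatrix} x & 1 & 0 \\ 0 & 0 & u \\ 1 & 0 & v \end{pmatrix}$, where $u,v\in K$; isotropy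 group $\left\{\begin{pmatrix} a & p^m b & p^m u d \\ u d & a & 0 \\ b+v d & d & a \end{pmatrix}\;\middle|\;a\in S^*,\ b,d\in K\right\}$. (5) $\begin{pmatrix} x & 1 & 0 \\ 0 & 0 & 1 \\ 0 & 0 & w \end{pmatrix}$, where $w\in K$; isotropy group $\left\{\begin{pmatrix} a & p^m b_1 & p^m b_2 \\ 0 & a & 0 \\ 0 & 0 & a \end{pmatrix}\;\middle|\;a\in S^*,\ b_1,b_2\in K\right\}$. (6) $\begin{pmatrix} x & 1 & 0 \\ 0 & u & 0 \\ 0 & 0 & w \end{pmatrix}$, where $u,w\in K$; isotropy group $\left\{\begin{pmatrix} a & p^m b_1 & p^m b_2 \\ 0 & a & 0 \\ d(w-u) & d & e \end{pmatrix}\;\middle|\;a\in S^*,\ b_1,b_2,d\in K,\ e\in K^*\right\}$. (7) $\begin{pmatrix} x & 0 & 0 \\ 1 & 0 & 0 \\ 0 & 1 & w \end{pmatrix}$, where $w\in K$; isotropy group $\left\{\begin{pmatrix} a & 0 & 0 \\ c_1 & a & 0 \\ c_2 & 0 & a \end{pmatrix}\;\middle|\;a\in S^*,\ c_1,c_2\in K\right\}$. (8) $\begin{pmatrix} x & 0 & 0 \\ 1 & u & 0 \\ 0 & 0 & w \end{pmatrix}$, where $u,w\in K$; isotropy group $\left\{\begin{pmatrix} a & 0 & p^m d(w-u) \\ c_1 & a & d \\ c_2 & 0 & e \end{pmatrix}\;\middle|\;a\in S^*,\ c_1,c_2,d\in K,\ e\in K^*\right\}$.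
   Context: Let $\lambda=(m+1,1,1)$, $M_\lambda(p)=k[t]/p^{m+1}\oplus k[t]/p\oplus k[t]/p$, $G_\lambda(p)=\mathrm{Aut}_{k[t]}(M_\lambda(p))$, $E_\lambda(p)=\mathrm{Ext}^1_{k[t]}(M_\lambda(p),M_\lambda(p))$, with $G_\lambda(p)$ acting on $E_\lambda(p)$ diagonally ($g\cdot\xi\cdot g^{-1}$, by functoriality in both arguments). In matrix terms (block matrices with blocks of sizes $1,2$; column vectors $\vec y,\vec z,\vec b,\vec c$): $$E_\lambda(p)=\left\{\begin{pmatrix} x & \vec y^{T} \\ \vec z & W \end{pmatrix}\;\middle|\;x\in S,\ \vec y,\vec z\in K^2,\ W\in M_2(K)\right\},$$ $$G_\lambda(p)=\left\{\begin{pmatrix} a & p^m\vec b^{T} \\ \vec c & D \end{pmatrix}\;\middle|\;a\in S^*,\ \vec b,\vec c\in K^2,\ D\in\mathrm{GL}_2(K)\right\}$$ (the matrix of an automorphism $g$ is given by $g(e_j)=\sum_ig_{ij}e_i$, $e_j$ being the image of $1$ in the $j$-th summand; the matrix of an extension $0\to M_\lambda\xrightarrow{i}M\xrightarrow{q}M_\lambda\to0$ is $(\epsilon_{ij})$ where $p^{\lambda_j}\tilde f_j=\sum_i\epsilon_{ij}i(e_i)$ for lifts $\tilde f_j\in M$ of $e_j$). For $g=\begin{pmatrix} a & p^m\vec b^{T} \\ \vec c & D \end{pmatrix}$ put $g^\#=\begin{pmatrix} a & \vec b^{T} \\ p^m\vec c & D \end{pmatrix}$. The action of $g$ on $E_\lambda(p)$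 is $E\mapsto gE(g^{-1})^\#$; thus $g$ sends $E$ to $E'$ iff $gE=E'g^\#$ in $E_\lambda(p)$ (the $(1,1)$ entry is read modulo $p^{m+1}$, all others modulo $p$). When an element of $S$ appears in an entry read modulo $p$, its residue class in $K$ is meant. "$W$ in rational normal form" means $W$ runs over the rational canonical forms, one for each similarity class in $M_2(K)$. $Z_{\mathrm{GL}_2(K)}(W)$ is the centralizer of $W$ in $\mathrm{GL}_2(K)$. *)

theory Defs
  imports
    "HOL-Analysis.Cartesian_Space"
    "HOL-Computational_Algebra.Polynomial_Factorial"
    "HOL-Algebra.Group_Action"
    "HOL-Algebra.Bij"
    "HOL-Algebra.Module"
    "HOL-Algebra.Algebraic_Closure_Type"
begin

section \<open>Modules, automorphisms and Ext groups\<close>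

definition mod_hom :: "('r, 's) ring_scheme \<Rightarrow> ('r, 'a) module \<Rightarrow> ('r, 'b) module \<Rightarrow> ('a \<Rightarrow> 'b) set" where
  "mod_hom R M N = {h \<in> carrier M \<rightarrow> carrier N.
     (\<forall>x\<in>carrier M. \<forall>y\<in>carrier M. h (x \<oplus>\<^bsub>M\<^esub> y) = h x \<oplus>\<^bsub>N\<^esub> h y) \<and>
     (\<forall>r\<in>carrier R. \<forall>x\<in>carrier M. h (r \<odot>\<^bsub>M\<^esub> x) = r \<odot>\<^bsub>N\<^esub> h x)}"

definition mod_Aut :: "('r, 's) ring_scheme \<Rightarrow> ('r, 'a) module \<Rightarrow> ('a \<Rightarrow> 'a) monoid" where
  "mod_Aut R M = BijGroup (carrier M) \<lparr>carrier := mod_hom R M M \<inter> Bij (carrier M)\<rparr>"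

text \<open>
  A triple \<open>(L, i, q)\<close> stands for a short exact sequence of \<open>R\<close>-modules
  \<open>0 \<rightarrow> B \<rightarrow> L \<rightarrow> A \<rightarrow> 0\<close> with maps \<open>i\<close> and \<open>q\<close>.  The underlying set of \<open>L\<close>
  is taken inside the type \<open>'b \<times> 'a\<close>; this is no restriction up to equivalence, because the
  underlying set of any extension of \<open>A\<close> by \<open>B\<close> is in bijection with
  \<open>carrier B \<times> carrier A\<close>.  The \<open>mult\<close> and \<open>one\<close> fields of a module record carry no
  information.
\<close>

type_synonym ('r, 'a, 'b) ext =
  "('r, 'b \<times> 'a) module \<times> ('b \<Rightarrow> 'b \<times> 'a) \<times> ('b \<times> 'a \<Rightarrow> 'a)"

definition extensions ::
    "('r, 's) ring_scheme \<Rightarrow> ('r, 'a) module \<Rightarrow> ('r, 'b) module \<Rightarrow> ('r, 'a, 'b) ext set" where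
  "extensions R A B = {(L, i, q).
     Module.module R L \<and>
     i \<in> mod_hom R B L \<and> inj_on i (carrier B) \<and>
     q \<in> mod_hom R L A \<and> q ` carrier L = carrier A \<and>
     i ` carrier B = {x \<in> carrier L. q x = \<zero>\<^bsub>A\<^esub>}}"

definition ext_equiv ::
    "('r, 's) ring_scheme \<Rightarrow> ('r, 'a) module \<Rightarrow> ('r, 'b) module \<Rightarrow> ('r, 'a, 'b) ext rel" where
  "ext_equiv R A B = {((L, i, q), (L', i', q')).
     (L, i, q) \<in> extensions R A B \<and> (L', i', q') \<in> extensions R A B \<and>
     (\<exists>\<phi> \<in> mod_hom R L L'. bij_betw \<phi> (carrier L) (carrier L') \<and>
        (\<forall>b\<in>carrier B. \<phi> (i b) = i' b) \<and> (\<forall>x\<in>carrier L. q' (\<phi> x) = q x))}"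

definition Ext1 ::
    "('r, 's) ring_scheme \<Rightarrow> ('r, 'a) module \<Rightarrow> ('r, 'b) module \<Rightarrow> ('r, 'a, 'b) ext set set" where
  "Ext1 R A B = extensions R A B // ext_equiv R A B"

text \<open>
  For an automorphism \<open>g\<close> of \<open>M\<close>, the class \<open>g \<cdot> \<xi> \<cdot> g\<^sup>-\<^sup>1\<close> is obtained by pushing out along
  \<open>g\<close> and pulling back along the inverse of \<open>g\<close>.  Since \<open>g\<close> is invertible, both
  constructions leave the middle module \<open>L\<close> unchanged: the pushout along \<open>g\<close> replaces \<open>i\<close>
  by \<open>i \<circ> g\<^sup>-\<^sup>1\<close>, and the pullback along the inverse of \<open>g\<close> replaces \<open>q\<close> by \<open>g \<circ> q\<close>.
\<close>

definition ext_conj :: "('r, 'a) module \<Rightarrow> ('a \<Rightarrow> 'a) \<Rightarrow> ('r, 'a, 'a) ext \<Rightarrow> ('r, 'a, 'a) ext" where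
  "ext_conj M g = (\<lambda>(L, i, q). (L, i \<circ> inv_into (carrier M) g, g \<circ> q))"

definition ext_act ::
    "('r, 's) ring_scheme \<Rightarrow> ('r, 'a) module \<Rightarrow> ('a \<Rightarrow> 'a) \<Rightarrow> ('r, 'a, 'a) ext set \<Rightarrow> ('r, 'a, 'a) ext set"
  where "ext_act R M g \<xi> = ext_equiv R M M `` (ext_conj M g ` \<xi>)"


section \<open>Torsion modules over a polynomial ring\<close>

text \<open>
  The quotient \<open>k[t]/q\<close> is represented by the remainders modulo \<open>q\<close>.  These are closed under
  addition, so that only products have to be reduced.
\<close>

definition resid :: "'k::field poly \<Rightarrow> 'k poly set" where
  "resid q = {f. f mod q = f}"

definition resid_units :: "'k::field poly \<Rightarrow> 'k poly set" where
  "resid_units q = {f \<in> resid q. \<exists>h \<in> resid q. (f * h) mod q = 1}"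

abbreviation kt :: "'k::field poly ring" where
  "kt \<equiv> ring_of_type_algebra"

text \<open>The module \<open>M\<^sub>\<lambda>(p)\<close>, that is, the direct sum of the modules \<open>k[t]/p\<^bsup>\<lambda> j\<^esup>\<close>.\<close>

definition tmod :: "'k::field poly \<Rightarrow> ('n::finite \<Rightarrow> nat) \<Rightarrow> ('k poly, 'k poly ^ 'n) module" where
  "tmod p l = \<lparr>carrier = {v. \<forall>j. v $ j \<in> resid (p ^ l j)},
     monoid.mult = undefined, one = undefined, zero = 0, add = (+),
     module.smult = (\<lambda>f v. \<chi> j. (f * v $ j) mod p ^ l j)\<rparr>"

definition gen :: "'k::field poly \<Rightarrow> ('n::finite \<Rightarrow> nat) \<Rightarrow> 'n \<Rightarrow> 'k poly ^ 'n" where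
  "gen p l j = axis j (1 mod p ^ l j)"

definition aut_matrix :: "('k::field poly ^ 'n \<Rightarrow> 'k poly ^ 'n) \<Rightarrow> ('n \<Rightarrow> 'k poly ^ 'n) \<Rightarrow> 'k poly ^ 'n ^ 'n" where
  "aut_matrix g e = (\<chi> i j. g (e j) $ i)"

text \<open>
  The class of all extensions with matrix \<open>E\<close>.  The \<open>(i,j)\<close> entry of \<open>E\<close> only matters modulo
  \<open>p\<close> to the power \<open>min (l i) (l j)\<close>: modulo \<open>p ^ l i\<close> because it multiplies
  \<open>gen p l i\<close>, and modulo \<open>p ^ l j\<close> because the lift \<open>f j\<close> may be changed by elements of the
  image of \<open>\<iota>\<close>.
\<close>

definition ext_of_matrix ::
    "'k::field poly \<Rightarrow> ('n::finite \<Rightarrow> nat) \<Rightarrow> 'k poly ^ 'n ^ 'n \<Rightarrow>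
     ('k poly, 'k poly ^ 'n, 'k poly ^ 'n) ext set" where
  "ext_of_matrix p l E = {(L, \<iota>, q) \<in> extensions kt (tmod p l) (tmod p l).
     \<exists>f. \<forall>j. f j \<in> carrier L \<and> q (f j) = gen p l j \<and>
       (p ^ l j) \<odot>\<^bsub>L\<^esub> f j = (\<Oplus>\<^bsub>L\<^esub> i\<in>UNIV. E $ i $ j \<odot>\<^bsub>L\<^esub> \<iota> (gen p l i))}"


section \<open>The partition \<open>(m + 1, 1, 1)\<close>\<close>

definition lam :: "nat \<Rightarrow> 3 \<Rightarrow> nat" where
  "lam m j = (if j = 1 then m + 1 else 1)"

abbreviation M_lam :: "'k::field poly \<Rightarrow> nat \<Rightarrow> ('k poly, 'k poly ^ 3) module" where
  "M_lam p m \<equiv> tmod p (lam m)"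

abbreviation G_lam :: "'k::field poly \<Rightarrow> nat \<Rightarrow> ('k poly ^ 3 \<Rightarrow> 'k poly ^ 3) monoid" where
  "G_lam p m \<equiv> mod_Aut kt (M_lam p m)"

abbreviation E_lam :: "'k::field poly \<Rightarrow> nat \<Rightarrow> ('k poly, 'k poly ^ 3, 'k poly ^ 3) ext set set" where
  "E_lam p m \<equiv> Ext1 kt (M_lam p m) (M_lam p m)"

abbreviation act_lam ::
    "'k::field poly \<Rightarrow> nat \<Rightarrow> ('k poly ^ 3 \<Rightarrow> 'k poly ^ 3) \<Rightarrow>
     ('k poly, 'k poly ^ 3, 'k poly ^ 3) ext set \<Rightarrow> ('k poly, 'k poly ^ 3, 'k poly ^ 3) ext set" where
  "act_lam p m \<equiv> ext_act kt (M_lam p m)"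


subsection \<open>Vectors and matrices over \<open>K = k[t]/p\<close>\<close>

definition vecK :: "'k::field poly \<Rightarrow> ('k poly ^ 2) set" where
  "vecK p = {v. \<forall>i. v $ i \<in> resid p}"

definition matK :: "'k::field poly \<Rightarrow> ('k poly ^ 2 ^ 2) set" where
  "matK p = {A. \<forall>i j. A $ i $ j \<in> resid p}"

definition mulK :: "'k::field poly \<Rightarrow> 'k poly ^ 2 ^ 2 \<Rightarrow> 'k poly ^ 2 ^ 2 \<Rightarrow> 'k poly ^ 2 ^ 2" where
  "mulK p A B = (\<chi> i j. (A ** B) $ i $ j mod p)"

definition GL2K :: "'k::field poly \<Rightarrow> ('k poly ^ 2 ^ 2) set" where
  "GL2K p = {D \<in> matK p. \<exists>D' \<in> matK p. mulK p D D' = mat 1 \<and> mulK p D' D = mat 1}"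

definition centralizerK :: "'k::field poly \<Rightarrow> 'k poly ^ 2 ^ 2 \<Rightarrow> ('k poly ^ 2 ^ 2) set" where
  "centralizerK p W = {D \<in> GL2K p. mulK p D W = mulK p W D}"

text \<open>
  The rational canonical forms of size two: the invariant factors are either \<open>z - w, z - w\<close>,
  giving a scalar matrix, or the single polynomial \<open>z\<^sup>2 - d z - c\<close>, giving its companion matrix.
\<close>

definition rational_forms :: "'k::field poly \<Rightarrow> ('k poly ^ 2 ^ 2) set" where
  "rational_forms p =
     {vector [vector [w, 0], vector [0, w]] | w. w \<in> resid p} \<union>
     {vector [vector [0, c], vector [1, d]] | c d. c \<in> resid p \<and> d \<in> resid p}"


subsection \<open>The list of representatives and isotropy groups\<close>

definition block :: "'k::field poly \<Rightarrow> 'k poly ^ 2 \<Rightarrow> 'k poly ^ 2 \<Rightarrow> 'k poly ^ 2 ^ 2 \<Rightarrow> 'k poly ^ 3 ^ 3" where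
  "block a b c D = vector
     [vector [a,     b $ 1,     b $ 2],
      vector [c $ 1, D $ 1 $ 1, D $ 1 $ 2],
      vector [c $ 2, D $ 2 $ 1, D $ 2 $ 2]]"

abbreviation mat3 :: "'k::field poly list list \<Rightarrow> 'k poly ^ 3 ^ 3" where
  "mat3 rs \<equiv> vector (map vector rs)"

text \<open>
  The pairs consisting of a representative and its isotropy group, both given by matrices.  The
  matrix of an automorphism has its first row in \<open>S = k[t]/p\<^bsup>m+1\<^esup>\<close> and the other two rows in
  \<open>K\<close>.  The parameter \<open>T\<close> is the chosen system of representatives in \<open>S\<close> of
  the classes in \<open>k[t]/p\<^bsup>m\<^esup>\<close> that are divisible by \<open>p\<close>.
\<close>

inductive_set orbit_table ::
    "'k::field poly \<Rightarrow> nat \<Rightarrow> 'k poly set \<Rightarrow> (('k poly ^ 3 ^ 3) \<times> ('k poly ^ 3 ^ 3) set) set"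
  for p :: "'k::field poly" and m :: nat and T :: "'k poly set" where
  diag_nonunit:
    "\<lbrakk>x \<in> resid (p ^ (m + 1)); p dvd x; W \<in> rational_forms p\<rbrakk> \<Longrightarrow>
     (block x 0 0 W,
      {block a (p ^ m *s b) c D | a b c D.
         a \<in> resid_units (p ^ (m + 1)) \<and> b \<in> vecK p \<and> c \<in> vecK p \<and> D \<in> centralizerK p W})
     \<in> orbit_table p m T"
| diag_unit:
    "\<lbrakk>x \<in> resid (p ^ (m + 1)); coprime x p; W \<in> rational_forms p\<rbrakk> \<Longrightarrow>
     (block x 0 0 W,
      {block a 0 0 D | a D. a \<in> resid_units (p ^ (m + 1)) \<and> D \<in> centralizerK p W})
     \<in> orbit_table p m T"
| both_nonorthogonal:
    "\<lbrakk>x \<in> T; r \<in> resid p; u \<in> resid p; v \<in> resid p; r \<noteq> 0\<rbrakk> \<Longrightarrow>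
     (mat3 [[x, 1, 0],
            [r, u, 0],
            [0, 0, v]],
      {mat3 [[a,             p ^ m * b, 0],
             [(b * r) mod p, a mod p,   0],
             [0,             0,         d]] | a b d.
         a \<in> resid_units (p ^ (m + 1)) \<and> b \<in> resid p \<and> d \<in> resid_units p})
     \<in> orbit_table p m T"
| both_orthogonal:
    "\<lbrakk>x \<in> T; u \<in> resid p; v \<in> resid p\<rbrakk> \<Longrightarrow>
     (mat3 [[x, 1, 0],
            [0, 0, u],
            [1, 0, v]],
      {mat3 [[a,                 p ^ m * b, p ^ m * ((u * d) mod p)],
             [(u * d) mod p,     a mod p,   0],
             [(b + v * d) mod p, d,         a mod p]] | a b d.
         a \<in> resid_units (p ^ (m + 1)) \<and> b \<in> resid p \<and> d \<in> resid p})
     \<in> orbit_table p m T"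
| row_nondiag:
    "\<lbrakk>x \<in> T; w \<in> resid p\<rbrakk> \<Longrightarrow>
     (mat3 [[x, 1, 0],
            [0, 0, 1],
            [0, 0, w]],
      {mat3 [[a, p ^ m * b1, p ^ m * b2],
             [0, a mod p,    0],
             [0, 0,          a mod p]] | a b1 b2.
         a \<in> resid_units (p ^ (m + 1)) \<and> b1 \<in> resid p \<and> b2 \<in> resid p})
     \<in> orbit_table p m T"
| row_diag:
    "\<lbrakk>x \<in> T; u \<in> resid p; w \<in> resid p\<rbrakk> \<Longrightarrow>
     (mat3 [[x, 1, 0],
            [0, u, 0],
            [0, 0, w]],
      {mat3 [[a,                   p ^ m * b1, p ^ m * b2],
             [0,                   a mod p,    0],
             [(d * (w - u)) mod p, d,          e]] | a b1 b2 d e.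
         a \<in> resid_units (p ^ (m + 1)) \<and> b1 \<in> resid p \<and> b2 \<in> resid p \<and> d \<in> resid p \<and>
         e \<in> resid_units p})
     \<in> orbit_table p m T"
| column_nondiag:
    "\<lbrakk>x \<in> T; w \<in> resid p\<rbrakk> \<Longrightarrow>
     (mat3 [[x, 0, 0],
            [1, 0, 0],
            [0, 1, w]],
      {mat3 [[a,  0,       0],
             [c1, a mod p, 0],
             [c2, 0,       a mod p]] | a c1 c2.
         a \<in> resid_units (p ^ (m + 1)) \<and> c1 \<in> resid p \<and> c2 \<in> resid p})
     \<in> orbit_table p m T"
| column_diag:
    "\<lbrakk>x \<in> T; u \<in> resid p; w \<in> resid p\<rbrakk> \<Longrightarrow>
     (mat3 [[x, 0, 0],
            [1, u, 0],
            [0, 0, w]],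
      {mat3 [[a,  0,       p ^ m * ((d * (w - u)) mod p)],
             [c1, a mod p, d],
             [c2, 0,       e]] | a c1 c2 d e.
         a \<in> resid_units (p ^ (m + 1)) \<and> c1 \<in> resid p \<and> c2 \<in> resid p \<and> d \<in> resid p \<and>
         e \<in> resid_units p})
     \<in> orbit_table p m T"

end

theory Submission
  imports Defs
begin

text \<open>
  An extension of \<open>M = \<Oplus> k[t]/p\<^bsup>l j\<^esup>\<close> by itself is governed by a matrix: lift the generator \<open>e\<^sub>j\<close> to
  \<open>f\<^sub>j\<close> and expand \<open>p\<^bsup>l j\<^esup> f\<^sub>j\<close>, which lies in the submodule, in terms of the generators there.
  Addition with carry, with the columns of the matrix as the carries, yields an extension with any
  prescribed matrix (\<open>std_ext_extension\<close>). It maps to every other extension with that matrix, and by the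
  short five lemma the map is an equivalence (\<open>std_ext_universal\<close>). The only freedom left is the choice of
  the lifts, so that the entry \<open>(i, j)\<close> counts modulo \<open>p\<close> to the power \<open>min (l i) (l j)\<close>
  (\<open>ext_of_matrix_eq_iff\<close>). If \<open>g\<close> has the matrix \<open>A\<close> and \<open>A\<^sup>#\<close> is defined by
  \<open>p\<^bsup>l i\<^esup> A\<^sup>#\<^sub>i\<^sub>j = A\<^sub>i\<^sub>j p\<^bsup>l j\<^esup>\<close>, then \<open>g\<close> maps the class of \<open>E\<close> to that of \<open>E'\<close> if and only if
  \<open>A E \<equiv> E' A\<^sup>#\<close> (\<open>act_matrix_iff\<close>).

  For the partition \<open>(m + 1, 1, 1)\<close> let \<open>E\<close> have the blocks \<open>x, y, z, W\<close>, and let \<open>A\<close> have the blocks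
  \<open>a, p\<^sup>m b, c, D\<close>. The condition becomes
  \<open>a (x - x') + p\<^sup>m (b z - y' c) \<equiv> 0\<close> modulo \<open>p\<^bsup>m+1\<^esup>\<close>, together with the equations
  \<open>a y = x' b + y' D\<close>, \<open>c x + D z = z' a\<close> and \<open>c y + D W = z' b + W' D\<close> over \<open>K = k[t]/p\<close>.
  Evaluation at a root of \<open>p\<close> embeds \<open>K\<close> into an algebraic closure of \<open>k\<close>, so that the last three
  are equations between elements of a field (\<open>moves_iff\<close>).

  The residue of \<open>x\<close> modulo \<open>p\<close> is an invariant. If it is not zero, then \<open>b\<close> and \<open>c\<close> clear \<open>y\<close> and \<open>z\<close>,
  after which \<open>x\<close> is fixed and \<open>D\<close> acts on \<open>W\<close> by conjugation. If \<open>p\<close> divides \<open>x\<close>, then \<open>y\<close> and \<open>z\<close> only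
  undergo changes of basis and a common change of scale. Whether they vanish is therefore an invariant,
  and so is the product \<open>y z\<close>. These invariants separate the cases, except that there are two families with
  \<open>y \<noteq> 0\<close> and \<open>z = 0\<close>, and two with \<open>y = 0\<close> and \<open>z \<noteq> 0\<close>; an off-diagonal entry of \<open>W\<close> tells them apart.
  For \<open>y = z = 0\<close> again \<open>x\<close> is fixed and \<open>W\<close> counts up to similarity. Otherwise \<open>D\<close> brings \<open>(y, z)\<close> to a
  normal form, while \<open>b\<close> and \<open>c\<close> change \<open>W\<close> by \<open>c y - z b\<close> and \<open>x\<close> by a multiple of \<open>p\<^sup>m\<close>; this allows
  for a shift of \<open>x\<close> to the chosen representative of its class modulo \<open>p\<^sup>m\<close> and for clearing entries of
  \<open>W\<close> (\<open>every_matrix_represented\<close>). The remaining entries can be read off from the equations, which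
  gives uniqueness (\<open>table_unique\<close>), and with \<open>E = E'\<close> the same equations describe the isotropy group
  (\<open>table_isotropy\<close>).
\<close>

(* Otherwise every component of a vector would also be parsed as a coefficient of a power series. *)
no_notation fps_nth (infixl \<open>$\<close> 75)

section \<open>The action on equivalence classes of extensions\<close>

lemma carrier_mod_Aut: "carrier (mod_Aut R M) = mod_hom R M M \<inter> Bij (carrier M)"
  by (simp add: mod_Aut_def)

lemma mod_hom_zero:
  assumes "Module.module R M" "Module.module R N" "h \<in> mod_hom R M N"
  shows "h \<zero>\<^bsub>M\<^esub> = \<zero>\<^bsub>N\<^esub>"
proof -
  interpret M: Module.module R M by fact
  interpret N: Module.module R N by fact
  have "h \<zero>\<^bsub>M\<^esub> = h (\<zero>\<^bsub>R\<^esub> \<odot>\<^bsub>M\<^esub> \<zero>\<^bsub>M\<^esub>)" by simp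
  also have "\<dots> = \<zero>\<^bsub>R\<^esub> \<odot>\<^bsub>N\<^esub> h \<zero>\<^bsub>M\<^esub>"
    using assms(3) M.R.zero_closed M.M.zero_closed unfolding mod_hom_def by blast
  also have "\<dots> = \<zero>\<^bsub>N\<^esub>"
    using assms(3) by (intro N.smult_l_null) (auto simp: mod_hom_def)
  finally show ?thesis .
qed

lemma mod_hom_comp:
  assumes "h \<in> mod_hom R M N" "g \<in> mod_hom R N P"
  shows "g \<circ> h \<in> mod_hom R M P"
  using assms unfolding mod_hom_def by (auto simp: Pi_iff)

lemma mod_hom_inv_into:
  assumes "Module.module R M" and "h \<in> mod_hom R M N" and bij: "bij_betw h (carrier M) (carrier N)"
  shows "inv_into (carrier M) h \<in> mod_hom R N M"
proof -
  interpret M: Module.module R M by fact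
  let ?k = "inv_into (carrier M) h"
  have k: "?k y \<in> carrier M" "h (?k y) = y" if "y \<in> carrier N" for y
    using that bij by (auto simp: bij_betw_def f_inv_into_f inv_into_into)
  have kh: "?k (h x) = x" if "x \<in> carrier M" for x
    using that bij by (simp add: bij_betw_def)
  have add: "?k (x \<oplus>\<^bsub>N\<^esub> y) = ?k x \<oplus>\<^bsub>M\<^esub> ?k y" if "x \<in> carrier N" "y \<in> carrier N" for x y
  proof -
    have "x \<oplus>\<^bsub>N\<^esub> y = h (?k x \<oplus>\<^bsub>M\<^esub> ?k y)"
      using that k assms(2) unfolding mod_hom_def by simp
    then show ?thesis using kh k that by simp
  qed
  have sm: "?k (r \<odot>\<^bsub>N\<^esub> x) = r \<odot>\<^bsub>M\<^esub> ?k x" if "x \<in> carrier N" "r \<in> carrier R" for x r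
  proof -
    have "r \<odot>\<^bsub>N\<^esub> x = h (r \<odot>\<^bsub>M\<^esub> ?k x)"
      using that k assms(2) unfolding mod_hom_def by simp
    then show ?thesis using kh k that by simp
  qed
  show ?thesis using k add sm unfolding mod_hom_def by auto
qed

lemma id_mod_hom: "(\<lambda>x. x) \<in> mod_hom R M M"
  by (auto simp: mod_hom_def)

lemma mod_hom_cong:
  assumes "h \<in> mod_hom R M N" "Module.module R M" "\<And>x. x \<in> carrier M \<Longrightarrow> h' x = h x"
  shows "h' \<in> mod_hom R M N"
proof -
  interpret M: Module.module R M by fact
  show ?thesis using assms(1,3) unfolding mod_hom_def by (auto simp: Pi_iff)
qed

lemma extensions_module: "(L, i, q) \<in> extensions R A B \<Longrightarrow> Module.module R L"
  by (simp add: extensions_def)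

lemma ext_equiv_refl: "e \<in> extensions R A B \<Longrightarrow> (e, e) \<in> ext_equiv R A B"
  by (cases e) (auto simp: ext_equiv_def bij_betw_def intro!: bexI[OF _ id_mod_hom])

lemma ext_equiv_sym:
  assumes "(e, e') \<in> ext_equiv R A B"
  shows "(e', e) \<in> ext_equiv R A B"
proof -
  obtain L i q where e: "e = (L, i, q)" by (cases e)
  obtain L' i' q' where e': "e' = (L', i', q')" by (cases e')
  from assms e e' obtain \<phi> where ex: "(L, i, q) \<in> extensions R A B" "(L', i', q') \<in> extensions R A B"
    and \<phi>: "\<phi> \<in> mod_hom R L L'" "bij_betw \<phi> (carrier L) (carrier L')"
    "\<And>b. b \<in> carrier B \<Longrightarrow> \<phi> (i b) = i' b" "\<And>x. x \<in> carrier L \<Longrightarrow> q' (\<phi> x) = q x"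
    by (auto simp: ext_equiv_def)
  let ?k = "inv_into (carrier L) \<phi>"
  have "?k \<in> mod_hom R L' L" using mod_hom_inv_into extensions_module[OF ex(1)] \<phi> by blast
  moreover have "bij_betw ?k (carrier L') (carrier L)" using \<phi>(2) by (rule bij_betw_inv_into)
  moreover have "?k (i' b) = i b" if "b \<in> carrier B" for b
  proof -
    have "i b \<in> carrier L" using ex(1) that by (auto simp: extensions_def mod_hom_def)
    then show ?thesis using \<phi>(2,3) that by (metis bij_betw_inv_into_left)
  qed
  moreover have "q (?k x) = q' x" if "x \<in> carrier L'" for x
    using \<phi>(4)[of "?k x"] bij_betw_inv_into_right[OF \<phi>(2) that]
      bij_betw_apply[OF bij_betw_inv_into[OF \<phi>(2)] that] by simp
  ultimately show ?thesis using ex unfolding e e' ext_equiv_def by blast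
qed

lemma ext_equiv_trans:
  assumes "(e, e') \<in> ext_equiv R A B" "(e', e'') \<in> ext_equiv R A B"
  shows "(e, e'') \<in> ext_equiv R A B"
proof -
  obtain L i q where e: "e = (L, i, q)" by (cases e)
  obtain L' i' q' where e': "e' = (L', i', q')" by (cases e')
  obtain L'' i'' q'' where e'': "e'' = (L'', i'', q'')" by (cases e'')
  from assms(1) e e' obtain \<phi> where ex: "(L, i, q) \<in> extensions R A B"
    and \<phi>: "\<phi> \<in> mod_hom R L L'" "bij_betw \<phi> (carrier L) (carrier L')"
    "\<And>b. b \<in> carrier B \<Longrightarrow> \<phi> (i b) = i' b" "\<And>x. x \<in> carrier L \<Longrightarrow> q' (\<phi> x) = q x"
    by (auto simp: ext_equiv_def)
  from assms(2) e' e'' obtain \<psi> where ex'': "(L'', i'', q'') \<in> extensions R A B"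
    and \<psi>: "\<psi> \<in> mod_hom R L' L''" "bij_betw \<psi> (carrier L') (carrier L'')"
    "\<And>b. b \<in> carrier B \<Longrightarrow> \<psi> (i' b) = i'' b" "\<And>x. x \<in> carrier L' \<Longrightarrow> q'' (\<psi> x) = q' x"
    by (auto simp: ext_equiv_def)
  have "\<psi> \<circ> \<phi> \<in> mod_hom R L L''" "bij_betw (\<psi> \<circ> \<phi>) (carrier L) (carrier L'')"
    using \<phi> \<psi> mod_hom_comp bij_betw_trans by blast+
  moreover have "(\<psi> \<circ> \<phi>) (i b) = i'' b" if "b \<in> carrier B" for b
    using \<phi>(3) \<psi>(3) that by simp
  moreover have "q'' ((\<psi> \<circ> \<phi>) x) = q x" if "x \<in> carrier L" for x
    using \<phi> \<psi>(4) that by (simp add: bij_betw_apply)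
  ultimately show ?thesis using ex ex'' e e'' unfolding ext_equiv_def by blast
qed

lemma ext_equiv_in: "(e, e') \<in> ext_equiv R A B \<Longrightarrow> e \<in> extensions R A B \<and> e' \<in> extensions R A B"
  by (auto simp: ext_equiv_def)

lemma ext_class_eq: 
  assumes "(e, e') \<in> ext_equiv R A B"
  shows "ext_equiv R A B `` {e} = ext_equiv R A B `` {e'}"
  using ext_equiv_trans[OF assms] ext_equiv_trans[OF ext_equiv_sym[OF assms]] by auto

lemma Aut_inverse_closed:
  assumes "Module.module R M" "g \<in> carrier (mod_Aut R M)"
  shows "restrict (inv_into (carrier M) g) (carrier M) \<in> carrier (mod_Aut R M)"
proof -
  have g: "g \<in> mod_hom R M M" "g \<in> Bij (carrier M)" using assms(2) by (auto simp: carrier_mod_Aut)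
  have "inv_into (carrier M) g \<in> mod_hom R M M"
    using assms(1) g by (intro mod_hom_inv_into) (auto simp: Bij_def)
  then have "restrict (inv_into (carrier M) g) (carrier M) \<in> mod_hom R M M"
    using assms(1) by (rule mod_hom_cong) auto
  then show ?thesis using g restrict_inv_into_Bij by (auto simp: carrier_mod_Aut)
qed

lemma Aut_compose_closed:
  assumes "Module.module R M" "g \<in> carrier (mod_Aut R M)" "h \<in> carrier (mod_Aut R M)"
  shows "compose (carrier M) g h \<in> carrier (mod_Aut R M)"
proof -
  have "g \<circ> h \<in> mod_hom R M M"
    using assms by (auto simp: carrier_mod_Aut intro: mod_hom_comp)
  then have "compose (carrier M) g h \<in> mod_hom R M M"
    using assms(1) by (rule mod_hom_cong) (auto simp: compose_def)
  then show ?thesis using assms compose_Bij by (auto simp: carrier_mod_Aut)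
qed

lemma Aut_bij: "g \<in> carrier (mod_Aut R M) \<Longrightarrow> bij_betw g (carrier M) (carrier M)"
  by (auto simp: carrier_mod_Aut Bij_def)

lemma Aut_hom: "g \<in> carrier (mod_Aut R M) \<Longrightarrow> g \<in> mod_hom R M M"
  by (auto simp: carrier_mod_Aut)

lemma ext_conj_extension:
  assumes M: "Module.module R M" and g: "g \<in> carrier (mod_Aut R M)" and e: "e \<in> extensions R M M"
  shows "ext_conj M g e \<in> extensions R M M"
proof -
  obtain L i q where L: "e = (L, i, q)" by (cases e)
  note ex = e[unfolded L extensions_def, simplified]
  note gb = Aut_bij[OF g] and gh = Aut_hom[OF g]
  let ?k = "inv_into (carrier M) g"
  have kb: "bij_betw ?k (carrier M) (carrier M)" using gb by (rule bij_betw_inv_into)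
  have kh: "?k \<in> mod_hom R M M" using M gh gb by (rule mod_hom_inv_into)
  have 1: "i \<circ> ?k \<in> mod_hom R M L" "g \<circ> q \<in> mod_hom R L M"
    using ex by (auto intro: mod_hom_comp[OF kh] mod_hom_comp[OF _ gh])
  have 2: "inj_on (i \<circ> ?k) (carrier M)"
    using ex kb by (intro comp_inj_on) (auto simp: bij_betw_def)
  have "(g \<circ> q) ` carrier L = g ` q ` carrier L" by (simp only: image_comp)
  also have "\<dots> = carrier M" using ex gb by (simp add: bij_betw_def)
  finally have 3: "(g \<circ> q) ` carrier L = carrier M" .
  have "(i \<circ> ?k) ` carrier M = i ` ?k ` carrier M" by (simp only: image_comp)
  also have "\<dots> = i ` carrier M" using kb by (simp add: bij_betw_def)
  finally have 4: "(i \<circ> ?k) ` carrier M = i ` carrier M" .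
  have z: "g \<zero>\<^bsub>M\<^esub> = \<zero>\<^bsub>M\<^esub>" using mod_hom_zero[OF M M gh] .
  have zc: "\<zero>\<^bsub>M\<^esub> \<in> carrier M"
  proof - interpret Module.module R M by fact show ?thesis by simp qed
  have 5: "g (q x) = \<zero>\<^bsub>M\<^esub> \<longleftrightarrow> q x = \<zero>\<^bsub>M\<^esub>" if "x \<in> carrier L" for x
  proof -
    have "q x \<in> carrier M" using ex that by (auto simp: mod_hom_def)
    then show ?thesis using gb z zc by (metis bij_betw_inv_into_left)
  qed
  show ?thesis using ex 1 2 3 4 5 L by (auto simp: ext_conj_def extensions_def)
qed

lemma ext_conj_cong:
  assumes M: "Module.module R M" and g: "g \<in> carrier (mod_Aut R M)" and e: "(e, e') \<in> ext_equiv R M M"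
  shows "(ext_conj M g e, ext_conj M g e') \<in> ext_equiv R M M"
proof -
  obtain L i q where L: "e = (L, i, q)" by (cases e)
  obtain L' i' q' where L': "e' = (L', i', q')" by (cases e')
  have ee: "e \<in> extensions R M M" "e' \<in> extensions R M M" using e ext_equiv_in by blast+
  from e L L' obtain \<phi> where
    \<phi>: "\<phi> \<in> mod_hom R L L'" "bij_betw \<phi> (carrier L) (carrier L')"
    "\<And>b. b \<in> carrier M \<Longrightarrow> \<phi> (i b) = i' b" "\<And>x. x \<in> carrier L \<Longrightarrow> q' (\<phi> x) = q x"
    by (auto simp: ext_equiv_def)
  have "inv_into (carrier M) g b \<in> carrier M" if "b \<in> carrier M" for b
    using that Aut_bij[OF g] by (metis bij_betw_apply bij_betw_inv_into)
  then show ?thesis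
    using \<phi> ext_conj_extension[OF M g ee(1)] ext_conj_extension[OF M g ee(2)]
    unfolding L L' by (auto simp: ext_conj_def ext_equiv_def)
qed

text \<open>
  The image of a class is a single class because pushing out and pulling back preserve equivalence; any
  member of the class may be used to compute it.
\<close>

lemma ext_act_class:
  assumes M: "Module.module R M" and g: "g \<in> carrier (mod_Aut R M)" and e: "e \<in> extensions R M M"
  shows "ext_act R M g (ext_equiv R M M `` {e}) = ext_equiv R M M `` {ext_conj M g e}"
proof -
  have "ext_equiv R M M `` {ext_conj M g e'} = ext_equiv R M M `` {ext_conj M g e}"
    if "(e, e') \<in> ext_equiv R M M" for e'
    using ext_class_eq[OF ext_conj_cong[OF M g that]] by simp
  then have "(\<Union>e'\<in>ext_equiv R M M `` {e}. ext_equiv R M M `` {ext_conj M g e'})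
      = (\<Union>e'\<in>ext_equiv R M M `` {e}. ext_equiv R M M `` {ext_conj M g e})"
    by (intro SUP_cong) auto
  also have "\<dots> = ext_equiv R M M `` {ext_conj M g e}"
    using ext_equiv_refl[OF e] by auto
  finally show ?thesis unfolding ext_act_def by blast
qed

lemma ext_equiv_same_module:
  assumes "(L, i, q) \<in> extensions R A B" "(L, i', q') \<in> extensions R A B"
    "\<And>b. b \<in> carrier B \<Longrightarrow> i b = i' b" "\<And>x. x \<in> carrier L \<Longrightarrow> q' x = q x"
  shows "((L, i, q), (L, i', q')) \<in> ext_equiv R A B"
  using assms by (auto simp: ext_equiv_def bij_betw_def intro!: bexI[OF _ id_mod_hom])

lemma ext_act_compose:
  assumes M: "Module.module R M" and g: "g \<in> carrier (mod_Aut R M)" and h: "h \<in> carrier (mod_Aut R M)"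
    and xi: "\<xi> \<in> Ext1 R M M"
  shows "ext_act R M g (ext_act R M h \<xi>) = ext_act R M (compose (carrier M) g h) \<xi>"
proof -
  obtain e where e: "e \<in> extensions R M M" and xe: "\<xi> = ext_equiv R M M `` {e}"
    using xi by (auto simp: Ext1_def elim: quotientE)
  obtain L i q where L: "e = (L, i, q)" by (cases e)
  note gh = Aut_compose_closed[OF M g h]
  have 1: "ext_act R M g (ext_act R M h \<xi>) = ext_equiv R M M `` {ext_conj M g (ext_conj M h e)}"
    unfolding xe using M g h e by (simp add: ext_act_class ext_conj_extension)
  have 2: "ext_act R M (compose (carrier M) g h) \<xi> = ext_equiv R M M `` {ext_conj M (compose (carrier M) g h) e}"
    unfolding xe using M gh e by (simp add: ext_act_class)
  have inv: "inv_into (carrier M) h (inv_into (carrier M) g b) = inv_into (carrier M) (compose (carrier M) g h) b"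
    if b: "b \<in> carrier M" for b
  proof -
    define c where "c = inv_into (carrier M) h (inv_into (carrier M) g b)"
    have c: "c \<in> carrier M" "g (h c) = b"
      using b Aut_bij[OF g] Aut_bij[OF h] unfolding c_def
      by (metis bij_betw_apply bij_betw_inv_into bij_betw_inv_into_right)+
    then have "compose (carrier M) g h c = b" by (simp add: compose_def)
    then show ?thesis using c(1) Aut_bij[OF gh] c_def bij_betw_inv_into_left by metis
  qed
  have qc: "q x \<in> carrier M" if "x \<in> carrier L" for x
    using e that unfolding L by (auto simp: extensions_def mod_hom_def)
  have "(ext_conj M g (ext_conj M h e), ext_conj M (compose (carrier M) g h) e) \<in> ext_equiv R M M"
    using ext_conj_extension[OF M g ext_conj_extension[OF M h e]] ext_conj_extension[OF M gh e]
    unfolding L ext_conj_def prod.case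
    by (rule ext_equiv_same_module) (auto simp: inv qc compose_def)
  then show ?thesis using 1 2 ext_class_eq by metis
qed

lemma ext_act_closed:
  assumes M: "Module.module R M" and g: "g \<in> carrier (mod_Aut R M)" and xi: "\<xi> \<in> Ext1 R M M"
  shows "ext_act R M g \<xi> \<in> Ext1 R M M"
proof -
  obtain e where e: "e \<in> extensions R M M" and xe: "\<xi> = ext_equiv R M M `` {e}"
    using xi by (auto simp: Ext1_def elim: quotientE)
  show ?thesis unfolding xe ext_act_class[OF M g e] Ext1_def
    using ext_conj_extension[OF M g e] by (rule quotientI)
qed

lemma ext_act_identity:
  assumes M: "Module.module R M" and g: "g \<in> carrier (mod_Aut R M)"
    and id: "\<And>x. x \<in> carrier M \<Longrightarrow> g x = x" and xi: "\<xi> \<in> Ext1 R M M"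
  shows "ext_act R M g \<xi> = \<xi>"
proof -
  obtain e where e: "e \<in> extensions R M M" and xe: "\<xi> = ext_equiv R M M `` {e}"
    using xi by (auto simp: Ext1_def elim: quotientE)
  obtain L i q where L: "e = (L, i, q)" by (cases e)
  have inv: "inv_into (carrier M) g b = b" if "b \<in> carrier M" for b
    using that id Aut_bij[OF g] bij_betw_inv_into_left by metis
  have qc: "q x \<in> carrier M" if "x \<in> carrier L" for x
    using e that unfolding L by (auto simp: extensions_def mod_hom_def)
  have "(ext_conj M g e, e) \<in> ext_equiv R M M"
    using ext_conj_extension[OF M g e] e
    unfolding L ext_conj_def prod.case
    by (rule ext_equiv_same_module) (auto simp: inv qc id)
  then show ?thesis unfolding xe ext_act_class[OF M g e] using ext_class_eq by metis
qed

text \<open>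
  Two points of an orbit are images of a common point, and the inverse of one of the two automorphisms
  leads from one to the other.
\<close>

lemma orbit_transitive:
  assumes M: "Module.module R M" and Ob: "Ob \<in> orbits (mod_Aut R M) (Ext1 R M M) (ext_act R M)"
    and xi: "\<xi> \<in> Ob" and eta: "\<eta> \<in> Ob"
  shows "\<exists>g\<in>carrier (mod_Aut R M). ext_act R M g \<xi> = \<eta>"
proof -
  obtain \<zeta> g h where z: "\<zeta> \<in> Ext1 R M M" and g: "g \<in> carrier (mod_Aut R M)" and h: "h \<in> carrier (mod_Aut R M)"
    and eq: "\<xi> = ext_act R M g \<zeta>" "\<eta> = ext_act R M h \<zeta>"
    using Ob xi eta by (auto simp: orbits_def orbit_def)
  let ?k = "restrict (inv_into (carrier M) g) (carrier M)"
  have k: "?k \<in> carrier (mod_Aut R M)" using Aut_inverse_closed[OF M g] .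
  have kg: "compose (carrier M) ?k g x = x" if "x \<in> carrier M" for x
    using that Aut_bij[OF g] by (simp add: compose_def bij_betw_apply bij_betw_inv_into_left)
  have "ext_act R M ?k \<xi> = \<zeta>"
    unfolding eq ext_act_compose[OF M k g z]
    using M Aut_compose_closed[OF M k g] kg z by (rule ext_act_identity)
  then have "ext_act R M (compose (carrier M) h ?k) \<xi> = \<eta>"
    using ext_act_compose[OF M h k, of \<xi>] ext_act_closed[OF M g z] eq by simp
  then show ?thesis using Aut_compose_closed[OF M h k] by blast
qed

section \<open>Extensions of torsion modules with a prescribed matrix\<close>

lemma finsum_mod_hom:
  assumes M: "Module.module R M" and N: "Module.module R N" and h: "h \<in> mod_hom R M N"
    and "finite A" "f \<in> A \<rightarrow> carrier M"
  shows "h (finsum M f A) = finsum N (\<lambda>a. h (f a)) A"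
proof -
  interpret M: Module.module R M by fact
  interpret N: Module.module R N by fact
  have hc: "h x \<in> carrier N" if "x \<in> carrier M" for x using h that by (auto simp: mod_hom_def)
  have ha: "h (x \<oplus>\<^bsub>M\<^esub> y) = h x \<oplus>\<^bsub>N\<^esub> h y" if "x \<in> carrier M" "y \<in> carrier M" for x y
    using h that by (auto simp: mod_hom_def)
  show ?thesis using assms(4,5)
    by (induction A rule: finite_induct) (auto simp: mod_hom_zero[OF M N h] hc ha Pi_iff)
qed

text \<open>
  Injectivity and surjectivity come from the usual diagram chase, so that the equivalences below are
  established by writing down a homomorphism.
\<close>

lemma short_five:
  assumes e: "(L, i, q) \<in> extensions R A B" and e': "(L', i', q') \<in> extensions R A B"
    and B: "Module.module R B"
    and \<phi>: "\<phi> \<in> mod_hom R L L'"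
    and i: "\<And>b. b \<in> carrier B \<Longrightarrow> \<phi> (i b) = i' b" and q: "\<And>x. x \<in> carrier L \<Longrightarrow> q' (\<phi> x) = q x"
    and A: "Module.module R A"
  shows "((L, i, q), (L', i', q')) \<in> ext_equiv R A B"
proof -
  note ex = e[unfolded extensions_def, simplified] e'[unfolded extensions_def, simplified]
  interpret L: Module.module R L using ex by blast
  interpret L': Module.module R L' using ex by blast
  interpret A: Module.module R A by fact
  interpret B: Module.module R B by fact
  have add: "\<phi> (x \<oplus>\<^bsub>L\<^esub> y) = \<phi> x \<oplus>\<^bsub>L'\<^esub> \<phi> y" "\<phi> x \<in> carrier L'" if "x \<in> carrier L" "y \<in> carrier L" for x y
    using \<phi> that by (auto simp: mod_hom_def)
  have qadd: "q (x \<oplus>\<^bsub>L\<^esub> y) = q x \<oplus>\<^bsub>A\<^esub> q y" "q x \<in> carrier A" if "x \<in> carrier L" "y \<in> carrier L" for x y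
    using ex that by (auto simp: mod_hom_def)
  have q'add: "q' (x \<oplus>\<^bsub>L'\<^esub> y) = q' x \<oplus>\<^bsub>A\<^esub> q' y" "q' x \<in> carrier A" if "x \<in> carrier L'" "y \<in> carrier L'" for x y
    using ex that by (auto simp: mod_hom_def)
  have ic: "i b \<in> carrier L" if "b \<in> carrier B" for b using ex that by (auto simp: mod_hom_def)
  have \<phi>0: "\<phi> \<zero>\<^bsub>L\<^esub> = \<zero>\<^bsub>L'\<^esub>" and i0: "i \<zero>\<^bsub>B\<^esub> = \<zero>\<^bsub>L\<^esub>" and i'0: "i' \<zero>\<^bsub>B\<^esub> = \<zero>\<^bsub>L'\<^esub>"
    and q'0: "q' \<zero>\<^bsub>L'\<^esub> = \<zero>\<^bsub>A\<^esub>"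
    using mod_hom_zero[OF _ _ \<phi>] mod_hom_zero[of R B L i] mod_hom_zero[of R B L' i']
      mod_hom_zero[of R L' A q'] ex A B by blast+
  have minus: "\<phi> (\<ominus>\<^bsub>L\<^esub> x) = \<ominus>\<^bsub>L'\<^esub> \<phi> x" if "x \<in> carrier L" for x
  proof -
    have "\<phi> (\<ominus>\<^bsub>L\<^esub> x) \<oplus>\<^bsub>L'\<^esub> \<phi> x = \<zero>\<^bsub>L'\<^esub>"
      using that add(1)[of "\<ominus>\<^bsub>L\<^esub> x" x] \<phi>0 by (simp add: L.M.l_neg)
    then show ?thesis using that add(2) L'.M.minus_equality by simp
  qed
  have q'minus: "q' (\<ominus>\<^bsub>L'\<^esub> x) = \<ominus>\<^bsub>A\<^esub> q' x" if "x \<in> carrier L'" for x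
  proof -
    have "q' (\<ominus>\<^bsub>L'\<^esub> x) \<oplus>\<^bsub>A\<^esub> q' x = \<zero>\<^bsub>A\<^esub>"
      using that q'add(1)[of "\<ominus>\<^bsub>L'\<^esub> x" x] q'0 by (simp add: L'.M.l_neg)
    then show ?thesis using that q'add(2) A.M.minus_equality by simp
  qed
  have ker: "z = \<zero>\<^bsub>L\<^esub>" if z: "z \<in> carrier L" "\<phi> z = \<zero>\<^bsub>L'\<^esub>" for z
  proof -
    have "q z = \<zero>\<^bsub>A\<^esub>" using q[OF z(1)] z(2) q'0 by simp
    then have "z \<in> i ` carrier B" using ex z by blast
    then obtain b where b: "b \<in> carrier B" "z = i b" by blast
    have "i' b = i' \<zero>\<^bsub>B\<^esub>" using i[OF b(1)] b z i'0 by simp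
    then have "b = \<zero>\<^bsub>B\<^esub>" using ex(2) b(1) by (auto dest: inj_onD)
    then show ?thesis using b i0 by simp
  qed
  have inj: "inj_on \<phi> (carrier L)"
  proof (rule inj_onI)
    fix x y assume xy: "x \<in> carrier L" "y \<in> carrier L" "\<phi> x = \<phi> y"
    have "\<phi> (x \<oplus>\<^bsub>L\<^esub> \<ominus>\<^bsub>L\<^esub> y) = \<zero>\<^bsub>L'\<^esub>"
      using xy add minus by (simp add: L'.M.r_neg)
    then have "x \<oplus>\<^bsub>L\<^esub> \<ominus>\<^bsub>L\<^esub> y = \<zero>\<^bsub>L\<^esub>" using ker xy by simp
    then show "x = y" using xy by (metis L.M.add.inv_equality L.M.add.inv_closed L.M.minus_minus)
  qed
  have surj: "\<phi> ` carrier L = carrier L'"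
  proof
    show "\<phi> ` carrier L \<subseteq> carrier L'" using add(2) by auto
    show "carrier L' \<subseteq> \<phi> ` carrier L"
    proof
      fix y assume y: "y \<in> carrier L'"
      then have "q' y \<in> q ` carrier L" using ex q'add(2) by blast
      then obtain x where x: "x \<in> carrier L" "q' y = q x" by blast
      have "q' (y \<oplus>\<^bsub>L'\<^esub> \<ominus>\<^bsub>L'\<^esub> \<phi> x) = \<zero>\<^bsub>A\<^esub>"
        using y x add(2) q'add q'minus q qadd(2) by (simp add: A.M.r_neg)
      then have "y \<oplus>\<^bsub>L'\<^esub> \<ominus>\<^bsub>L'\<^esub> \<phi> x \<in> i' ` carrier B" using ex y x add(2) by simp
      then obtain b where b: "b \<in> carrier B" "y \<oplus>\<^bsub>L'\<^esub> \<ominus>\<^bsub>L'\<^esub> \<phi> x = i' b" by blast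
      have "\<phi> (i b \<oplus>\<^bsub>L\<^esub> x) = y"
        using b x y add ic i by (simp add: b(2)[symmetric] L'.M.a_assoc L'.M.l_neg)
      then show "y \<in> \<phi> ` carrier L" using b x ic by (metis L.M.a_closed imageI)
    qed
  qed
  show ?thesis using e e' \<phi> i q inj surj unfolding ext_equiv_def bij_betw_def by blast
qed


lemma kt_simps [simp]:
  "carrier kt = UNIV" "x \<otimes>\<^bsub>kt\<^esub> y = x * y" "x \<oplus>\<^bsub>kt\<^esub> y = x + y" "\<one>\<^bsub>kt\<^esub> = 1" "\<zero>\<^bsub>kt\<^esub> = 0"
  by (simp_all add: ring_of_type_algebra_def)

lemma tmod_simps [simp]:
  "carrier (tmod p l) = {v. \<forall>j. v $ j \<in> resid (p ^ l j)}"
  "u \<oplus>\<^bsub>tmod p l\<^esub> v = u + v" "\<zero>\<^bsub>tmod p l\<^esub> = 0"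
  "f \<odot>\<^bsub>tmod p l\<^esub> v = (\<chi> j. (f * v $ j) mod p ^ l j)"
  by (simp_all add: tmod_def)

lemma resid_0 [simp]: "0 \<in> resid q" and resid_mod [simp]: "f mod q \<in> resid q"
  by (simp_all add: resid_def)

lemma resid_add: "f \<in> resid q \<Longrightarrow> g \<in> resid q \<Longrightarrow> f + g \<in> resid q"
  and resid_uminus: "f \<in> resid q \<Longrightarrow> - f \<in> resid q"
  by (simp_all add: resid_def poly_mod_add_left poly_mod_minus_left)

lemma resid_modD: "f \<in> resid q \<Longrightarrow> f mod q = f"
  by (simp add: resid_def)

lemma resid_eqI: "f \<in> resid q \<Longrightarrow> g \<in> resid q \<Longrightarrow> q dvd f - g \<Longrightarrow> f = g"
  by (metis mod_eq_dvd_iff resid_modD)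

lemma module_tmod: "Module.module kt (tmod p l)"
proof (rule Module.moduleI)
  show "cring (kt :: 'a poly ring)" by (rule cring_from_type_algebra)
  show "abelian_group (tmod p l)"
  proof (rule abelian_groupI)
    fix x assume "x \<in> carrier (tmod p l)"
    then show "\<exists>y\<in>carrier (tmod p l). y \<oplus>\<^bsub>tmod p l\<^esub> x = \<zero>\<^bsub>tmod p l\<^esub>"
      by (intro bexI[of _ "-x"]) (auto simp: resid_uminus)
  qed (auto simp: resid_add add_ac)
qed (auto simp: vec_eq_iff algebra_simps poly_mod_add_left resid_modD mod_mult_right_eq)

text \<open>
  When \<open>r * v $ j\<close> overflows modulo \<open>p\<^bsup>l j\<^esup>\<close>, the quotient is carried over into the submodule as a
  multiple of the \<open>j\<close>-th column of \<open>E\<close>. Addition never overflows, as remainders are closed under it.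
\<close>

definition std_ext :: "'k::field poly \<Rightarrow> ('n::finite \<Rightarrow> nat) \<Rightarrow> 'k poly ^ 'n ^ 'n \<Rightarrow>
    ('k poly, 'k poly ^ 'n, 'k poly ^ 'n) ext" where
  "std_ext p l E = (\<lparr>carrier = carrier (tmod p l) \<times> carrier (tmod p l),
     monoid.mult = undefined, one = undefined, zero = 0, add = (+),
     module.smult = (\<lambda>r (u, v).
       (\<chi> i. (r * u $ i + (\<Sum>j\<in>UNIV. E $ i $ j * ((r * v $ j) div p ^ l j))) mod p ^ l i,
        \<chi> j. (r * v $ j) mod p ^ l j))\<rparr>, \<lambda>u. (u, 0), snd)"

text \<open>
  The cocycle identity behind the associativity of multiplication with carry: the carry of \<open>a * b\<close> is
  \<open>a\<close> times the carry of \<open>b\<close> plus the carry of \<open>a\<close> on the remainder.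
\<close>

lemma div_mult_carry:
  fixes q :: "'k::field poly"
  assumes "q \<noteq> 0"
  shows "(a * b * v) div q = a * ((b * v) div q) + (a * ((b * v) mod q)) div q"
proof -
  have "a * b * v = a * ((b * v) mod q) + a * ((b * v) div q) * q"
    by (metis (no_types) add.commute ab_semigroup_mult_class.mult_ac(1) distrib_left div_mult_mod_eq)
  then show ?thesis using assms by (metis add.commute div_mult_self1)
qed

lemma std_ext_extension:
  assumes p: "p \<noteq> (0 :: 'k::field poly)"
  shows "std_ext p l E \<in> extensions kt (tmod p l) (tmod p l)"
proof -
  define L where "L = fst (std_ext p l E)"
  have std: "std_ext p l E = (L, \<lambda>u. (u, 0), snd)" by (simp add: L_def std_ext_def)
  have L: "carrier L = carrier (tmod p l) \<times> carrier (tmod p l)" "x \<oplus>\<^bsub>L\<^esub> y = x + y" "\<zero>\<^bsub>L\<^esub> = 0"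
    "r \<odot>\<^bsub>L\<^esub> (u, v) = (\<chi> i. (r * u $ i + (\<Sum>j\<in>UNIV. E $ i $ j * ((r * v $ j) div p ^ l j))) mod p ^ l i,
        \<chi> j. (r * v $ j) mod p ^ l j)" for x y r u v
    by (simp_all add: L_def std_ext_def)
  have "Module.module kt L"
  proof (rule Module.moduleI)
    show "cring (kt :: 'k poly ring)" by (rule cring_from_type_algebra)
    show "abelian_group L"
    proof (rule abelian_groupI)
      fix x assume "x \<in> carrier L"
      then show "\<exists>y\<in>carrier L. y \<oplus>\<^bsub>L\<^esub> x = \<zero>\<^bsub>L\<^esub>"
        by (intro bexI[of _ "-x"]) (auto simp: L resid_uminus)
    qed (auto simp: L resid_add add_ac zero_prod_def)
  next
    fix a b x assume "x \<in> carrier L"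
    then obtain u v where x: "x = (u, v)" "u \<in> carrier (tmod p l)" "v \<in> carrier (tmod p l)"
      by (auto simp: L)
    have 1: "(\<Sum>j\<in>UNIV. E $ i $ j * ((a * b * v $ j) div p ^ l j)) =
       a * (\<Sum>j\<in>UNIV. E $ i $ j * ((b * v $ j) div p ^ l j)) +
       (\<Sum>j\<in>UNIV. E $ i $ j * ((a * ((b * v $ j) mod p ^ l j)) div p ^ l j))" for i
      unfolding sum_distrib_left sum.distrib[symmetric]
      by (intro sum.cong refl, subst div_mult_carry) (simp_all add: p distrib_left mult.left_commute)
    have 2: "(a * (w mod q) + t) mod q = (a * w + t) mod q" for w q t :: "'k poly"
      by (metis mod_add_left_eq mod_mult_right_eq)
    have 3: "(a * b * u $ i + (\<Sum>j\<in>UNIV. E $ i $ j * ((a * b * v $ j) div p ^ l j))) mod p ^ l i =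
       (a * ((b * u $ i + (\<Sum>j\<in>UNIV. E $ i $ j * ((b * v $ j) div p ^ l j))) mod p ^ l i) +
       (\<Sum>j\<in>UNIV. E $ i $ j * ((a * ((b * v $ j) mod p ^ l j)) div p ^ l j))) mod p ^ l i" for i
      unfolding 1 2 by (simp add: distrib_left add.assoc mult.assoc)
    show "(a \<otimes>\<^bsub>kt\<^esub> b) \<odot>\<^bsub>L\<^esub> x = a \<odot>\<^bsub>L\<^esub> (b \<odot>\<^bsub>L\<^esub> x)"
      by (simp add: x L vec_eq_iff 3 mod_mult_right_eq) (simp add: mult.assoc)
  next
    fix a b x assume "x \<in> carrier L"
    then obtain u v where x: "x = (u, v)" by (cases x)
    show "(a \<oplus>\<^bsub>kt\<^esub> b) \<odot>\<^bsub>L\<^esub> x = a \<odot>\<^bsub>L\<^esub> x \<oplus>\<^bsub>L\<^esub> b \<odot>\<^bsub>L\<^esub> x"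
      by (simp add: x L vec_eq_iff distrib_left distrib_right poly_mod_add_left poly_div_add_left
          sum.distrib)
  next
    fix a x y assume "x \<in> carrier L" "y \<in> carrier L"
    obtain u v u' v' where x: "x = (u, v)" "y = (u', v')" by (cases x, cases y)
    show "a \<odot>\<^bsub>L\<^esub> (x \<oplus>\<^bsub>L\<^esub> y) = a \<odot>\<^bsub>L\<^esub> x \<oplus>\<^bsub>L\<^esub> a \<odot>\<^bsub>L\<^esub> y"
      by (simp add: x L vec_eq_iff distrib_left distrib_right poly_mod_add_left poly_div_add_left
          sum.distrib)
  next
    fix x assume "x \<in> carrier L"
    then obtain u v where x: "x = (u, v)" "\<And>j. u $ j mod p ^ l j = u $ j" "\<And>j. v $ j mod p ^ l j = v $ j"
      by (auto simp: L resid_def)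
    have "v $ j div p ^ l j = 0" for j
      using x(3)[of j] p div_mult_mod_eq[of "v $ j" "p ^ l j"] by simp
    then show "\<one>\<^bsub>kt\<^esub> \<odot>\<^bsub>L\<^esub> x = x"
      by (simp add: x L vec_eq_iff)
  qed (auto simp: L)
  then show ?thesis
    unfolding std
    by (auto simp: extensions_def mod_hom_def L inj_on_def image_iff vec_eq_iff)
qed

lemma finsum_tmod:
  assumes "finite A" "\<And>i. i \<in> A \<Longrightarrow> w i \<in> carrier (tmod p l)"
  shows "finsum (tmod p l) (\<lambda>i. r i \<odot>\<^bsub>tmod p l\<^esub> w i) A = (\<chi> h. (\<Sum>i\<in>A. r i * w i $ h) mod p ^ l h)"
proof -
  interpret M: Module.module kt "tmod p l" by (rule module_tmod)
  show ?thesis using assms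
  proof (induction A rule: finite_induct)
    case empty
    then show ?case by (simp add: vec_eq_iff)
  next
    case (insert x A)
    have "(\<lambda>i. r i \<odot>\<^bsub>tmod p l\<^esub> w i) \<in> A \<rightarrow> carrier (tmod p l)" "r x \<odot>\<^bsub>tmod p l\<^esub> w x \<in> carrier (tmod p l)"
      by auto
    then have "finsum (tmod p l) (\<lambda>i. r i \<odot>\<^bsub>tmod p l\<^esub> w i) (insert x A) =
       r x \<odot>\<^bsub>tmod p l\<^esub> w x \<oplus>\<^bsub>tmod p l\<^esub> finsum (tmod p l) (\<lambda>i. r i \<odot>\<^bsub>tmod p l\<^esub> w i) A"
      using insert.hyps by (rule_tac M.M.finsum_insert)
    then show ?case using insert
      by (simp add: vec_eq_iff poly_mod_add_left del: tmod_simps(4)) simp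
  qed
qed

lemma mod_hom_smult: "h \<in> mod_hom R M N \<Longrightarrow> r \<in> carrier R \<Longrightarrow> x \<in> carrier M \<Longrightarrow> h (r \<odot>\<^bsub>M\<^esub> x) = r \<odot>\<^bsub>N\<^esub> h x"
  and mod_hom_add: "h \<in> mod_hom R M N \<Longrightarrow> x \<in> carrier M \<Longrightarrow> y \<in> carrier M \<Longrightarrow> h (x \<oplus>\<^bsub>M\<^esub> y) = h x \<oplus>\<^bsub>N\<^esub> h y"
  and mod_hom_closed: "h \<in> mod_hom R M N \<Longrightarrow> x \<in> carrier M \<Longrightarrow> h x \<in> carrier N"
  by (auto simp: mod_hom_def)

text \<open>
  Sums in an abstract extension are turned into sums of vectors of polynomials as soon as they lie in the
  image of a sum of torsion modules, or are mapped to one.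
\<close>

lemma finsum_hom_from_tmod:
  fixes w :: "'n::finite \<Rightarrow> 'k::field poly ^ 'm::finite"
  assumes L: "Module.module kt L" and \<iota>: "\<iota> \<in> mod_hom kt (tmod p l) L"
    and w: "\<And>i. w i \<in> carrier (tmod p l)"
  shows "finsum L (\<lambda>i. r i \<odot>\<^bsub>L\<^esub> \<iota> (w i)) UNIV = \<iota> (\<chi> h. (\<Sum>i\<in>UNIV. r i * w i $ h) mod p ^ l h)"
proof -
  interpret L: Module.module kt L by fact
  have "\<iota> (finsum (tmod p l) (\<lambda>i. r i \<odot>\<^bsub>tmod p l\<^esub> w i) UNIV) = finsum L (\<lambda>i. \<iota> (r i \<odot>\<^bsub>tmod p l\<^esub> w i)) UNIV"
    by (rule finsum_mod_hom[OF module_tmod L \<iota>]) auto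
  also have "(\<lambda>i. \<iota> (r i \<odot>\<^bsub>tmod p l\<^esub> w i)) = (\<lambda>i. r i \<odot>\<^bsub>L\<^esub> \<iota> (w i))"
    using mod_hom_smult[OF \<iota> _ w] by auto
  finally show ?thesis using finsum_tmod[of UNIV w p l r] w by simp
qed

lemma finsum_hom_to_tmod:
  fixes f :: "'n::finite \<Rightarrow> 'b"
  assumes L: "Module.module kt L" and q: "q \<in> mod_hom kt L (tmod p l)"
    and f: "\<And>i. f i \<in> carrier L"
  shows "q (finsum L (\<lambda>i. r i \<odot>\<^bsub>L\<^esub> f i) UNIV) = (\<chi> h. (\<Sum>i\<in>UNIV. r i * q (f i) $ h) mod p ^ l h)"
proof -
  interpret L: Module.module kt L by fact
  have "q (finsum L (\<lambda>i. r i \<odot>\<^bsub>L\<^esub> f i) UNIV) = finsum (tmod p l) (\<lambda>i. q (r i \<odot>\<^bsub>L\<^esub> f i)) UNIV"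
    by (rule finsum_mod_hom[OF L module_tmod q]) (auto simp: f)
  also have "(\<lambda>i. q (r i \<odot>\<^bsub>L\<^esub> f i)) = (\<lambda>i. r i \<odot>\<^bsub>tmod p l\<^esub> q (f i))"
    using mod_hom_smult[OF q _ f] by (auto simp del: tmod_simps(4))
  finally show ?thesis using finsum_tmod[of UNIV "\<lambda>i. q (f i)" p l r] mod_hom_closed[OF q f] by simp
qed

definition col :: "'k::field poly \<Rightarrow> ('n::finite \<Rightarrow> nat) \<Rightarrow> 'k poly ^ 'n ^ 'n \<Rightarrow> 'n \<Rightarrow> 'k poly ^ 'n" where
  "col p l E j = (\<chi> i. E $ i $ j mod p ^ l i)"

lemma col_closed [simp]: "col p l E j \<in> carrier (tmod p l)"
  by (simp add: col_def)

lemma sum_mod_cong: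
  fixes q :: "'k::field poly"
  assumes "\<And>j. j \<in> A \<Longrightarrow> f j mod q = g j mod q"
  shows "sum f A mod q = sum g A mod q"
proof -
  have "sum f A mod q = (\<Sum>j\<in>A. f j mod q) mod q" by (simp add: mod_sum_eq)
  also have "\<dots> = (\<Sum>j\<in>A. g j mod q) mod q" using assms by simp
  also have "\<dots> = sum g A mod q" by (simp add: mod_sum_eq)
  finally show ?thesis .
qed

text \<open>
  The exponents are positive, so that no generator vanishes and \<open>1\<close> is its own remainder.
\<close>

locale torsion =
  fixes p :: "'k::field poly" and l :: "'n::finite \<Rightarrow> nat"
  assumes deg: "degree p > 0" and pos: "\<And>j. l j > 0"
begin

abbreviation M where "M \<equiv> tmod p l"
abbreviation e where "e \<equiv> gen p l"

lemma p_nonzero [simp]: "p \<noteq> 0" using deg by auto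

lemma one_mod [simp]: "1 mod p ^ l j = 1"
proof -
  have "degree (p ^ l j) > 0" using deg pos[of j] by (simp add: degree_power_eq)
  then show ?thesis by (simp add: mod_poly_less)
qed

lemma gen_nth: "e j $ i = (if i = j then 1 else 0)"
  by (simp add: gen_def axis_def)

lemma gen_closed [simp]: "e j \<in> carrier M"
  by (auto simp: gen_nth resid_def)

lemma sum_gen: "(\<Sum>j\<in>UNIV. r j * e j $ h) = r h"
  by (simp add: gen_nth if_distrib cong: if_cong)

lemma sum_gen': "(\<Sum>k\<in>UNIV. r k * e j $ k) = r j"
  by (simp add: gen_nth if_distrib cong: if_cong)

lemma finsum_gens:
  assumes "Module.module kt L" "\<iota> \<in> mod_hom kt M L"
  shows "finsum L (\<lambda>i. E $ i $ j \<odot>\<^bsub>L\<^esub> \<iota> (e i)) UNIV = \<iota> (col p l E j)"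
  using finsum_hom_from_tmod[OF assms, of e "\<lambda>i. E $ i $ j"] by (simp add: sum_gen col_def del: tmod_simps)

definition lifts where
  "lifts L \<iota> q E f \<longleftrightarrow> (\<forall>j. f j \<in> carrier L \<and> q (f j) = e j \<and> (p ^ l j) \<odot>\<^bsub>L\<^esub> f j = \<iota> (col p l E j))"

text \<open>
  As the \<open>i\<close>-th generator counts modulo \<open>p\<^bsup>l i\<^esup>\<close> only, the sums in the definition are images of the
  reduced columns of the matrix.
\<close>

lemma ext_of_matrix_iff:
  "(L, \<iota>, q) \<in> ext_of_matrix p l E \<longleftrightarrow>
     (L, \<iota>, q) \<in> extensions kt M M \<and> (\<exists>f. lifts L \<iota> q E f)"
proof -
  have "finsum L (\<lambda>i. E $ i $ j \<odot>\<^bsub>L\<^esub> \<iota> (e i)) UNIV = \<iota> (col p l E j)"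
    if "(L, \<iota>, q) \<in> extensions kt M M" for j
    using that by (intro finsum_gens) (auto simp: extensions_def)
  then show ?thesis unfolding ext_of_matrix_def lifts_def by auto
qed

lemma std_ext_matrix: "std_ext p l E \<in> ext_of_matrix p l E"
proof -
  define f :: "'n \<Rightarrow> ('k poly ^ 'n) \<times> ('k poly ^ 'n)" where "f = (\<lambda>j. (0, e j))"
  obtain L \<iota> q where std: "std_ext p l E = (L, \<iota>, q)" by (cases "std_ext p l E")
  then have L: "carrier L = carrier M \<times> carrier M"
    "r \<odot>\<^bsub>L\<^esub> (u, v) = (\<chi> i. (r * u $ i + (\<Sum>j\<in>UNIV. E $ i $ j * ((r * v $ j) div p ^ l j))) mod p ^ l i,
        \<chi> j. (r * v $ j) mod p ^ l j)"  "q x = snd x" "\<iota> u = (u, 0)" for x r u v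
    by (auto simp: std_ext_def)
  have "(p ^ l j * e j $ k) div p ^ l k = e j $ k" for j k
    by (simp add: gen_nth)
  then have "lifts L \<iota> q E f"
    by (simp add: lifts_def L f_def vec_eq_iff col_def sum_gen') (simp add: gen_nth resid_def)
  then show ?thesis using std std_ext_extension[of p l E] ext_of_matrix_iff[of L \<iota> q E] by auto
qed

text \<open>
  The map sends \<open>(u, v)\<close> to \<open>\<iota> u + \<Sum> v\<^sub>j f\<^sub>j\<close>. It is linear because a carry from the \<open>j\<close>-th coordinate is
  a multiple of \<open>p\<^bsup>l j\<^esup> f\<^sub>j\<close>, hence the same multiple of the \<open>j\<close>-th column.
\<close>

lemma std_ext_universal:
  assumes x: "(L, \<iota>, q) \<in> ext_of_matrix p l E"
  shows "(std_ext p l E, (L, \<iota>, q)) \<in> ext_equiv kt M M"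
proof -
  from x obtain f where ext: "(L, \<iota>, q) \<in> extensions kt M M" and f: "lifts L \<iota> q E f"
    by (auto simp: ext_of_matrix_iff)
  have fc: "f j \<in> carrier L" and qf: "q (f j) = e j" and pf: "(p ^ l j) \<odot>\<^bsub>L\<^esub> f j = \<iota> (col p l E j)" for j
    using f by (auto simp: lifts_def)
  have L: "Module.module kt L" and \<iota>: "\<iota> \<in> mod_hom kt M L" and q: "q \<in> mod_hom kt L M"
    and ex: "\<iota> ` carrier M = {x \<in> carrier L. q x = \<zero>\<^bsub>M\<^esub>}"
    using ext by (auto simp: extensions_def)
  interpret L: Module.module kt L by fact
  obtain S i0 q0 where std: "std_ext p l E = (S, i0, q0)" by (cases "std_ext p l E")
  then have S: "carrier S = carrier M \<times> carrier M"  "x \<oplus>\<^bsub>S\<^esub> y = x + y"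
    "r \<odot>\<^bsub>S\<^esub> (u, v) = (\<chi> i. (r * u $ i + (\<Sum>j\<in>UNIV. E $ i $ j * ((r * v $ j) div p ^ l j))) mod p ^ l i,
        \<chi> j. (r * v $ j) mod p ^ l j)"  "q0 z = snd z" "i0 u = (u, 0)" for x y z r u v
    by (auto simp: std_ext_def)
  define F where "F = (\<lambda>v :: 'k poly ^ 'n. finsum L (\<lambda>j. v $ j \<odot>\<^bsub>L\<^esub> f j) UNIV)"
  have Fc: "F v \<in> carrier L" for v unfolding F_def by (rule L.M.finsum_closed) (simp add: fc)
  have Fadd: "F (v + w) = F v \<oplus>\<^bsub>L\<^esub> F w" for v w
    unfolding F_def using fc
    by (subst L.M.finsum_addf[symmetric]) (auto intro!: L.M.finsum_cong simp: L.smult_l_distr[simplified])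
  have Fsm: "r \<odot>\<^bsub>L\<^esub> F v = \<iota> (\<chi> i. (\<Sum>j\<in>UNIV. E $ i $ j * ((r * v $ j) div p ^ l j)) mod p ^ l i)
      \<oplus>\<^bsub>L\<^esub> F (\<chi> j. (r * v $ j) mod p ^ l j)" for r v
  proof -
    let ?d = "\<lambda>j. (r * v $ j) div p ^ l j" and ?m = "\<lambda>j. (r * v $ j) mod p ^ l j"
    have step: "r \<odot>\<^bsub>L\<^esub> (v $ j \<odot>\<^bsub>L\<^esub> f j) = ?d j \<odot>\<^bsub>L\<^esub> \<iota> (col p l E j) \<oplus>\<^bsub>L\<^esub> ?m j \<odot>\<^bsub>L\<^esub> f j" for j
    proof -
      have "r \<odot>\<^bsub>L\<^esub> (v $ j \<odot>\<^bsub>L\<^esub> f j) = (?d j * p ^ l j + ?m j) \<odot>\<^bsub>L\<^esub> f j"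
        unfolding div_mult_mod_eq using L.smult_assoc1[of r "v $ j" "f j"] fc by simp
      also have "\<dots> = (?d j * p ^ l j) \<odot>\<^bsub>L\<^esub> f j \<oplus>\<^bsub>L\<^esub> ?m j \<odot>\<^bsub>L\<^esub> f j"
        using L.smult_l_distr[of "?d j * p ^ l j" "?m j" "f j"] fc by simp
      also have "(?d j * p ^ l j) \<odot>\<^bsub>L\<^esub> f j = ?d j \<odot>\<^bsub>L\<^esub> \<iota> (col p l E j)"
        using L.smult_assoc1[of "?d j" "p ^ l j" "f j"] fc pf by simp
      finally show ?thesis .
    qed
    have "r \<odot>\<^bsub>L\<^esub> F v = finsum L (\<lambda>j. r \<odot>\<^bsub>L\<^esub> (v $ j \<odot>\<^bsub>L\<^esub> f j)) UNIV"
      unfolding F_def using fc by (intro L.finsum_smult_ldistr) auto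
    also have "\<dots> = finsum L (\<lambda>j. ?d j \<odot>\<^bsub>L\<^esub> \<iota> (col p l E j)) UNIV \<oplus>\<^bsub>L\<^esub> finsum L (\<lambda>j. ?m j \<odot>\<^bsub>L\<^esub> f j) UNIV"
      unfolding step using fc mod_hom_closed[OF \<iota> col_closed] by (intro L.M.finsum_addf) auto
    also have "finsum L (\<lambda>j. ?d j \<odot>\<^bsub>L\<^esub> \<iota> (col p l E j)) UNIV =
       \<iota> (\<chi> i. (\<Sum>j\<in>UNIV. ?d j * col p l E j $ i) mod p ^ l i)"
      by (rule finsum_hom_from_tmod[OF L \<iota>]) (rule col_closed)
    also have "(\<chi> i. (\<Sum>j\<in>UNIV. ?d j * col p l E j $ i) mod p ^ l i) =
       (\<chi> i. (\<Sum>j\<in>UNIV. E $ i $ j * ?d j) mod p ^ l i)"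
      unfolding vec_eq_iff vec_lambda_beta col_def
      by (intro allI sum_mod_cong) (simp add: mod_mult_right_eq mult.commute)
    finally show ?thesis by (simp add: F_def)
  qed
  define \<psi> where "\<psi> = (\<lambda>(u, v). \<iota> u \<oplus>\<^bsub>L\<^esub> F v)"
  note \<iota>c = mod_hom_closed[OF \<iota>] and \<iota>a = mod_hom_add[OF \<iota>] and \<iota>s = mod_hom_smult[OF \<iota>]
  have \<psi>: "\<psi> \<in> mod_hom kt S L"
    unfolding mod_hom_def
  proof (intro CollectI conjI ballI)
    show "\<psi> \<in> carrier S \<rightarrow> carrier L" by (auto simp: \<psi>_def S Fc \<iota>c)
  next
    fix x y assume "x \<in> carrier S" "y \<in> carrier S"
    then obtain u v u' v' where x: "x = (u, v)" "y = (u', v')" and c: "u \<in> carrier M" "u' \<in> carrier M"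
      by (auto simp: S)
    show "\<psi> (x \<oplus>\<^bsub>S\<^esub> y) = \<psi> x \<oplus>\<^bsub>L\<^esub> \<psi> y"
      using \<iota>a[OF c] \<iota>c[OF c(1)] \<iota>c[OF c(2)] Fc
      by (simp add: S(2) x \<psi>_def Fadd L.M.add.m_ac)
  next
    fix r x assume "x \<in> carrier S"
    then obtain u v where x: "x = (u, v)" and c: "u \<in> carrier M" by (auto simp: S)
    let ?w = "\<chi> i. (\<Sum>j\<in>UNIV. E $ i $ j * ((r * v $ j) div p ^ l j)) mod p ^ l i"
    have "r \<odot>\<^bsub>L\<^esub> \<psi> x = r \<odot>\<^bsub>L\<^esub> \<iota> u \<oplus>\<^bsub>L\<^esub> r \<odot>\<^bsub>L\<^esub> F v"
      unfolding x \<psi>_def prod.case using c by (intro L.smult_r_distr) (auto intro: \<iota>c Fc)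
    also have "\<dots> = \<iota> (r \<odot>\<^bsub>M\<^esub> u) \<oplus>\<^bsub>L\<^esub> (\<iota> ?w \<oplus>\<^bsub>L\<^esub> F (\<chi> j. (r * v $ j) mod p ^ l j))"
      using \<iota>s[of r u] c Fsm by simp
    also have "\<dots> = \<iota> (r \<odot>\<^bsub>M\<^esub> u \<oplus>\<^bsub>M\<^esub> ?w) \<oplus>\<^bsub>L\<^esub> F (\<chi> j. (r * v $ j) mod p ^ l j)"
      using \<iota>a[of "r \<odot>\<^bsub>M\<^esub> u" ?w] \<iota>c[of "r \<odot>\<^bsub>M\<^esub> u"] \<iota>c[of ?w] Fc by (simp add: L.M.a_assoc)
    also have "\<dots> = \<psi> (r \<odot>\<^bsub>S\<^esub> x)"
      by (simp add: x S(3) \<psi>_def poly_mod_add_left plus_vec_def)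
    finally show "\<psi> (r \<odot>\<^bsub>S\<^esub> x) = r \<odot>\<^bsub>L\<^esub> \<psi> x" by simp
  qed
  have F0: "F 0 = \<zero>\<^bsub>L\<^esub>" unfolding F_def using fc L.smult_l_null
    by (intro L.M.add.finprod_one_eqI) simp
  have \<psi>i: "\<psi> (i0 u) = \<iota> u" if "u \<in> carrier M" for u
    using \<iota>c[OF that] by (simp add: \<psi>_def S F0)
  have qF: "q (F v) = v" if "v \<in> carrier M" for v
    unfolding F_def finsum_hom_to_tmod[OF L q fc] qf using that by (simp add: sum_gen resid_modD)
  have \<psi>q: "q (\<psi> z) = q0 z" if "z \<in> carrier S" for z
  proof -
    obtain u v where z: "z = (u, v)" "u \<in> carrier M" "v \<in> carrier M" using \<open>z \<in> carrier S\<close> by (auto simp: S)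
    have "q (\<iota> u) = 0" using ex z(2) \<iota>c by auto
    then show ?thesis using mod_hom_add[OF q \<iota>c[OF z(2)] Fc] qF[OF z(3)] by (simp add: \<psi>_def z S)
  qed
  show ?thesis unfolding std
    using std_ext_extension[of p l E, unfolded std] ext module_tmod \<psi> \<psi>i \<psi>q module_tmod
    by (intro short_five) auto
qed

lemma ext_of_matrix_closed:
  assumes x: "x \<in> ext_of_matrix p l E" and eq: "(x, y) \<in> ext_equiv kt M M"
  shows "y \<in> ext_of_matrix p l E"
proof -
  obtain L i q where X: "x = (L, i, q)" by (cases x)
  obtain L' i' q' where Y: "y = (L', i', q')" by (cases y)
  from eq[unfolded X Y] obtain \<phi> where ex: "(L, i, q) \<in> extensions kt M M" "(L', i', q') \<in> extensions kt M M"
    and \<phi>: "\<phi> \<in> mod_hom kt L L'" 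
    "\<And>b. b \<in> carrier M \<Longrightarrow> \<phi> (i b) = i' b" "\<And>x. x \<in> carrier L \<Longrightarrow> q' (\<phi> x) = q x"
    by (auto simp: ext_equiv_def)
  from x[unfolded X] obtain f where f: "lifts L i q E f" by (auto simp: ext_of_matrix_iff)
  have "lifts L' i' q' E (\<lambda>j. \<phi> (f j))"
    unfolding lifts_def
  proof (intro allI conjI)
    fix j
    have fj: "f j \<in> carrier L" "q (f j) = e j" "(p ^ l j) \<odot>\<^bsub>L\<^esub> f j = i (col p l E j)"
      using f by (auto simp: lifts_def)
    show "\<phi> (f j) \<in> carrier L'" by (rule mod_hom_closed[OF \<phi>(1) fj(1)])
    show "q' (\<phi> (f j)) = e j" using fj \<phi> by simp
    have "(p ^ l j) \<odot>\<^bsub>L'\<^esub> \<phi> (f j) = \<phi> ((p ^ l j) \<odot>\<^bsub>L\<^esub> f j)"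
      using mod_hom_smult[OF \<phi>(1) _ fj(1)] by simp
    then show "(p ^ l j) \<odot>\<^bsub>L'\<^esub> \<phi> (f j) = i' (col p l E j)"
      using fj(3) \<phi>(2)[OF col_closed] by simp
  qed
  then show ?thesis using ex Y ext_of_matrix_iff by blast
qed

lemma ext_of_matrix_class:
  assumes x: "x \<in> ext_of_matrix p l E"
  shows "ext_of_matrix p l E = ext_equiv kt M M `` {x}"
proof -
  have s: "(std_ext p l E, y) \<in> ext_equiv kt M M" if "y \<in> ext_of_matrix p l E" for y
    using that std_ext_universal by (cases y) auto
  have "(x, y) \<in> ext_equiv kt M M" if "y \<in> ext_of_matrix p l E" for y
    using ext_equiv_trans[OF ext_equiv_sym[OF s[OF x]] s[OF that]] .
  then show ?thesis using ext_of_matrix_closed[OF x] by auto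
qed

lemma ext_of_matrix_in_Ext1: "ext_of_matrix p l E \<in> Ext1 kt M M"
  unfolding ext_of_matrix_class[OF std_ext_matrix] Ext1_def
  by (rule quotientI) (rule std_ext_extension, simp)

text \<open>
  The module \<open>M\<close> satisfies \<open>p\<^bsup>l j\<^esup> e\<^sub>j = 0\<close>, so that \<open>p\<^bsup>l j\<^esup>\<close> times a lift of \<open>e\<^sub>j\<close> lies in the submodule.
\<close>

lemma ext_matrix_exists:
  assumes x: "x \<in> extensions kt M M"
  shows "\<exists>E. x \<in> ext_of_matrix p l E"
proof -
  obtain L \<iota> q where X: "x = (L, \<iota>, q)" by (cases x)
  have L: "Module.module kt L" and \<iota>: "\<iota> \<in> mod_hom kt M L" and q: "q \<in> mod_hom kt L M"
    and ex: "\<iota> ` carrier M = {x \<in> carrier L. q x = \<zero>\<^bsub>M\<^esub>}" "q ` carrier L = carrier M"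
    using x X by (auto simp: extensions_def)
  interpret L: Module.module kt L by fact
  have "\<exists>f w. f \<in> carrier L \<and> q f = e j \<and> w \<in> carrier M \<and> (p ^ l j) \<odot>\<^bsub>L\<^esub> f = \<iota> w" for j
  proof -
    obtain f where f: "f \<in> carrier L" "q f = e j" using gen_closed[of j] unfolding ex(2)[symmetric] by auto
    have "q ((p ^ l j) \<odot>\<^bsub>L\<^esub> f) = \<zero>\<^bsub>M\<^esub>"
      using mod_hom_smult[OF q _ f(1), of "p ^ l j"] f(2) by (auto simp: vec_eq_iff gen_nth)
    then have "(p ^ l j) \<odot>\<^bsub>L\<^esub> f \<in> \<iota> ` carrier M" using ex(1) f by simp
    then show ?thesis using f by blast
  qed
  then obtain f w where fw: "\<And>j. f j \<in> carrier L" "\<And>j. q (f j) = e j" "\<And>j. w j \<in> carrier M"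
    "\<And>j. (p ^ l j) \<odot>\<^bsub>L\<^esub> f j = \<iota> (w j)" by metis
  have "col p l (\<chi> i j. w j $ i) j = w j" for j
    using fw(3)[of j] by (simp add: col_def vec_eq_iff resid_modD)
  then have "lifts L \<iota> q (\<chi> i j. w j $ i) f" using fw by (simp add: lifts_def)
  then show ?thesis using x X ext_of_matrix_iff by blast
qed

lemma Ext1_matrix:
  assumes "\<xi> \<in> Ext1 kt M M"
  obtains E where "\<xi> = ext_of_matrix p l E"
proof -
  obtain x where x: "x \<in> extensions kt M M" "\<xi> = ext_equiv kt M M `` {x}"
    using assms by (auto simp: Ext1_def elim: quotientE)
  obtain E where "x \<in> ext_of_matrix p l E" using ext_matrix_exists x by blast
  then show thesis using ext_of_matrix_class x that by metis
qed

section \<open>The action in terms of matrices\<close>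

definition mat_cong where
  "mat_cong E E' \<longleftrightarrow> (\<forall>i j. p ^ min (l i) (l j) dvd E $ i $ j - E' $ i $ j)"

lemma mat_cong_sym: "mat_cong E E' \<Longrightarrow> mat_cong E' E"
  unfolding mat_cong_def by (metis dvd_minus_iff minus_diff_eq)

lemma mat_cong_trans: "mat_cong E E' \<Longrightarrow> mat_cong E' E'' \<Longrightarrow> mat_cong E E''"
  unfolding mat_cong_def
proof (intro allI)
  fix i j
  assume "\<forall>i j. p ^ min (l i) (l j) dvd E $ i $ j - E' $ i $ j" "\<forall>i j. p ^ min (l i) (l j) dvd E' $ i $ j - E'' $ i $ j"
  then have "p ^ min (l i) (l j) dvd (E $ i $ j - E' $ i $ j) + (E' $ i $ j - E'' $ i $ j)" by (intro dvd_add) auto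
  then show "p ^ min (l i) (l j) dvd E $ i $ j - E'' $ i $ j" by simp
qed

text \<open>
  A change of the lift of \<open>e\<^sub>j\<close> by an element of the submodule changes the \<open>j\<close>-th column by a multiple of
  \<open>p\<^bsup>l j\<^esup>\<close>, and the entry \<open>(i, j)\<close> counts modulo \<open>p\<^bsup>l i\<^esup>\<close> anyway.
\<close>

lemma ext_of_matrix_cong_mem:
  assumes x: "x \<in> ext_of_matrix p l E" and c: "mat_cong E E'"
  shows "x \<in> ext_of_matrix p l E'"
proof -
  obtain L \<iota> q where X: "x = (L, \<iota>, q)" by (cases x)
  from x[unfolded X] obtain f where ext: "(L, \<iota>, q) \<in> extensions kt M M" and f: "lifts L \<iota> q E f"
    by (auto simp: ext_of_matrix_iff)
  have fc: "f j \<in> carrier L" and qf: "q (f j) = e j" and pf: "(p ^ l j) \<odot>\<^bsub>L\<^esub> f j = \<iota> (col p l E j)" for j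
    using f by (auto simp: lifts_def)
  have L: "Module.module kt L" and \<iota>: "\<iota> \<in> mod_hom kt M L" and q: "q \<in> mod_hom kt L M"
    and ex: "\<iota> ` carrier M = {x \<in> carrier L. q x = \<zero>\<^bsub>M\<^esub>}"
    using ext by (auto simp: extensions_def)
  interpret L: Module.module kt L by fact
  \<comment> \<open>Where \<open>l j \<le> l i\<close> the difference of the entries is a multiple of \<open>p\<^bsup>l j\<^esup>\<close> and is absorbed by the
    lift; elsewhere it is a multiple of \<open>p\<^bsup>l i\<^esup>\<close> and does not affect the columns.\<close>
  define u where "u = (\<lambda>j. \<chi> i. (if l j \<le> l i then (E' $ i $ j - E $ i $ j) div p ^ l j else 0) mod p ^ l i)"
  have uc: "u j \<in> carrier M" for j by (simp add: u_def)
  have E': "col p l E' j = col p l E j \<oplus>\<^bsub>M\<^esub> (p ^ l j) \<odot>\<^bsub>M\<^esub> u j" for j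
  proof -
    have "E' $ i $ j mod p ^ l i = (E $ i $ j + p ^ l j * u j $ i) mod p ^ l i" for i
    proof (cases "l j \<le> l i")
      case True
      then have "p ^ l j dvd E' $ i $ j - E $ i $ j"
        using c mat_cong_sym[OF c] unfolding mat_cong_def by (metis min.absorb2)
      then have "E $ i $ j + p ^ l j * ((E' $ i $ j - E $ i $ j) div p ^ l j) = E' $ i $ j" by simp
      then show ?thesis using True by (simp add: u_def) (metis mod_add_right_eq mod_mult_right_eq)
    next
      case False
      then have "p ^ l i dvd E' $ i $ j - E $ i $ j"
        using mat_cong_sym[OF c] unfolding mat_cong_def by (metis min.absorb1 nat_le_linear)
      then show ?thesis using False by (simp add: u_def mod_eq_dvd_iff)
    qed
    then show ?thesis by (simp add: col_def vec_eq_iff poly_mod_add_left)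
  qed
  have "lifts L \<iota> q E' (\<lambda>j. f j \<oplus>\<^bsub>L\<^esub> \<iota> (u j))"
    unfolding lifts_def
  proof (intro allI conjI)
    fix j
    note iu = mod_hom_closed[OF \<iota> uc]
    show "f j \<oplus>\<^bsub>L\<^esub> \<iota> (u j) \<in> carrier L" using fc iu by simp
    have "q (\<iota> (u j)) = 0" using ex uc[of j] by auto
    then show "q (f j \<oplus>\<^bsub>L\<^esub> \<iota> (u j)) = e j" using mod_hom_add[OF q fc iu] qf by simp
    have "(p ^ l j) \<odot>\<^bsub>L\<^esub> (f j \<oplus>\<^bsub>L\<^esub> \<iota> (u j)) = \<iota> (col p l E j) \<oplus>\<^bsub>L\<^esub> \<iota> ((p ^ l j) \<odot>\<^bsub>M\<^esub> u j)"
      using L.smult_r_distr[of "p ^ l j" "f j" "\<iota> (u j)"] fc iu pf mod_hom_smult[OF \<iota> _ uc, of "p ^ l j"]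
      by simp
    also have "\<dots> = \<iota> (col p l E' j)" unfolding E'
      by (rule mod_hom_add[OF \<iota>, symmetric]) (simp_all del: tmod_simps(1) add: tmod_simps(1)[of p l] col_def)
    finally show "(p ^ l j) \<odot>\<^bsub>L\<^esub> (f j \<oplus>\<^bsub>L\<^esub> \<iota> (u j)) = \<iota> (col p l E' j)" .
  qed
  then show ?thesis using ext X ext_of_matrix_iff by blast
qed

text \<open>
  Conversely, two lifts of \<open>e\<^sub>j\<close> differ by an element of the submodule.
\<close>

lemma ext_matrix_unique:
  assumes x: "x \<in> ext_of_matrix p l E" and x': "x \<in> ext_of_matrix p l E'"
  shows "mat_cong E E'"
proof -
  obtain L \<iota> q where X: "x = (L, \<iota>, q)" by (cases x)
  from x[unfolded X] obtain f where ext: "(L, \<iota>, q) \<in> extensions kt M M" and f: "lifts L \<iota> q E f"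
    by (auto simp: ext_of_matrix_iff)
  from x'[unfolded X] obtain f' where f': "lifts L \<iota> q E' f'"
    by (auto simp: ext_of_matrix_iff)
  have L: "Module.module kt L" and \<iota>: "\<iota> \<in> mod_hom kt M L" and q: "q \<in> mod_hom kt L M"
    and ex: "\<iota> ` carrier M = {x \<in> carrier L. q x = \<zero>\<^bsub>M\<^esub>}" and inj: "inj_on \<iota> (carrier M)"
    using ext by (auto simp: extensions_def)
  interpret L: Module.module kt L by fact
  have "p ^ min (l i) (l j) dvd E' $ i $ j - E $ i $ j" for i j
  proof -
    have fj: "f j \<in> carrier L" "q (f j) = e j" "(p ^ l j) \<odot>\<^bsub>L\<^esub> f j = \<iota> (col p l E j)"
      using f by (auto simp: lifts_def)
    have f'j: "f' j \<in> carrier L" "q (f' j) = e j" "(p ^ l j) \<odot>\<^bsub>L\<^esub> f' j = \<iota> (col p l E' j)"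
      using f' by (auto simp: lifts_def)
    have "q ((- 1) \<odot>\<^bsub>L\<^esub> f j) = - e j"
      using mod_hom_smult[OF q _ fj(1), of "- 1"] fj(2) gen_closed[of j]
      by (simp add: vec_eq_iff poly_mod_minus_left resid_modD)
    moreover have m: "(- 1) \<odot>\<^bsub>L\<^esub> f j \<in> carrier L" using fj by simp
    ultimately have "q (f' j \<oplus>\<^bsub>L\<^esub> (- 1) \<odot>\<^bsub>L\<^esub> f j) = \<zero>\<^bsub>M\<^esub>"
      using mod_hom_add[OF q f'j(1) m] f'j by simp
    then have "f' j \<oplus>\<^bsub>L\<^esub> (- 1) \<odot>\<^bsub>L\<^esub> f j \<in> \<iota> ` carrier M" using ex f'j m by simp
    then obtain u where u: "u \<in> carrier M" "f' j \<oplus>\<^bsub>L\<^esub> (- 1) \<odot>\<^bsub>L\<^esub> f j = \<iota> u" by blast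
    have z: "f j \<oplus>\<^bsub>L\<^esub> (- 1) \<odot>\<^bsub>L\<^esub> f j = \<zero>\<^bsub>L\<^esub>"
      using L.smult_l_distr[of 1 "- 1" "f j"] fj(1) L.smult_one[of "f j"]
        L.smult_l_null[OF fj(1)] by simp
    have "\<iota> u \<oplus>\<^bsub>L\<^esub> f j = f' j \<oplus>\<^bsub>L\<^esub> (f j \<oplus>\<^bsub>L\<^esub> (- 1) \<odot>\<^bsub>L\<^esub> f j)"
      unfolding u(2)[symmetric] using fj f'j m by (simp add: L.M.add.m_ac)
    then have f'u: "f' j = \<iota> u \<oplus>\<^bsub>L\<^esub> f j" using z f'j by simp
    have "\<iota> (col p l E' j) = (p ^ l j) \<odot>\<^bsub>L\<^esub> \<iota> u \<oplus>\<^bsub>L\<^esub> \<iota> (col p l E j)"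
      using f'j(3) fj(3) unfolding f'u
      using L.smult_r_distr[of "p ^ l j" "\<iota> u" "f j"] mod_hom_closed[OF \<iota> u(1)] fj(1) by simp
    also have "\<dots> = \<iota> ((p ^ l j) \<odot>\<^bsub>M\<^esub> u \<oplus>\<^bsub>M\<^esub> col p l E j)"
      using mod_hom_add[OF \<iota>, of "(p ^ l j) \<odot>\<^bsub>M\<^esub> u" "col p l E j"] mod_hom_smult[OF \<iota> _ u(1), of "p ^ l j"]
        col_closed[of p l E j] by simp
    finally have "col p l E' j = (p ^ l j) \<odot>\<^bsub>M\<^esub> u \<oplus>\<^bsub>M\<^esub> col p l E j"
      using col_closed[of p l E j] col_closed[of p l E' j]
      by (intro inj_onD[OF inj]) (auto intro!: resid_add)
    then have "E' $ i $ j mod p ^ l i = (p ^ l j * u $ i + E $ i $ j) mod p ^ l i"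
      by (simp add: col_def vec_eq_iff poly_mod_add_left)
    then have "p ^ l i dvd (E' $ i $ j - E $ i $ j) - p ^ l j * u $ i"
      by (simp add: mod_eq_dvd_iff algebra_simps)
    then have "p ^ min (l i) (l j) dvd (E' $ i $ j - E $ i $ j) - p ^ l j * u $ i"
      by (rule dvd_trans[rotated]) (simp add: le_imp_power_dvd)
    moreover have "p ^ min (l i) (l j) dvd p ^ l j * u $ i"
      by (rule dvd_mult2) (simp add: le_imp_power_dvd)
    ultimately show ?thesis by (simp add: dvd_diff_right_iff dvd_diff_left_iff)
  qed
  then show ?thesis using mat_cong_sym unfolding mat_cong_def by blast
qed

lemma ext_of_matrix_eq_iff: "ext_of_matrix p l E = ext_of_matrix p l E' \<longleftrightarrow> mat_cong E E'"
proof
  assume "ext_of_matrix p l E = ext_of_matrix p l E'"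
  then have "std_ext p l E \<in> ext_of_matrix p l E'" using std_ext_matrix by metis
  then show "mat_cong E E'" by (rule ext_matrix_unique[OF std_ext_matrix])
next
  assume "mat_cong E E'"
  then show "ext_of_matrix p l E = ext_of_matrix p l E'"
    using ext_of_matrix_cong_mem[of _ E E'] ext_of_matrix_cong_mem[of _ E' E] mat_cong_sym[of E E'] by auto
qed

lemma hom_apply:
  assumes g: "g \<in> mod_hom kt M M" and v: "v \<in> carrier M"
  shows "g v = (\<chi> h. (\<Sum>j\<in>UNIV. aut_matrix g e $ h $ j * v $ j) mod p ^ l h)"
proof -
  have "finsum M (\<lambda>j. v $ j \<odot>\<^bsub>M\<^esub> e j) UNIV = (\<chi> h. (\<Sum>j\<in>UNIV. v $ j * e j $ h) mod p ^ l h)"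
    by (rule finsum_tmod[OF finite gen_closed])
  also have "\<dots> = v" using v by (simp add: sum_gen resid_modD vec_eq_iff)
  finally have "finsum M (\<lambda>j. v $ j \<odot>\<^bsub>M\<^esub> e j) UNIV = v" .
  then have "g v = g (finsum M (\<lambda>j. v $ j \<odot>\<^bsub>M\<^esub> e j) UNIV)" by simp
  also have "\<dots> = (\<chi> h. (\<Sum>j\<in>UNIV. v $ j * g (e j) $ h) mod p ^ l h)"
    by (rule finsum_hom_to_tmod[OF module_tmod g gen_closed])
  finally show ?thesis by (simp add: aut_matrix_def mult.commute)
qed

lemma hom_gen_dvd:
  assumes g: "g \<in> mod_hom kt M M"
  shows "p ^ l i dvd aut_matrix g e $ i $ j * p ^ l j"
proof -
  have "(p ^ l j) \<odot>\<^bsub>M\<^esub> g (e j) = g ((p ^ l j) \<odot>\<^bsub>M\<^esub> e j)"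
    using mod_hom_smult[OF g _ gen_closed, of "p ^ l j"] by simp
  also have "(p ^ l j) \<odot>\<^bsub>M\<^esub> e j = \<zero>\<^bsub>M\<^esub>" by (auto simp: vec_eq_iff gen_nth)
  also have "g \<zero>\<^bsub>M\<^esub> = \<zero>\<^bsub>M\<^esub>" by (rule mod_hom_zero[OF module_tmod module_tmod g])
  finally have "(p ^ l j * g (e j) $ i) mod p ^ l i = 0" by (simp add: vec_eq_iff)
  then show ?thesis by (simp add: aut_matrix_def mult.commute mod_eq_0_iff_dvd)
qed

text \<open>
  This is the matrix \<open>g\<^sup>#\<close>: the lift of an endomorphism \<open>g\<close> to the free resolution of \<open>M\<close> consists of
  the matrix of \<open>g\<close> in degree zero and of \<open>g\<^sup>#\<close> in degree one. Being a relation, it avoids division by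
  powers of \<open>p\<close>.
\<close>

definition sharp_of where
  "sharp_of A B \<longleftrightarrow> (\<forall>i j. A $ i $ j * p ^ l j = p ^ l i * B $ i $ j)"

lemma sharp_exists:
  assumes "g \<in> mod_hom kt M M"
  shows "\<exists>B. sharp_of (aut_matrix g e) B"
proof -
  have "sharp_of (aut_matrix g e) (\<chi> i j. (aut_matrix g e $ i $ j * p ^ l j) div p ^ l i)"
    using hom_gen_dvd[OF assms] by (simp add: sharp_of_def)
  then show ?thesis by blast
qed

text \<open>
  If \<open>f'\<^sub>i\<close> are lifts for the new extension, then \<open>\<Sum> A\<^sub>i\<^sub>j f'\<^sub>i\<close> lifts \<open>e\<^sub>j\<close> in the old one, since the new
  projection is the old one followed by \<open>g\<close>. Multiplication by \<open>p\<^bsup>l j\<^esup>\<close> turns the coefficients into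
  \<open>B\<^sub>i\<^sub>j p\<^bsup>l i\<^esup>\<close>, so that these lifts have the columns of \<open>E' B\<close>, pulled back along \<open>g\<close>. The old
  extension has the matrix \<open>E\<close> as well, and its matrix is unique up to congruence.
\<close>

lemma conj_matrix:
  assumes g: "g \<in> carrier (mod_Aut kt M)" and B: "sharp_of (aut_matrix g e) B"
    and x: "x \<in> ext_of_matrix p l E" and y: "ext_conj M g x \<in> ext_of_matrix p l E'"
  shows "mat_cong (aut_matrix g e ** E) (E' ** B)"
proof -
  let ?A = "aut_matrix g e" and ?k = "inv_into (carrier M) g"
  obtain L \<iota> q where X: "x = (L, \<iota>, q)" by (cases x)
  note gh = Aut_hom[OF g] and gb = Aut_bij[OF g]
  have ext: "(L, \<iota>, q) \<in> extensions kt M M" using x X by (auto simp: ext_of_matrix_iff)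
  have L: "Module.module kt L" and \<iota>: "\<iota> \<in> mod_hom kt M L" and q: "q \<in> mod_hom kt L M"
    using ext by (auto simp: extensions_def)
  interpret L: Module.module kt L by fact
  have "(L, \<iota> \<circ> ?k, g \<circ> q) \<in> extensions kt M M"
    using ext_conj_extension[OF module_tmod g ext] by (simp add: ext_conj_def)
  then have \<iota>': "\<iota> \<circ> ?k \<in> mod_hom kt M L" and q': "g \<circ> q \<in> mod_hom kt L M"
    by (auto simp: extensions_def)
  from y[unfolded X] obtain f where f: "lifts L (\<iota> \<circ> ?k) (g \<circ> q) E' f"
    by (auto simp: ext_of_matrix_iff ext_conj_def)
  have fc: "f i \<in> carrier L" and qf: "(g \<circ> q) (f i) = e i"
    and pf: "(p ^ l i) \<odot>\<^bsub>L\<^esub> f i = (\<iota> \<circ> ?k) (col p l E' i)" for i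
    using f unfolding lifts_def by blast+
  \<comment> \<open>The combinations of the new lifts with the columns of \<open>?A\<close> are lifts for the old extension.\<close>
  define F where "F = (\<lambda>j. finsum L (\<lambda>i. ?A $ i $ j \<odot>\<^bsub>L\<^esub> f i) UNIV)"
  have Fc: "F j \<in> carrier L" for j unfolding F_def using fc by (intro L.M.finsum_closed) auto
  have qF: "q (F j) = e j" for j
  proof -
    have "(g \<circ> q) (F j) = (\<chi> h. (\<Sum>i\<in>UNIV. ?A $ i $ j * e i $ h) mod p ^ l h)"
      unfolding F_def finsum_hom_to_tmod[OF L q' fc] qf ..
    also have "\<dots> = g (e j)"
      using mod_hom_closed[OF gh gen_closed[of j]] by (simp add: vec_eq_iff sum_gen aut_matrix_def resid_modD)
    finally show ?thesis
      using gb mod_hom_closed[OF q Fc] gen_closed[of j] by (auto simp: bij_betw_def dest: inj_onD)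
  qed
  have pF: "(p ^ l j) \<odot>\<^bsub>L\<^esub> F j = (\<iota> \<circ> ?k) (col p l (E' ** B) j)" for j
  proof -
    have "(p ^ l j) \<odot>\<^bsub>L\<^esub> F j = finsum L (\<lambda>i. (p ^ l j) \<odot>\<^bsub>L\<^esub> (?A $ i $ j \<odot>\<^bsub>L\<^esub> f i)) UNIV"
      unfolding F_def using fc by (intro L.finsum_smult_ldistr) auto
    also have "(\<lambda>i. (p ^ l j) \<odot>\<^bsub>L\<^esub> (?A $ i $ j \<odot>\<^bsub>L\<^esub> f i)) = (\<lambda>i. B $ i $ j \<odot>\<^bsub>L\<^esub> (\<iota> \<circ> ?k) (col p l E' i))"
    proof
      fix i
      have "(p ^ l j) \<odot>\<^bsub>L\<^esub> (?A $ i $ j \<odot>\<^bsub>L\<^esub> f i) = (?A $ i $ j * p ^ l j) \<odot>\<^bsub>L\<^esub> f i"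
        using L.smult_assoc1[of "p ^ l j" "?A $ i $ j" "f i"] fc by (simp add: mult.commute)
      also have "\<dots> = (B $ i $ j * p ^ l i) \<odot>\<^bsub>L\<^esub> f i"
        using B by (simp add: sharp_of_def mult.commute)
      also have "\<dots> = B $ i $ j \<odot>\<^bsub>L\<^esub> (\<iota> \<circ> ?k) (col p l E' i)"
        using L.smult_assoc1[of "B $ i $ j" "p ^ l i" "f i"] fc pf by simp
      finally show "(p ^ l j) \<odot>\<^bsub>L\<^esub> (?A $ i $ j \<odot>\<^bsub>L\<^esub> f i) = B $ i $ j \<odot>\<^bsub>L\<^esub> (\<iota> \<circ> ?k) (col p l E' i)" .
    qed
    also have "finsum L (\<lambda>i. B $ i $ j \<odot>\<^bsub>L\<^esub> (\<iota> \<circ> ?k) (col p l E' i)) UNIV =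
        (\<iota> \<circ> ?k) (\<chi> h. (\<Sum>i\<in>UNIV. B $ i $ j * col p l E' i $ h) mod p ^ l h)"
      by (rule finsum_hom_from_tmod[OF L \<iota>' col_closed])
    also have "(\<chi> h. (\<Sum>i\<in>UNIV. B $ i $ j * col p l E' i $ h) mod p ^ l h) = col p l (E' ** B) j"
      unfolding col_def vec_eq_iff vec_lambda_beta matrix_matrix_mult_def
      by (intro allI sum_mod_cong) (simp add: mod_mult_right_eq mult.commute)
    finally show ?thesis .
  qed
  define E2 where "E2 = (\<chi> i j. ?k (col p l (E' ** B) j) $ i)"
  have kc: "?k w \<in> carrier M" "g (?k w) = w" if "w \<in> carrier M" for w
    using gb that bij_betw_apply[OF bij_betw_inv_into[OF gb]] bij_betw_inv_into_right[OF gb] by blast+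
  have colE2: "col p l E2 j = ?k (col p l (E' ** B) j)" for j
  proof -
    have "E2 $ i $ j = ?k (col p l (E' ** B) j) $ i" for i by (simp add: E2_def)
    then show ?thesis using kc(1)[OF col_closed, of "E' ** B" j]
      by (simp add: col_def[of p l E2] vec_eq_iff resid_modD)
  qed
  have "lifts L \<iota> q E2 F" using Fc qF pF colE2 by (simp add: lifts_def)
  then have x2: "x \<in> ext_of_matrix p l E2" using X ext ext_of_matrix_iff by blast
  have EE2: "mat_cong E E2" by (rule ext_matrix_unique[OF x x2])
  show ?thesis unfolding mat_cong_def
  proof (intro allI)
    fix h j
    let ?m = "p ^ min (l h) (l j)"
    have "g (col p l E2 j) = col p l (E' ** B) j" unfolding colE2 by (rule kc(2)[OF col_closed])
    then have "(\<Sum>k\<in>UNIV. ?A $ h $ k * col p l E2 j $ k) mod p ^ l h = (E' ** B) $ h $ j mod p ^ l h"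
      unfolding hom_apply[OF gh col_closed] by (simp add: vec_eq_iff col_def)
    then have "p ^ l h dvd (\<Sum>k\<in>UNIV. ?A $ h $ k * col p l E2 j $ k) - (E' ** B) $ h $ j"
      by (simp add: mod_eq_dvd_iff)
    then have 1: "?m dvd (\<Sum>k\<in>UNIV. ?A $ h $ k * col p l E2 j $ k) - (E' ** B) $ h $ j"
      by (rule dvd_trans[rotated]) (simp add: le_imp_power_dvd)
    have "?m dvd ?A $ h $ k * (E $ k $ j - col p l E2 j $ k)" for k
    proof -
      have a: "p ^ min (l k) (l j) dvd E $ k $ j - E2 $ k $ j" using EE2 by (simp add: mat_cong_def)
      have b: "p ^ min (l k) (l j) dvd E2 $ k $ j - col p l E2 j $ k"
        by (rule dvd_trans[of _ "p ^ l k"]) (simp_all add: le_imp_power_dvd col_def minus_mod_eq_mult_div)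
      have c: "p ^ min (l k) (l j) dvd E $ k $ j - col p l E2 j $ k"
        using dvd_add[OF a b] by simp
      have "?m dvd ?A $ h $ k * p ^ min (l k) (l j)"
      proof (cases "l k \<le> l j")
        case True
        then show ?thesis using hom_gen_dvd[OF gh, of h k]
          by (simp add: min_absorb1) (rule dvd_trans[of _ "p ^ l h"], simp_all add: le_imp_power_dvd)
      next
        case False
        then show ?thesis by (simp add: min_absorb2 le_imp_power_dvd dvd_mult)
      qed
      also have "\<dots> dvd ?A $ h $ k * (E $ k $ j - col p l E2 j $ k)" by (rule mult_dvd_mono[OF dvd_refl c])
      finally show ?thesis .
    qed
    then have "?m dvd (\<Sum>k\<in>UNIV. ?A $ h $ k * (E $ k $ j - col p l E2 j $ k))" by (intro dvd_sum) auto
    from dvd_add[OF this 1] show "?m dvd (?A ** E) $ h $ j - (E' ** B) $ h $ j"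
      by (simp add: matrix_matrix_mult_def right_diff_distrib sum_subtractf)
  qed
qed

lemma inverse_matrix:
  assumes g: "g \<in> carrier (mod_Aut kt M)" 
  obtains k where "k \<in> carrier (mod_Aut kt M)"
    "\<And>i j. p ^ l i dvd (aut_matrix g e ** aut_matrix k e) $ i $ j - (if i = j then 1 else 0)"
proof -
  define k where "k = restrict (inv_into (carrier M) g) (carrier M)"
  have k: "k \<in> carrier (mod_Aut kt M)" unfolding k_def by (rule Aut_inverse_closed[OF module_tmod g])
  have "p ^ l i dvd (aut_matrix g e ** aut_matrix k e) $ i $ j - (if i = j then 1 else 0)" for i j
  proof -
    have kj: "k (e j) \<in> carrier M" by (rule mod_hom_closed[OF Aut_hom[OF k] gen_closed])
    have "g (k (e j)) = e j"
      using gen_closed[of j] Aut_bij[OF g] by (simp add: k_def bij_betw_inv_into_right)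
    then have "(\<Sum>h\<in>UNIV. aut_matrix g e $ i $ h * aut_matrix k e $ h $ j) mod p ^ l i = (if i = j then 1 else 0) mod p ^ l i"
      unfolding hom_apply[OF Aut_hom[OF g] kj] by (simp add: vec_eq_iff aut_matrix_def gen_nth)
    then show ?thesis by (simp add: matrix_matrix_mult_def mod_eq_dvd_iff)
  qed
  then show thesis using k that by blast
qed

text \<open>
  The matrix \<open>B\<close> is invertible, its inverse being the sharp of the matrix of the inverse automorphism.
  Entries of a sharp have enough factors \<open>p\<close> for multiplication by it to respect the congruence.
\<close>

lemma sharp_cancel:
  assumes g: "g \<in> carrier (mod_Aut kt M)" and B: "sharp_of (aut_matrix g e) B"
    and c: "mat_cong (E ** B) (E' ** B)"
  shows "mat_cong E E'"
proof -
  let ?A = "aut_matrix g e"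
  obtain k where k: "k \<in> carrier (mod_Aut kt M)"
    and AA': "\<And>i j. p ^ l i dvd (?A ** aut_matrix k e) $ i $ j - (if i = j then 1 else 0)"
    using inverse_matrix[OF g] by blast
  let ?A' = "aut_matrix k e"
  obtain B' where B': "sharp_of ?A' B'" using sharp_exists[OF Aut_hom[OF k]] by blast
  have BB': "p ^ l j dvd (B ** B') $ i $ j - (if i = j then 1 else 0)" for i j
  proof -
    have "p ^ l i * (B ** B') $ i $ j = (\<Sum>h\<in>UNIV. (p ^ l i * B $ i $ h) * B' $ h $ j)"
      by (simp add: matrix_matrix_mult_def sum_distrib_left mult.assoc)
    also have "\<dots> = (\<Sum>h\<in>UNIV. ?A $ i $ h * (p ^ l h * B' $ h $ j))"
      using B by (intro sum.cong) (auto simp: sharp_of_def mult.assoc[symmetric])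
    also have "\<dots> = (\<Sum>h\<in>UNIV. ?A $ i $ h * (?A' $ h $ j * p ^ l j))"
      using B' by (simp add: sharp_of_def)
    also have "\<dots> = (?A ** ?A') $ i $ j * p ^ l j"
      by (simp add: matrix_matrix_mult_def sum_distrib_right mult.assoc)
    finally have "p ^ l i * ((B ** B') $ i $ j - (if i = j then 1 else 0)) =
        ((?A ** ?A') $ i $ j - (if i = j then 1 else 0)) * p ^ l j"
      by (simp add: algebra_simps)
    moreover have "p ^ l i * p ^ l j dvd \<dots>" by (rule mult_dvd_mono[OF AA' dvd_refl])
    ultimately have "p ^ l i * p ^ l j dvd p ^ l i * ((B ** B') $ i $ j - (if i = j then 1 else 0))" by metis
    then show ?thesis by (subst (asm) dvd_mult_cancel_left) simp
  qed
  show ?thesis unfolding mat_cong_def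
  proof (intro allI)
    fix h j
    let ?m = "p ^ min (l h) (l j)" and ?X = "E - E'"
    have "?m dvd (?X ** B) $ h $ i * B' $ i $ j" for i
    proof -
      have "(?X ** B) $ h $ i = (E ** B) $ h $ i - (E' ** B) $ h $ i"
        by (simp add: matrix_matrix_mult_def left_diff_distrib sum_subtractf)
      then have "p ^ min (l h) (l i) dvd (?X ** B) $ h $ i" using c by (simp add: mat_cong_def)
      then have "p ^ min (l h) (l i) * B' $ i $ j dvd (?X ** B) $ h $ i * B' $ i $ j"
        by (rule mult_dvd_mono) simp
      moreover have "?m dvd p ^ min (l h) (l i) * B' $ i $ j"
      proof (cases "l i \<le> l h")
        case True
        then have "p ^ min (l h) (l i) * B' $ i $ j = ?A' $ i $ j * p ^ l j"
          using B' by (simp add: sharp_of_def min_absorb2)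
        then show ?thesis by (simp add: le_imp_power_dvd dvd_mult)
      next
        case False
        then show ?thesis by (simp add: min_absorb1 le_imp_power_dvd dvd_mult2)
      qed
      ultimately show ?thesis by (rule dvd_trans[rotated])
    qed
    then have 1: "?m dvd (\<Sum>i\<in>UNIV. (?X ** B) $ h $ i * B' $ i $ j)" by (intro dvd_sum) auto
    have "(\<Sum>i\<in>UNIV. (?X ** B) $ h $ i * B' $ i $ j) = ((?X ** B) ** B') $ h $ j"
      by (simp add: matrix_matrix_mult_def)
    also have "\<dots> = (\<Sum>i\<in>UNIV. ?X $ h $ i * (B ** B') $ i $ j)"
      unfolding matrix_mul_assoc[symmetric] by (simp add: matrix_matrix_mult_def)
    finally have 2: "?m dvd (\<Sum>i\<in>UNIV. ?X $ h $ i * (B ** B') $ i $ j)" using 1 by simp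
    have "?m dvd p ^ l j" by (simp add: le_imp_power_dvd)
    then have "?m dvd ?X $ h $ i * ((B ** B') $ i $ j - (if i = j then 1 else 0))" for i
      using BB' by (intro dvd_mult) (rule dvd_trans)
    then have 3: "?m dvd (\<Sum>i\<in>UNIV. ?X $ h $ i * ((B ** B') $ i $ j - (if i = j then 1 else 0)))"
      by (intro dvd_sum) auto
    have "(\<Sum>i\<in>UNIV. ?X $ h $ i * (B ** B') $ i $ j) -
        (\<Sum>i\<in>UNIV. ?X $ h $ i * ((B ** B') $ i $ j - (if i = j then 1 else 0))) = ?X $ h $ j"
      unfolding sum_subtractf[symmetric] right_diff_distrib[symmetric] by (simp add: if_distrib cong: if_cong)
    then show "?m dvd E $ h $ j - E' $ h $ j" using dvd_diff[OF 2 3] by simp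
  qed
qed

text \<open>
  The image of the class of \<open>E\<close> has some matrix \<open>E2\<close>, for which \<open>A E \<equiv> E2 B\<close>; cancelling \<open>B\<close> compares it
  with \<open>E'\<close>.
\<close>

lemma act_matrix_iff:
  assumes g: "g \<in> carrier (mod_Aut kt M)" and B: "sharp_of (aut_matrix g e) B"
  shows "ext_act kt M g (ext_of_matrix p l E) = ext_of_matrix p l E' \<longleftrightarrow>
     mat_cong (aut_matrix g e ** E) (E' ** B)"
proof -
  let ?x = "std_ext p l E"
  have x: "?x \<in> extensions kt M M" by (rule std_ext_extension) simp
  note gx = ext_conj_extension[OF module_tmod g x]
  obtain E2 where E2: "ext_conj M g ?x \<in> ext_of_matrix p l E2" using ext_matrix_exists[OF gx] by blast
  have "ext_act kt M g (ext_of_matrix p l E) = ext_of_matrix p l E2"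
    using ext_act_class[OF module_tmod g x] ext_of_matrix_class[OF E2]
      ext_of_matrix_class[OF std_ext_matrix, of E] by simp
  then have 1: "ext_act kt M g (ext_of_matrix p l E) = ext_of_matrix p l E' \<longleftrightarrow> mat_cong E2 E'"
    using ext_of_matrix_eq_iff by simp
  have 2: "mat_cong (aut_matrix g e ** E) (E2 ** B)" by (rule conj_matrix[OF g B std_ext_matrix E2])
  have "mat_cong (E2 ** B) (E' ** B) \<longleftrightarrow> mat_cong E2 E'"
  proof
    assume "mat_cong (E2 ** B) (E' ** B)"
    then show "mat_cong E2 E'" by (rule sharp_cancel[OF g B])
  next
    assume "mat_cong E2 E'"
    then have "ext_conj M g ?x \<in> ext_of_matrix p l E'" using E2 ext_of_matrix_eq_iff by blast
    from conj_matrix[OF g B std_ext_matrix this] show "mat_cong (E2 ** B) (E' ** B)"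
      using 2 mat_cong_sym mat_cong_trans by blast
  qed
  then show ?thesis using 1 2 mat_cong_sym mat_cong_trans by blast
qed

section \<open>Automorphisms given by matrices\<close>

definition mat_map where
  "mat_map A v = (\<chi> h. (\<Sum>j\<in>UNIV. A $ h $ j * v $ j) mod p ^ l h)"

text \<open>
  The condition for multiplication by \<open>A\<close> to be well defined on classes modulo powers of \<open>p\<close>.
\<close>

definition admissible where
  "admissible A \<longleftrightarrow> (\<forall>h j. p ^ l h dvd A $ h $ j * p ^ l j)"

lemma mat_map_closed [simp]: "mat_map A v \<in> carrier M"
  by (simp add: mat_map_def)

lemma mat_map_row_mod:
  assumes "admissible A" "\<And>j. w $ j mod p ^ l j = v $ j mod p ^ l j"
  shows "mat_map A w = mat_map A v"
  unfolding mat_map_def vec_eq_iff vec_lambda_beta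
proof (intro allI sum_mod_cong)
  fix h j
  have "p ^ l j dvd w $ j - v $ j" using assms(2)[of j] by (simp add: mod_eq_dvd_iff)
  then have "A $ h $ j * p ^ l j dvd A $ h $ j * (w $ j - v $ j)" by (rule mult_dvd_mono[OF dvd_refl])
  then have "p ^ l h dvd A $ h $ j * (w $ j - v $ j)"
    using assms(1) dvd_trans unfolding admissible_def by blast
  then show "A $ h $ j * w $ j mod p ^ l h = A $ h $ j * v $ j mod p ^ l h"
    by (simp add: mod_eq_dvd_iff right_diff_distrib)
qed

lemma mat_map_comp:
  assumes "admissible A"
  shows "mat_map A (mat_map A' v) = mat_map (A ** A') v"
proof -
  have "mat_map A (mat_map A' v) = mat_map A (A' *v v)"
    by (rule mat_map_row_mod[OF assms]) (simp add: mat_map_def matrix_vector_mult_def)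
  also have "\<dots> = mat_map (A ** A') v"
    using matrix_vector_mul_assoc[of A A' v] by (simp add: mat_map_def matrix_vector_mult_def vec_eq_iff)
  finally show ?thesis .
qed

lemma mat_map_cong_id:
  assumes "\<And>h j. p ^ l h dvd A $ h $ j - (if h = j then 1 else 0)" and v: "v \<in> carrier M"
  shows "mat_map A v = v"
proof -
  have "(\<Sum>j\<in>UNIV. A $ h $ j * v $ j) mod p ^ l h = (\<Sum>j\<in>UNIV. if j = h then v $ j else 0) mod p ^ l h" for h
  proof (rule sum_mod_cong)
    fix j
    have "p ^ l h dvd (A $ h $ j - (if h = j then 1 else 0)) * v $ j" by (rule dvd_mult2[OF assms(1)])
    then show "A $ h $ j * v $ j mod p ^ l h = (if j = h then v $ j else 0) mod p ^ l h"
      by (auto simp: mod_eq_dvd_iff left_diff_distrib)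
  qed
  then show ?thesis using v by (simp add: mat_map_def vec_eq_iff resid_modD)
qed

lemma mat_map_hom:
  assumes "admissible A"
  shows "mat_map A \<in> mod_hom kt M M"
  unfolding mod_hom_def
proof (intro CollectI conjI ballI)
  show "mat_map A \<in> carrier M \<rightarrow> carrier M" using mat_map_closed by blast
  show "mat_map A (x \<oplus>\<^bsub>M\<^esub> y) = mat_map A x \<oplus>\<^bsub>M\<^esub> mat_map A y" for x y
    by (simp add: mat_map_def vec_eq_iff distrib_left sum.distrib poly_mod_add_left)
  show "mat_map A (r \<odot>\<^bsub>M\<^esub> x) = r \<odot>\<^bsub>M\<^esub> mat_map A x" for r x
  proof -
    have "mat_map A (r \<odot>\<^bsub>M\<^esub> x) = mat_map A (\<chi> j. r * x $ j)"
      by (rule mat_map_row_mod[OF assms]) simp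
    also have "\<dots> = r \<odot>\<^bsub>M\<^esub> mat_map A x"
      by (simp add: mat_map_def vec_eq_iff mod_mult_right_eq sum_distrib_left mult.left_commute)
    finally show ?thesis .
  qed
qed

text \<open>
  As maps \<open>A A' = 1\<close> and \<open>A' A'' = 1\<close>, whence \<open>A = A''\<close> and \<open>A' A = 1\<close>. Right inverses are thus enough,
  provided that the right inverse has one as well.
\<close>

lemma automorphism_of_matrix:
  assumes adm: "admissible A" "admissible A'"
    and id: "\<And>h j. p ^ l h dvd (A ** A') $ h $ j - (if h = j then 1 else 0)"
      "\<And>h j. p ^ l h dvd (A' ** A'') $ h $ j - (if h = j then 1 else 0)"
    and red: "\<And>h j. A $ h $ j \<in> resid (p ^ l h)"
  shows "\<exists>g\<in>carrier (mod_Aut kt M). aut_matrix g e = A"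
proof
  let ?g = "restrict (mat_map A) (carrier M)"
  have 1: "mat_map A (mat_map A' v) = v" if "v \<in> carrier M" for v
    unfolding mat_map_comp[OF adm(1)] by (rule mat_map_cong_id[OF id(1) that])
  have 2: "mat_map A' (mat_map A'' v) = v" if "v \<in> carrier M" for v
    unfolding mat_map_comp[OF adm(2)] by (rule mat_map_cong_id[OF id(2) that])
  have 3: "mat_map A' (mat_map A v) = v" if "v \<in> carrier M" for v
    using 1[OF mat_map_closed, of A'' v] 2[OF that] by simp
  have "bij_betw (mat_map A) (carrier M) (carrier M)"
    by (rule bij_betw_byWitness[where f' = "mat_map A'"]) (use 1 3 mat_map_closed in blast)+
  then have "bij_betw ?g (carrier M) (carrier M)" by (simp add: bij_betw_restrict_eq)
  then show "?g \<in> carrier (mod_Aut kt M)"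
    unfolding carrier_mod_Aut Bij_def
    using mod_hom_cong[OF mat_map_hom[OF adm(1)] module_tmod, of ?g] by simp
  have "(\<Sum>j\<in>UNIV. A $ h $ j * e k $ j) = A $ h $ k" for h k by (rule sum_gen')
  then show "aut_matrix ?g e = A"
    using gen_closed red by (simp add: aut_matrix_def vec_eq_iff mat_map_def resid_modD)
qed

lemma aut_matrix_inj: "inj_on (\<lambda>g. aut_matrix g e) (carrier (mod_Aut kt M))"
proof (rule inj_onI)
  fix g g' assume g: "g \<in> carrier (mod_Aut kt M)" and g': "g' \<in> carrier (mod_Aut kt M)"
    and eq: "aut_matrix g e = aut_matrix g' e"
  show "g = g'"
  proof (rule extensionalityI[of _ "carrier M"])
    show "g \<in> extensional (carrier M)" "g' \<in> extensional (carrier M)"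
      using g g' unfolding carrier_mod_Aut Bij_def by blast+
    show "g x = g' x" if "x \<in> carrier M" for x
      using hom_apply[OF Aut_hom[OF g] that] hom_apply[OF Aut_hom[OF g'] that] eq by simp
  qed
qed

lemma aut_matrix_resid:
  assumes "g \<in> carrier (mod_Aut kt M)"
  shows "aut_matrix g e $ i $ j \<in> resid (p ^ l i)"
  using mod_hom_closed[OF Aut_hom[OF assms] gen_closed[of j]] by (simp add: aut_matrix_def)

end


section \<open>Reduction to the residue field\<close>

text \<open>
  An element of least degree of the ideal generated by \<open>p\<close> and \<open>f\<close> divides both, hence is a unit.
\<close>

lemma field_poly_bezout:
  fixes p f :: "'k::field poly"
  assumes p: "irreducible p" and f: "\<not> p dvd f"
  shows "\<exists>u v. u * p + v * f = 1"
proof -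
  define I where "I = {u * p + v * f | u v. True}"
  have pI: "p \<in> I" "f \<in> I" unfolding I_def by (auto intro: exI[of _ 1] exI[of _ 0])
  have p0: "p \<noteq> 0" using p by auto
  define d where "d = (ARG_MIN degree x. x \<in> I \<and> x \<noteq> 0)"
  have d: "d \<in> I" "d \<noteq> 0" "\<And>x. x \<in> I \<Longrightarrow> x \<noteq> 0 \<Longrightarrow> degree d \<le> degree x"
    using arg_min_natI[of "\<lambda>x. x \<in> I \<and> x \<noteq> 0" p degree] arg_min_nat_le[of "\<lambda>x. x \<in> I \<and> x \<noteq> 0" _ degree]
      pI p0 unfolding d_def by auto
  have dvd: "d dvd x" if x: "x \<in> I" for x
  proof (rule ccontr)
    assume nd: "\<not> d dvd x"
    obtain a b a' b' where ab: "x = a * p + b * f" "d = a' * p + b' * f" using x d(1) by (auto simp: I_def)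
    have "x mod d = x - (x div d) * d" by (simp add: minus_div_mult_eq_mod)
    also have "\<dots> = (a - (x div d) * a') * p + (b - (x div d) * b') * f"
      by (subst (1) ab(1), subst (2) ab(2)) (simp add: algebra_simps)
    finally have "x mod d \<in> I" by (auto simp: I_def)
    moreover have "x mod d \<noteq> 0" using nd by (simp add: mod_eq_0_iff_dvd)
    ultimately have "degree d \<le> degree (x mod d)" using d(3) by blast
    then show False using degree_mod_less[OF d(2), of x] \<open>x mod d \<noteq> 0\<close> by auto
  qed
  have "\<not> p dvd d" using dvd[OF pI(2)] f dvd_trans by blast
  then have "is_unit d" using irreducibleD'[OF p dvd[OF pI(1)]] by blast
  then obtain c where c: "1 = d * c" by (auto elim: dvdE)
  obtain a b where "d = a * p + b * f" using d(1) by (auto simp: I_def)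
  then have "(c * a) * p + (c * b) * f = 1" using c by (simp add: algebra_simps)
  then show ?thesis by blast
qed

lemma unit_mod_power:
  fixes p :: "'k::field poly"
  assumes p: "irreducible p" and f: "\<not> p dvd f"
  shows "\<exists>h. p ^ n dvd f * h - 1"
proof -
  obtain u v where uv: "u * p + v * f = 1" using field_poly_bezout[OF p f] by blast
  show ?thesis
  proof (induction n)
    case (Suc n)
    then obtain h w where h: "f * h - 1 = p ^ n * w" by (auto elim: dvdE)
    \<comment> \<open>Newton step: \<open>f * v \<equiv> 1\<close> modulo \<open>p\<close>.\<close>
    have "f * (h - p ^ n * w * v) - 1 = (f * h - 1) - p ^ n * w * (v * f)" by (simp add: algebra_simps)
    also have "v * f = 1 - u * p" using uv by (simp add: algebra_simps)
    also have "(f * h - 1) - p ^ n * w * (1 - u * p) = p ^ Suc n * (w * u)" unfolding h by (simp add: algebra_simps)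
    finally show ?case by (metis dvd_triv_left)
  qed simp
qed

lemma resid_units_iff:
  fixes p :: "'k::field poly"
  assumes p: "irreducible p" and n: "n > 0"
  shows "f \<in> resid_units (p ^ n) \<longleftrightarrow> f \<in> resid (p ^ n) \<and> \<not> p dvd f"
proof -
  have deg: "degree p > 0"
    using p is_unit_iff_degree[of p] irreducible_not_unit by (cases "p = 0") (auto simp: irreducible_def)
  then have "p \<noteq> 0" by auto
  then have "degree (p ^ n) > 0" using n deg by (simp add: degree_power_eq)
  then have one: "1 mod p ^ n = 1" by (simp add: mod_poly_less)
  have "\<exists>h\<in>resid (p ^ n). (f * h) mod p ^ n = 1" if nd: "\<not> p dvd f"
  proof -
    obtain h where h: "p ^ n dvd f * h - 1" using unit_mod_power[OF p nd] by blast
    have "(f * (h mod p ^ n)) mod p ^ n = (f * h) mod p ^ n" by (rule mod_mult_right_eq)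
    also have "\<dots> = 1" using h one by (metis mod_eq_dvd_iff)
    finally show ?thesis by (intro bexI[of _ "h mod p ^ n"]) auto
  qed
  moreover have "\<not> p dvd f" if h: "(f * h) mod p ^ n = 1" for h
  proof
    assume "p dvd f"
    moreover have "p dvd p ^ n" using n by simp
    ultimately have "p dvd (f * h) mod p ^ n" by (simp add: dvd_mod)
    then have "is_unit p" using h by simp
    then show False using p irreducible_not_unit by blast
  qed
  ultimately show ?thesis by (auto simp: resid_units_def)
qed

locale residue_field =
  fixes p :: "'k::field poly"
  assumes irr: "irreducible p"
begin

lemma deg: "degree p > 0"
  using irr is_unit_iff_degree[of p] irreducible_not_unit by (cases "p = 0") (auto simp: irreducible_def)

definition root :: "'k alg_closure" where
  "root = (SOME z. poly (map_poly to_ac p) z = 0)"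

text \<open>
  Reduction modulo \<open>p\<close>, with the residue field \<open>k[t]/p\<close> embedded into an algebraic closure of \<open>k\<close>. As
  \<open>p\<close> is a variable, \<open>k[t]/p\<close> is not itself a type; this way its elements belong to a type that is a field.
\<close>

definition red :: "'k poly \<Rightarrow> 'k alg_closure" where
  "red f = poly (map_poly to_ac f) root"

lemma red_add [simp]: "red (f + g) = red f + red g"
proof -
  have "map_poly to_ac (f + g) = map_poly to_ac f + map_poly to_ac g"
    by (intro poly_eqI) (simp add: coeff_map_poly)
  then show ?thesis by (simp add: red_def)
qed

lemma red_mult [simp]: "red (f * g) = red f * red g"
proof -
  have "map_poly to_ac (f * g) = map_poly to_ac f * map_poly to_ac g"
    by (intro poly_eqI) (simp add: coeff_map_poly coeff_mult to_ac_sum)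
  then show ?thesis by (simp add: red_def)
qed

lemma red_0 [simp]: "red 0 = 0" and red_1 [simp]: "red 1 = 1"
  by (simp_all add: red_def)

lemma red_uminus [simp]: "red (- f) = - red f"
  using red_add[of f "- f"] by (simp add: add_eq_0_iff)

lemma red_diff [simp]: "red (f - g) = red f - red g"
  using red_add[of f "- g"] by simp

lemma red_p [simp]: "red p = 0"
proof -
  have "degree (map_poly to_ac p) > 0" using deg by (subst degree_map_poly) auto
  then have "\<exists>z. poly (map_poly to_ac p) z = 0"
    using alg_closed_imp_poly_has_root by blast
  then show ?thesis unfolding red_def root_def by (rule someI_ex)
qed

lemma red_power [simp]: "red (f ^ n) = red f ^ n"
  by (induction n) auto

lemma red_eq_0_iff: "red f = 0 \<longleftrightarrow> p dvd f"
proof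
  assume "p dvd f" then show "red f = 0" by (auto elim: dvdE)
next
  assume 0: "red f = 0"
  show "p dvd f"
  proof (rule ccontr)
    assume "\<not> p dvd f"
    then obtain u v where "u * p + v * f = 1" using field_poly_bezout[OF irr] by blast
    then have "red (u * p + v * f) = red 1" by simp
    then show False using 0 by simp
  qed
qed

lemma red_eq_iff: "red f = red g \<longleftrightarrow> p dvd f - g"
  using red_eq_0_iff[of "f - g"] by simp

lemma red_mod [simp]: "red (f mod p) = red f"
  unfolding red_eq_iff by (metis mod_eq_dvd_iff mod_mod_trivial)

lemma red_inj: "f \<in> resid p \<Longrightarrow> g \<in> resid p \<Longrightarrow> red f = red g \<Longrightarrow> f = g"
  unfolding red_eq_iff by (rule resid_eqI)

lemma red_inverse: "\<exists>g. red g = inverse (red f)"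
proof (cases "red f = 0")
  case True
  then show ?thesis by (intro exI[of _ 0]) simp
next
  case False
  then obtain u v where "u * p + v * f = 1" using field_poly_bezout[OF irr, of f] by (auto simp: red_eq_0_iff)
  then have "red (u * p + v * f) = red 1" by simp
  then have "red v * red f = 1" by simp
  then show ?thesis by (intro exI[of _ v]) (simp add: False field_simps)
qed

lemma one_resid [simp]: "1 \<in> resid p"
  using deg by (simp add: resid_def mod_poly_less)

lemma p_nonzero [simp]: "p \<noteq> 0" using irr by auto

end

section \<open>Automorphisms and extensions for the hook (m+1,1,1)\<close>

text \<open>
  The Young diagram of the partition \<open>(m + 1, 1, 1)\<close> is a hook.
\<close>

locale hook = residue_field p for p :: "'k::field poly" +
  fixes m :: nat
  assumes m: "m \<ge> 1"
begin

sublocale tor: torsion p "lam m"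
  by unfold_locales (auto simp: deg lam_def)

abbreviation S_units where "S_units \<equiv> resid_units (p ^ (m + 1))"

abbreviation cls where "cls \<equiv> ext_of_matrix p (lam m)"

lemma lam_simps [simp]: "lam m 1 = m + 1" "lam m 2 = 1" "lam m 3 = 1"
  by (simp_all add: lam_def)

lemma red_pm [simp]: "red (p ^ m) = 0" "red p ^ m = 0"
  using m by simp_all

lemma zero_power_m [simp]: "(0 :: 'k alg_closure) ^ m = 0"
  using m by simp

lemma block_nth [simp]:
  "block a b c D $ 1 $ 1 = a" "block a b c D $ 1 $ 2 = b $ 1" "block a b c D $ 1 $ 3 = b $ 2"
  "block a b c D $ 2 $ 1 = c $ 1" "block a b c D $ 2 $ 2 = D $ 1 $ 1" "block a b c D $ 2 $ 3 = D $ 1 $ 2"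
  "block a b c D $ 3 $ 1 = c $ 2" "block a b c D $ 3 $ 2 = D $ 2 $ 1" "block a b c D $ 3 $ 3 = D $ 2 $ 2"
  by (simp_all add: block_def vector_3)

lemma pm1_dvd_pm_mult: "p ^ (m + 1) dvd p ^ m * f \<longleftrightarrow> red f = 0"
  by (simp add: red_eq_0_iff mult.commute[of p])

lemma mat_cong_iff:
  "tor.mat_cong E E' \<longleftrightarrow> p ^ (m + 1) dvd E $ 1 $ 1 - E' $ 1 $ 1 \<and>
     red (E $ 1 $ 2) = red (E' $ 1 $ 2) \<and> red (E $ 1 $ 3) = red (E' $ 1 $ 3) \<and>
     red (E $ 2 $ 1) = red (E' $ 2 $ 1) \<and> red (E $ 2 $ 2) = red (E' $ 2 $ 2) \<and> red (E $ 2 $ 3) = red (E' $ 2 $ 3) \<and>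
     red (E $ 3 $ 1) = red (E' $ 3 $ 1) \<and> red (E $ 3 $ 2) = red (E' $ 3 $ 2) \<and> red (E $ 3 $ 3) = red (E' $ 3 $ 3)"
  unfolding tor.mat_cong_def forall_3 lam_simps red_eq_iff by simp

definition det2 :: "'k poly ^ 2 ^ 2 \<Rightarrow> 'k poly" where
  "det2 D = D $ 1 $ 1 * D $ 2 $ 2 - D $ 1 $ 2 * D $ 2 $ 1"

lemma det2_mult:
  fixes a :: "'a::comm_ring"
  shows "(a * d - b * c) * (a' * d' - b' * c') = (a * a' + b * c') * (c * b' + d * d') - (a * b' + b * d') * (c * a' + d * c')"
  by (simp add: algebra_simps)

text \<open>
  The condition \<open>A E \<equiv> E' A\<^sup>#\<close> for the automorphism with the blocks \<open>a, p\<^sup>m b, c, D\<close>, in the eight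
  places that count modulo \<open>p\<close>, where \<open>p\<^sup>m\<close> vanishes. The corner counts modulo \<open>p\<^bsup>m+1\<^esup>\<close> and is added in
  \<open>moves\<close>.
\<close>

definition moves_mod_p :: "'k poly \<Rightarrow> 'k poly ^ 2 \<Rightarrow> 'k poly ^ 2 \<Rightarrow> 'k poly ^ 2 ^ 2 \<Rightarrow> 'k poly ^ 3 ^ 3 \<Rightarrow> 'k poly ^ 3 ^ 3 \<Rightarrow> bool" where
  "moves_mod_p a b c D E E' \<longleftrightarrow>
     red a * red (E $ 1 $ 2) = red (E' $ 1 $ 1) * red (b $ 1) + red (E' $ 1 $ 2) * red (D $ 1 $ 1) + red (E' $ 1 $ 3) * red (D $ 2 $ 1) \<and>
     red a * red (E $ 1 $ 3) = red (E' $ 1 $ 1) * red (b $ 2) + red (E' $ 1 $ 2) * red (D $ 1 $ 2) + red (E' $ 1 $ 3) * red (D $ 2 $ 2) \<and>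
     red (c $ 1) * red (E $ 1 $ 1) + red (D $ 1 $ 1) * red (E $ 2 $ 1) + red (D $ 1 $ 2) * red (E $ 3 $ 1) = red (E' $ 2 $ 1) * red a \<and>
     red (c $ 2) * red (E $ 1 $ 1) + red (D $ 2 $ 1) * red (E $ 2 $ 1) + red (D $ 2 $ 2) * red (E $ 3 $ 1) = red (E' $ 3 $ 1) * red a \<and>
     red (c $ 1) * red (E $ 1 $ 2) + red (D $ 1 $ 1) * red (E $ 2 $ 2) + red (D $ 1 $ 2) * red (E $ 3 $ 2) =
       red (E' $ 2 $ 1) * red (b $ 1) + red (E' $ 2 $ 2) * red (D $ 1 $ 1) + red (E' $ 2 $ 3) * red (D $ 2 $ 1) \<and>
     red (c $ 1) * red (E $ 1 $ 3) + red (D $ 1 $ 1) * red (E $ 2 $ 3) + red (D $ 1 $ 2) * red (E $ 3 $ 3) =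
       red (E' $ 2 $ 1) * red (b $ 2) + red (E' $ 2 $ 2) * red (D $ 1 $ 2) + red (E' $ 2 $ 3) * red (D $ 2 $ 2) \<and>
     red (c $ 2) * red (E $ 1 $ 2) + red (D $ 2 $ 1) * red (E $ 2 $ 2) + red (D $ 2 $ 2) * red (E $ 3 $ 2) =
       red (E' $ 3 $ 1) * red (b $ 1) + red (E' $ 3 $ 2) * red (D $ 1 $ 1) + red (E' $ 3 $ 3) * red (D $ 2 $ 1) \<and>
     red (c $ 2) * red (E $ 1 $ 3) + red (D $ 2 $ 1) * red (E $ 2 $ 3) + red (D $ 2 $ 2) * red (E $ 3 $ 3) =
       red (E' $ 3 $ 1) * red (b $ 2) + red (E' $ 3 $ 2) * red (D $ 1 $ 2) + red (E' $ 3 $ 3) * red (D $ 2 $ 2)"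

definition moves :: "'k poly \<Rightarrow> 'k poly ^ 2 \<Rightarrow> 'k poly ^ 2 \<Rightarrow> 'k poly ^ 2 ^ 2 \<Rightarrow> 'k poly ^ 3 ^ 3 \<Rightarrow> 'k poly ^ 3 ^ 3 \<Rightarrow> bool" where
  "moves a b c D E E' \<longleftrightarrow>
     p ^ (m + 1) dvd a * (E $ 1 $ 1 - E' $ 1 $ 1) +
       p ^ m * (b $ 1 * E $ 2 $ 1 + b $ 2 * E $ 3 $ 1 - (E' $ 1 $ 2 * c $ 1 + E' $ 1 $ 3 * c $ 2)) \<and>
     moves_mod_p a b c D E E'"

lemma movesD:
  assumes "moves a b c D E E'"
  shows "p ^ (m + 1) dvd a * (E $ 1 $ 1 - E' $ 1 $ 1) +
       p ^ m * (b $ 1 * E $ 2 $ 1 + b $ 2 * E $ 3 $ 1 - (E' $ 1 $ 2 * c $ 1 + E' $ 1 $ 3 * c $ 2))"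
    "red a * red (E $ 1 $ 2) = red (E' $ 1 $ 1) * red (b $ 1) + red (E' $ 1 $ 2) * red (D $ 1 $ 1) + red (E' $ 1 $ 3) * red (D $ 2 $ 1)"
    "red a * red (E $ 1 $ 3) = red (E' $ 1 $ 1) * red (b $ 2) + red (E' $ 1 $ 2) * red (D $ 1 $ 2) + red (E' $ 1 $ 3) * red (D $ 2 $ 2)"
    "red (c $ 1) * red (E $ 1 $ 1) + red (D $ 1 $ 1) * red (E $ 2 $ 1) + red (D $ 1 $ 2) * red (E $ 3 $ 1) = red (E' $ 2 $ 1) * red a"
    "red (c $ 2) * red (E $ 1 $ 1) + red (D $ 2 $ 1) * red (E $ 2 $ 1) + red (D $ 2 $ 2) * red (E $ 3 $ 1) = red (E' $ 3 $ 1) * red a"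
    "red (c $ 1) * red (E $ 1 $ 2) + red (D $ 1 $ 1) * red (E $ 2 $ 2) + red (D $ 1 $ 2) * red (E $ 3 $ 2) =
       red (E' $ 2 $ 1) * red (b $ 1) + red (E' $ 2 $ 2) * red (D $ 1 $ 1) + red (E' $ 2 $ 3) * red (D $ 2 $ 1)"
    "red (c $ 1) * red (E $ 1 $ 3) + red (D $ 1 $ 1) * red (E $ 2 $ 3) + red (D $ 1 $ 2) * red (E $ 3 $ 3) =
       red (E' $ 2 $ 1) * red (b $ 2) + red (E' $ 2 $ 2) * red (D $ 1 $ 2) + red (E' $ 2 $ 3) * red (D $ 2 $ 2)"
    "red (c $ 2) * red (E $ 1 $ 2) + red (D $ 2 $ 1) * red (E $ 2 $ 2) + red (D $ 2 $ 2) * red (E $ 3 $ 2) =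
       red (E' $ 3 $ 1) * red (b $ 1) + red (E' $ 3 $ 2) * red (D $ 1 $ 1) + red (E' $ 3 $ 3) * red (D $ 2 $ 1)"
    "red (c $ 2) * red (E $ 1 $ 3) + red (D $ 2 $ 1) * red (E $ 2 $ 3) + red (D $ 2 $ 2) * red (E $ 3 $ 3) =
       red (E' $ 3 $ 1) * red (b $ 2) + red (E' $ 3 $ 2) * red (D $ 1 $ 2) + red (E' $ 3 $ 3) * red (D $ 2 $ 2)"
  using assms unfolding moves_def moves_mod_p_def by blast+

lemma mult_nth: "(A ** E) $ i $ j = A $ i $ 1 * E $ 1 $ j + A $ i $ 2 * E $ 2 $ j + A $ i $ 3 * E $ 3 $ j"
  for A E :: "'k poly ^ 3 ^ 3"
  by (simp add: matrix_matrix_mult_def sum_3)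

lemma moves_iff: "tor.mat_cong (block a (p ^ m *s b) c D ** E) (E' ** block a b (p ^ m *s c) D) \<longleftrightarrow> moves a b c D E E'"
proof -
  have "(block a (p ^ m *s b) c D ** E) $ 1 $ 1 - (E' ** block a b (p ^ m *s c) D) $ 1 $ 1 =
     a * (E $ 1 $ 1 - E' $ 1 $ 1) +
       p ^ m * (b $ 1 * E $ 2 $ 1 + b $ 2 * E $ 3 $ 1 - (E' $ 1 $ 2 * c $ 1 + E' $ 1 $ 3 * c $ 2))"
    by (simp add: mult_nth algebra_simps)
  note eq = this
  show ?thesis unfolding mat_cong_iff moves_def moves_mod_p_def eq
    by (simp add: mult_nth) blast
qed

lemma dvd_cong_iff:
  fixes q :: "'a::comm_ring_1"
  assumes "q dvd f - g"
  shows "q dvd f \<longleftrightarrow> q dvd g"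
  using dvd_add_right_iff[OF assms, of g] by simp

text \<open>
  Automorphisms may be given by polynomials that are not remainders.
\<close>

lemma moves_reduce:
  "moves (a mod p ^ (m + 1)) (\<chi> i. b $ i mod p) (\<chi> i. c $ i mod p) (\<chi> i j. D $ i $ j mod p) E E' \<longleftrightarrow> moves a b c D E E'"
proof -
  have a: "red (a mod p ^ (m + 1)) = red a"
    unfolding red_eq_iff using dvd_trans[of p "p ^ (m + 1)" "a mod p ^ (m + 1) - a"]
    by (metis mod_eq_dvd_iff mod_mod_trivial dvd_power zero_less_Suc Suc_eq_plus1)
  let ?X = "E $ 1 $ 1 - E' $ 1 $ 1"
  let ?Y = "\<lambda>b c. b $ 1 * E $ 2 $ 1 + b $ 2 * E $ 3 $ 1 - (E' $ 1 $ 2 * c $ 1 + E' $ 1 $ 3 * c $ 2)"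
  let ?b = "\<chi> i. b $ i mod p" and ?c = "\<chi> i. c $ i mod p"
  have "p ^ (m + 1) dvd (a mod p ^ (m + 1) - a) * ?X"
    by (rule dvd_mult2) (metis mod_eq_dvd_iff mod_mod_trivial)
  moreover have "p ^ (m + 1) dvd p ^ m * (?Y ?b ?c - ?Y b c)"
    unfolding pm1_dvd_pm_mult by simp
  ultimately have "p ^ (m + 1) dvd (a mod p ^ (m + 1) - a) * ?X + p ^ m * (?Y ?b ?c - ?Y b c)" by (rule dvd_add)
  also have "(a mod p ^ (m + 1) - a) * ?X + p ^ m * (?Y ?b ?c - ?Y b c) =
     ((a mod p ^ (m + 1)) * ?X + p ^ m * ?Y ?b ?c) - (a * ?X + p ^ m * ?Y b c)"
    by (simp add: algebra_simps)
  finally have "p ^ (m + 1) dvd (a mod p ^ (m + 1)) * ?X + p ^ m * ?Y ?b ?c \<longleftrightarrow> p ^ (m + 1) dvd a * ?X + p ^ m * ?Y b c"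
    by (rule dvd_cong_iff)
  then show ?thesis unfolding moves_def moves_mod_p_def a vec_lambda_beta red_mod by simp
qed

lemma admissible_block: "tor.admissible (block a (p ^ m *s b) c D)"
  by (simp add: tor.admissible_def forall_3 dvd_mult dvd_mult2)

lemma sharp_block: "tor.sharp_of (block a (p ^ m *s b) c D) (block a b (p ^ m *s c) D)"
  by (simp add: tor.sharp_of_def forall_3 mult.commute)

text \<open>
  Modulo \<open>p\<close> the matrix is block triangular with \<open>a\<close> and \<open>D\<close> on the diagonal. The right inverse has the
  adjugate of \<open>D\<close> divided by the determinant as its lower block; its corner is the inverse \<open>a0\<close> of \<open>a\<close>
  modulo \<open>p\<^bsup>m+1\<^esup>\<close>, corrected by a multiple of \<open>p\<^sup>m\<close> for the contribution \<open>t\<close> of the off-diagonal blocks.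
\<close>

lemma block_right_inverse:
  assumes a: "red a \<noteq> 0" and D: "red (det2 D) \<noteq> 0"
  obtains a' b' c' D' where "red a' \<noteq> 0" "red (det2 D') \<noteq> 0"
    "\<And>h j. p ^ lam m h dvd (block a (p ^ m *s b) c D ** block a' (p ^ m *s b') c' D') $ h $ j - (if h = j then 1 else 0)"
proof -
  obtain a0 where a0: "p ^ (m + 1) dvd a * a0 - 1" using unit_mod_power[OF irr] a red_eq_0_iff by blast
  obtain d where d: "red d = inverse (red (det2 D))" using red_inverse by blast
  have "p dvd a * a0 - 1" by (rule dvd_trans[OF _ a0]) simp
  then have a0': "red a * red a0 = 1" using red_eq_iff[of "a * a0" 1] by simp
  define D' :: "'k poly ^ 2 ^ 2" where "D' = vector [vector [d * D $ 2 $ 2, - (d * D $ 1 $ 2)], vector [- (d * D $ 2 $ 1), d * D $ 1 $ 1]]"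
  have D'n: "D' $ 1 $ 1 = d * D $ 2 $ 2" "D' $ 1 $ 2 = - (d * D $ 1 $ 2)" "D' $ 2 $ 1 = - (d * D $ 2 $ 1)" "D' $ 2 $ 2 = d * D $ 1 $ 1"
    by (simp_all add: D'_def vector_2)
  have dd: "red d * (red (D $ 1 $ 1) * red (D $ 2 $ 2) - red (D $ 1 $ 2) * red (D $ 2 $ 1)) = 1"
    using d D by (simp add: det2_def)
  define b' :: "'k poly ^ 2" where "b' = vector [- a0 * (b $ 1 * D' $ 1 $ 1 + b $ 2 * D' $ 2 $ 1), - a0 * (b $ 1 * D' $ 1 $ 2 + b $ 2 * D' $ 2 $ 2)]"
  define c' :: "'k poly ^ 2" where "c' = vector [- a0 * (D' $ 1 $ 1 * c $ 1 + D' $ 1 $ 2 * c $ 2), - a0 * (D' $ 2 $ 1 * c $ 1 + D' $ 2 $ 2 * c $ 2)]"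
  have b'n: "b' $ 1 = - a0 * (b $ 1 * D' $ 1 $ 1 + b $ 2 * D' $ 2 $ 1)" "b' $ 2 = - a0 * (b $ 1 * D' $ 1 $ 2 + b $ 2 * D' $ 2 $ 2)"
    and c'n: "c' $ 1 = - a0 * (D' $ 1 $ 1 * c $ 1 + D' $ 1 $ 2 * c $ 2)" "c' $ 2 = - a0 * (D' $ 2 $ 1 * c $ 1 + D' $ 2 $ 2 * c $ 2)"
    by (simp_all add: b'_def c'_def vector_2)
  define t where "t = b $ 1 * (D' $ 1 $ 1 * c $ 1 + D' $ 1 $ 2 * c $ 2) + b $ 2 * (D' $ 2 $ 1 * c $ 1 + D' $ 2 $ 2 * c $ 2)"
  define a' where "a' = a0 + p ^ m * (a0 * a0 * t)"
  let ?P = "block a (p ^ m *s b) c D ** block a' (p ^ m *s b') c' D'"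
  have "?P $ 1 $ 1 - 1 = a * a' + p ^ m * (b $ 1 * c' $ 1 + b $ 2 * c' $ 2) - 1"
    by (simp add: mult_nth algebra_simps)
  also have "b $ 1 * c' $ 1 + b $ 2 * c' $ 2 = - a0 * t" unfolding c'n t_def by (simp add: algebra_simps)
  also have "a * a' + p ^ m * (- a0 * t) - 1 = (a * a0 - 1) * (1 + p ^ m * (a0 * t))"
    unfolding a'_def by (simp add: algebra_simps)
  finally have 11: "p ^ (m + 1) dvd ?P $ 1 $ 1 - 1" using a0 by simp
  have 12: "p ^ (m + 1) dvd ?P $ 1 $ 2"
  proof -
    have "?P $ 1 $ 2 = p ^ m * (a * b' $ 1 + b $ 1 * D' $ 1 $ 1 + b $ 2 * D' $ 2 $ 1)"
      by (simp add: mult_nth algebra_simps)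
    also have "a * b' $ 1 + b $ 1 * D' $ 1 $ 1 + b $ 2 * D' $ 2 $ 1 = (1 - a * a0) * (b $ 1 * D' $ 1 $ 1 + b $ 2 * D' $ 2 $ 1)"
      unfolding b'n by (simp add: algebra_simps)
    finally show ?thesis using a0' by (simp only: pm1_dvd_pm_mult) simp
  qed
  have 13: "p ^ (m + 1) dvd ?P $ 1 $ 3"
  proof -
    have "?P $ 1 $ 3 = p ^ m * (a * b' $ 2 + b $ 1 * D' $ 1 $ 2 + b $ 2 * D' $ 2 $ 2)"
      by (simp add: mult_nth algebra_simps)
    also have "a * b' $ 2 + b $ 1 * D' $ 1 $ 2 + b $ 2 * D' $ 2 $ 2 = (1 - a * a0) * (b $ 1 * D' $ 1 $ 2 + b $ 2 * D' $ 2 $ 2)"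
      unfolding b'n by (simp add: algebra_simps)
    finally show ?thesis using a0' by (simp only: pm1_dvd_pm_mult) simp
  qed
  have "red (?P $ 2 $ 1) = red (c $ 1) * red a0 * (1 - red d * (red (D $ 1 $ 1) * red (D $ 2 $ 2) - red (D $ 1 $ 2) * red (D $ 2 $ 1)))"
    "red (?P $ 2 $ 2) = red d * (red (D $ 1 $ 1) * red (D $ 2 $ 2) - red (D $ 1 $ 2) * red (D $ 2 $ 1))"
    by (simp_all add: mult_nth a'_def c'n D'n algebra_simps)
  then have r2: "red (?P $ 2 $ 1) = 0" "red (?P $ 2 $ 2) = 1" "red (?P $ 2 $ 3) = 0"
    unfolding dd by (simp_all add: mult_nth D'n algebra_simps)
  have "red (?P $ 3 $ 1) = red (c $ 2) * red a0 * (1 - red d * (red (D $ 1 $ 1) * red (D $ 2 $ 2) - red (D $ 1 $ 2) * red (D $ 2 $ 1)))"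
    "red (?P $ 3 $ 3) = red d * (red (D $ 1 $ 1) * red (D $ 2 $ 2) - red (D $ 1 $ 2) * red (D $ 2 $ 1))"
    by (simp_all add: mult_nth a'_def c'n D'n algebra_simps)
  then have r3: "red (?P $ 3 $ 1) = 0" "red (?P $ 3 $ 2) = 0" "red (?P $ 3 $ 3) = 1"
    unfolding dd by (simp_all add: mult_nth D'n algebra_simps)
  have "\<forall>h j. p ^ lam m h dvd ?P $ h $ j - (if h = j then 1 else 0)"
    unfolding forall_3 using 11 12 13 r2 r3 red_eq_0_iff red_eq_iff[of _ 1] by simp
  moreover have "red a' \<noteq> 0" using a0' by (auto simp: a'_def)
  moreover have "red (det2 D') \<noteq> 0"
  proof -
    have "red (det2 D') = red d * (red d * (red (D $ 1 $ 1) * red (D $ 2 $ 2) - red (D $ 1 $ 2) * red (D $ 2 $ 1)))"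
      by (simp add: det2_def D'n algebra_simps)
    then show ?thesis unfolding dd using d D by simp
  qed
  ultimately show thesis using that by blast
qed

lemma GL2K_iff: "D \<in> GL2K p \<longleftrightarrow> D \<in> matK p \<and> red (det2 D) \<noteq> 0"
proof
  assume "D \<in> GL2K p"
  then obtain D' where D: "D \<in> matK p" and "mulK p D D' = mat 1" by (auto simp: GL2K_def)
  then have "(D ** D') $ i $ j mod p = (if i = j then 1 else 0)" for i j
    by (simp add: mulK_def vec_eq_iff mat_def)
  then have "red ((D ** D') $ i $ j) = (if i = j then 1 else 0)" for i j
    by (metis red_mod red_0 red_1)
  from this[of 1 1] this[of 1 2] this[of 2 1] this[of 2 2] have
    "red (D $ 1 $ 1) * red (D' $ 1 $ 1) + red (D $ 1 $ 2) * red (D' $ 2 $ 1) = 1"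
    "red (D $ 1 $ 1) * red (D' $ 1 $ 2) + red (D $ 1 $ 2) * red (D' $ 2 $ 2) = 0"
    "red (D $ 2 $ 1) * red (D' $ 1 $ 1) + red (D $ 2 $ 2) * red (D' $ 2 $ 1) = 0"
    "red (D $ 2 $ 1) * red (D' $ 1 $ 2) + red (D $ 2 $ 2) * red (D' $ 2 $ 2) = 1"
    by (simp_all add: matrix_matrix_mult_def sum_2)
  then have "red (det2 D) * red (det2 D') = 1" by (simp add: det2_def det2_mult)
  then show "D \<in> matK p \<and> red (det2 D) \<noteq> 0" using D by auto
next
  assume D: "D \<in> matK p \<and> red (det2 D) \<noteq> 0"
  obtain d where d: "red d = inverse (red (det2 D))" using red_inverse by blast
  define D' :: "'k poly ^ 2 ^ 2" where "D' = vector [vector [(d * D $ 2 $ 2) mod p, (- (d * D $ 1 $ 2)) mod p], vector [(- (d * D $ 2 $ 1)) mod p, (d * D $ 1 $ 1) mod p]]"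
  have D'n: "red (D' $ 1 $ 1) = red d * red (D $ 2 $ 2)" "red (D' $ 1 $ 2) = - (red d * red (D $ 1 $ 2))"
    "red (D' $ 2 $ 1) = - (red d * red (D $ 2 $ 1))" "red (D' $ 2 $ 2) = red d * red (D $ 1 $ 1)"
    by (simp_all add: D'_def vector_2)
  have dd: "red d * (red (D $ 1 $ 1) * red (D $ 2 $ 2) - red (D $ 1 $ 2) * red (D $ 2 $ 1)) = 1"
    using d D by (simp add: det2_def)
  have c: "D' \<in> matK p" by (simp add: D'_def matK_def forall_2 vector_2 resid_uminus)
  have eq: "f mod p = g" if "red f = red g" "g \<in> resid p" for f g
    using that red_inj[of "f mod p" g] by simp
  have "mulK p D D' = mat 1" "mulK p D' D = mat 1"
    unfolding mulK_def vec_eq_iff forall_2 vec_lambda_beta mat_def matrix_matrix_mult_def sum_2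
    by (intro conjI eq; use dd in \<open>simp add: D'n algebra_simps\<close>)+
  then show "D \<in> GL2K p" using D c by (auto simp: GL2K_def)
qed

definition aut_matrices :: "('k poly ^ 3 ^ 3) set" where
  "aut_matrices = {block a (p ^ m *s b) c D | a b c D.
     a \<in> S_units \<and> b \<in> vecK p \<and> c \<in> vecK p \<and> D \<in> GL2K p}"

lemma unit_iff: "a \<in> S_units \<longleftrightarrow> a \<in> resid (p ^ (m + 1)) \<and> red a \<noteq> 0"
  using resid_units_iff[OF irr, of "m + 1" a] red_eq_0_iff by simp

lemma resid_pm_mult: "p ^ m * b \<in> resid (p ^ (m + 1)) \<longleftrightarrow> b \<in> resid p"
proof -
  have "p ^ (m + 1) = p ^ m * p" by simp
  then have "(p ^ m * b) mod p ^ (m + 1) = p ^ m * (b mod p)" by (simp only: mult_mod_right)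
  then show ?thesis unfolding resid_def by simp
qed

lemma aut_matrices_realised:
  assumes "a \<in> S_units" "b \<in> vecK p" "c \<in> vecK p" "D \<in> GL2K p"
  shows "\<exists>g\<in>carrier (G_lam p m). aut_matrix g (gen p (lam m)) = block a (p ^ m *s b) c D"
proof -
  have a: "red a \<noteq> 0" "red (det2 D) \<noteq> 0" using assms unfolding unit_iff GL2K_iff by auto
  obtain a' b' c' D' where 1: "red a' \<noteq> 0" "red (det2 D') \<noteq> 0"
    "\<And>h j. p ^ lam m h dvd (block a (p ^ m *s b) c D ** block a' (p ^ m *s b') c' D') $ h $ j - (if h = j then 1 else 0)"
    using block_right_inverse[OF a] by metis
  obtain a'' b'' c'' D'' where 2:
    "\<And>h j. p ^ lam m h dvd (block a' (p ^ m *s b') c' D' ** block a'' (p ^ m *s b'') c'' D'') $ h $ j - (if h = j then 1 else 0)"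
    using block_right_inverse[OF 1(1,2)] by metis
  have "\<forall>h j. block a (p ^ m *s b) c D $ h $ j \<in> resid (p ^ lam m h)"
    unfolding forall_3 using assms resid_pm_mult unfolding unit_iff vecK_def GL2K_iff matK_def by auto
  then show ?thesis by (intro tor.automorphism_of_matrix[OF admissible_block admissible_block 1(3) 2]) blast
qed

text \<open>
  The two generators killed by \<open>p\<close> are mapped to elements killed by \<open>p\<close>, so that \<open>p\<^sup>m\<close> divides the rest of the
  first row. Modulo \<open>p\<close>, the product with the matrix of the inverse shows that \<open>a\<close> and \<open>D\<close> are invertible.
\<close>

lemma aut_matrix_block_form:
  assumes g: "g \<in> carrier (G_lam p m)"
  shows "aut_matrix g (gen p (lam m)) \<in> aut_matrices"
proof -
  let ?e = "gen p (lam m)"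
  obtain k where k: "k \<in> carrier (G_lam p m)"
    "\<And>i j. p ^ lam m i dvd (aut_matrix g ?e ** aut_matrix k ?e) $ i $ j - (if i = j then 1 else 0)"
    using tor.inverse_matrix[OF g] by blast
  have shape: "p ^ m dvd aut_matrix h ?e $ 1 $ j" if "h \<in> carrier (G_lam p m)" "j \<noteq> 1" for h j
  proof -
    have "p ^ (m + 1) dvd aut_matrix h ?e $ 1 $ j * p"
      using tor.hom_gen_dvd[OF Aut_hom[OF that(1)], of 1 j] that(2) by (simp add: lam_def)
    then show ?thesis by (simp add: mult.commute[of p])
  qed
  define A where "A = aut_matrix g ?e"
  define K where "K = aut_matrix k ?e"
  have res: "A $ i $ j \<in> resid (p ^ lam m i)" for i j
    unfolding A_def by (rule tor.aut_matrix_resid[OF g])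
  have pA: "p ^ m dvd A $ 1 $ 2" "p ^ m dvd A $ 1 $ 3" and pK: "p ^ m dvd K $ 1 $ 2" "p ^ m dvd K $ 1 $ 3"
    using shape[OF g] shape[OF k(1)] by (simp_all add: A_def K_def)
  have z: "red f = 0" if "p ^ m dvd f" for f using that m by (auto elim: dvdE)
  have AK: "red ((A ** K) $ i $ j) = (if i = j then 1 else 0)" for i j
  proof -
    have "p dvd p ^ lam m i" by (simp add: lam_def)
    then have "p dvd (A ** K) $ i $ j - (if i = j then 1 else 0)"
      using k(2) unfolding A_def K_def by (rule dvd_trans)
    then show ?thesis using red_eq_iff[of "(A ** K) $ i $ j" "if i = j then 1 else 0"] by simp
  qed
  have a: "red (A $ 1 $ 1) \<noteq> 0" using AK[of 1 1] pA by (auto simp: mult_nth z)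
  define D :: "'k poly ^ 2 ^ 2" where "D = vector [vector [A $ 2 $ 2, A $ 2 $ 3], vector [A $ 3 $ 2, A $ 3 $ 3]]"
  have "red (A $ 2 $ 2) * red (K $ 2 $ 2) + red (A $ 2 $ 3) * red (K $ 3 $ 2) = 1"
    "red (A $ 2 $ 2) * red (K $ 2 $ 3) + red (A $ 2 $ 3) * red (K $ 3 $ 3) = 0"
    "red (A $ 3 $ 2) * red (K $ 2 $ 2) + red (A $ 3 $ 3) * red (K $ 3 $ 2) = 0"
    "red (A $ 3 $ 2) * red (K $ 2 $ 3) + red (A $ 3 $ 3) * red (K $ 3 $ 3) = 1"
    using AK[of 2 2] AK[of 2 3] AK[of 3 2] AK[of 3 3] pK by (simp_all add: mult_nth z)
  then have "red (det2 D) * (red (K $ 2 $ 2) * red (K $ 3 $ 3) - red (K $ 2 $ 3) * red (K $ 3 $ 2)) = 1"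
    by (simp add: det2_def D_def vector_2 det2_mult)
  then have "red (det2 D) \<noteq> 0" by auto
  moreover have "D \<in> matK p" using res[of 2] res[of 3] by (simp add: matK_def D_def forall_2 vector_2)
  ultimately have D: "D \<in> GL2K p" by (simp add: GL2K_iff)
  define b :: "'k poly ^ 2" where "b = vector [A $ 1 $ 2 div p ^ m, A $ 1 $ 3 div p ^ m]"
  have b: "b \<in> vecK p"
  proof -
    have "f div p ^ m \<in> resid p" if "p ^ m dvd f" "f \<in> resid (p ^ (m + 1))" for f
    proof -
      obtain r where r: "f = p ^ m * r" using \<open>p ^ m dvd f\<close> by (auto elim: dvdE)
      show ?thesis using that(2) unfolding r resid_pm_mult by simp
    qed
    then show ?thesis using pA res[of 1] by (simp add: vecK_def b_def forall_2 vector_2)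
  qed
  define c :: "'k poly ^ 2" where "c = vector [A $ 2 $ 1, A $ 3 $ 1]"
  have c: "c \<in> vecK p" using res[of 2] res[of 3] by (simp add: vecK_def c_def forall_2 vector_2)
  have "A = block (A $ 1 $ 1) (p ^ m *s b) c D"
    unfolding vec_eq_iff forall_3 using pA by (simp add: b_def c_def D_def vector_2)
  moreover have "A $ 1 $ 1 \<in> S_units" using res[of 1] a unfolding unit_iff by simp
  ultimately show ?thesis using b c D unfolding aut_matrices_def A_def by blast
qed

lemma act_block_iff:
  assumes g: "g \<in> carrier (G_lam p m)" "aut_matrix g (gen p (lam m)) = block a (p ^ m *s b) c D"
  shows "act_lam p m g (cls E) = cls E' \<longleftrightarrow> moves a b c D E E'"
  using tor.act_matrix_iff[OF g(1), of "block a b (p ^ m *s c) D" E E'] g(2) sharp_block moves_iff by simp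

definition isotropy_matrices where
  "isotropy_matrices E = {block a (p ^ m *s b) c D | a b c D.
     a \<in> S_units \<and> b \<in> vecK p \<and> c \<in> vecK p \<and> D \<in> GL2K p \<and> moves a b c D E E}"

lemma stabilizer_bij:
  "bij_betw (\<lambda>g. aut_matrix g (gen p (lam m)))
     (stabilizer (G_lam p m) (act_lam p m) (cls E))
     (isotropy_matrices E)"
  unfolding bij_betw_def
proof
  show "inj_on (\<lambda>g. aut_matrix g (gen p (lam m))) (stabilizer (G_lam p m) (act_lam p m) (cls E))"
    by (rule inj_on_subset[OF tor.aut_matrix_inj]) (auto simp: stabilizer_def)
  show "(\<lambda>g. aut_matrix g (gen p (lam m))) ` stabilizer (G_lam p m) (act_lam p m) (cls E) = isotropy_matrices E" (is "?L = ?R")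
  proof (intro equalityI subsetI)
    fix A assume "A \<in> ?L"
    then obtain g where g: "g \<in> carrier (G_lam p m)" "act_lam p m g (cls E) = cls E"
      "A = aut_matrix g (gen p (lam m))" by (auto simp: stabilizer_def)
    then obtain a b c D where A: "A = block a (p ^ m *s b) c D" and
      mem: "a \<in> S_units \<and> b \<in> vecK p \<and> c \<in> vecK p \<and> D \<in> GL2K p"
      using aut_matrix_block_form[OF g(1)] by (auto simp: aut_matrices_def)
    then have "moves a b c D E E" using act_block_iff[of g a b c D E E] g by simp
    then show "A \<in> ?R" using A mem unfolding isotropy_matrices_def by blast
  next
    fix A assume "A \<in> ?R"
    then obtain a b c D where A: "A = block a (p ^ m *s b) c D" and
      mem: "a \<in> S_units" "b \<in> vecK p" "c \<in> vecK p" "D \<in> GL2K p" and mv: "moves a b c D E E"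
      unfolding isotropy_matrices_def by blast
    obtain g where g: "g \<in> carrier (G_lam p m)" "aut_matrix g (gen p (lam m)) = block a (p ^ m *s b) c D"
      using aut_matrices_realised[OF mem] by blast
    then have "g \<in> stabilizer (G_lam p m) (act_lam p m) (cls E)"
      using act_block_iff[OF g] mv by (simp add: stabilizer_def)
    then show "A \<in> ?L" using A g by (metis imageI)
  qed
qed

definition same_orbit where
  "same_orbit E E' \<longleftrightarrow> (\<exists>g\<in>carrier (G_lam p m). act_lam p m g (cls E) = cls E')"

lemma same_orbitI:
  assumes "red a \<noteq> 0" "red (det2 D) \<noteq> 0" "moves a b c D E E'"
  shows "same_orbit E E'"
proof -
  let ?a = "a mod p ^ (m + 1)" and ?b = "\<chi> i. b $ i mod p" and ?c = "\<chi> i. c $ i mod p" and ?D = "\<chi> i j. D $ i $ j mod p"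
  have "red ?a = red a" unfolding red_eq_iff
    by (rule dvd_trans[of _ "p ^ (m + 1)"]) (simp, metis mod_eq_dvd_iff mod_mod_trivial)
  then have "?a \<in> S_units" using assms(1) unfolding unit_iff by simp
  moreover have "?b \<in> vecK p" "?c \<in> vecK p" by (simp_all add: vecK_def)
  moreover have "?D \<in> GL2K p" using assms(2) by (simp add: GL2K_iff matK_def det2_def)
  ultimately obtain g where g: "g \<in> carrier (G_lam p m)" "aut_matrix g (gen p (lam m)) = block ?a (p ^ m *s ?b) ?c ?D"
    using aut_matrices_realised by blast
  show ?thesis unfolding same_orbit_def using g(1) act_block_iff[OF g] moves_reduce[of a b c D E E'] assms(3) by blast
qed

lemma same_orbitE:
  assumes "same_orbit E E'"
  obtains a b c D where "red a \<noteq> 0" "red (det2 D) \<noteq> 0" "moves a b c D E E'"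
proof -
  obtain g where g: "g \<in> carrier (G_lam p m)" "act_lam p m g (cls E) = cls E'"
    using assms by (auto simp: same_orbit_def)
  obtain a b c D where A: "aut_matrix g (gen p (lam m)) = block a (p ^ m *s b) c D" and
      mem: "a \<in> S_units \<and> b \<in> vecK p \<and> c \<in> vecK p \<and> D \<in> GL2K p"
    using aut_matrix_block_form[OF g(1)] by (auto simp: aut_matrices_def)
  show thesis
    using that[of a D b c] mem act_block_iff[OF g(1) A] g(2) unfolding unit_iff GL2K_iff by blast
qed

lemma same_orbit_trans:
  assumes "same_orbit E E'" "same_orbit E' E''"
  shows "same_orbit E E''"
proof -
  obtain g h where g: "g \<in> carrier (G_lam p m)" "act_lam p m g (cls E) = cls E'"
    and h: "h \<in> carrier (G_lam p m)" "act_lam p m h (cls E') = cls E''"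
    using assms by (auto simp: same_orbit_def)
  have "act_lam p m (compose (carrier (M_lam p m)) h g) (cls E) = cls E''"
    using ext_act_compose[OF module_tmod h(1) g(1) tor.ext_of_matrix_in_Ext1[of E]] unfolding g(2) h(2) by (rule sym)
  then show ?thesis using Aut_compose_closed[OF module_tmod h(1) g(1)] unfolding same_orbit_def by blast
qed

section \<open>Isotropy groups of the representatives\<close>

lemma mat3_nth [simp]:
  "mat3 [[a, b, c], r2, r3] $ 1 $ 1 = a" "mat3 [[a, b, c], r2, r3] $ 1 $ 2 = b" "mat3 [[a, b, c], r2, r3] $ 1 $ 3 = c"
  "mat3 [r1, [a, b, c], r3] $ 2 $ 1 = a" "mat3 [r1, [a, b, c], r3] $ 2 $ 2 = b" "mat3 [r1, [a, b, c], r3] $ 2 $ 3 = c"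
  "mat3 [r1, r2, [a, b, c]] $ 3 $ 1 = a" "mat3 [r1, r2, [a, b, c]] $ 3 $ 2 = b" "mat3 [r1, r2, [a, b, c]] $ 3 $ 3 = c"
  by (simp_all add: vector_3)

lemma moves_self_iff:
  "moves a b c D E E \<longleftrightarrow>
     red (b $ 1) * red (E $ 2 $ 1) + red (b $ 2) * red (E $ 3 $ 1) = red (E $ 1 $ 2) * red (c $ 1) + red (E $ 1 $ 3) * red (c $ 2) \<and>
     moves_mod_p a b c D E E"
proof -
  have "p ^ (m + 1) dvd a * (E $ 1 $ 1 - E $ 1 $ 1) + p ^ m * f \<longleftrightarrow> red f = 0" for f
    using pm1_dvd_pm_mult by simp
  then show ?thesis unfolding moves_def by simp
qed

lemmas moves_selfD = moves_self_iff[THEN iffD1, THEN conjunct1] movesD(2-9)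

text \<open>
  The same set with all entries spelled out, in the form of the rows of the table.
\<close>

lemma isotropy_matrices_flat:
  "isotropy_matrices E = {mat3 [[a, p ^ m * b1, p ^ m * b2], [c1, d11, d12], [c2, d21, d22]] | a b1 b2 c1 c2 d11 d12 d21 d22.
     a \<in> S_units \<and> b1 \<in> resid p \<and> b2 \<in> resid p \<and> c1 \<in> resid p \<and> c2 \<in> resid p \<and>
     d11 \<in> resid p \<and> d12 \<in> resid p \<and> d21 \<in> resid p \<and> d22 \<in> resid p \<and>
     red d11 * red d22 \<noteq> red d12 * red d21 \<and>
     moves a (vector [b1, b2]) (vector [c1, c2]) (vector [vector [d11, d12], vector [d21, d22]]) E E}" (is "_ = ?R")
proof (intro equalityI subsetI)
  fix A assume "A \<in> isotropy_matrices E"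
  then obtain a b c D where A: "A = block a (p ^ m *s b) c D" and
    h: "a \<in> S_units" "b \<in> vecK p" "c \<in> vecK p" "D \<in> matK p" "red (det2 D) \<noteq> 0" "moves a b c D E E"
    unfolding isotropy_matrices_def GL2K_iff by blast
  have v: "vector [b $ 1, b $ 2] = b" "vector [c $ 1, c $ 2] = c"
    "vector [vector [D $ 1 $ 1, D $ 1 $ 2], vector [D $ 2 $ 1, D $ 2 $ 2]] = D"
    by (simp_all add: vec_eq_iff forall_2 vector_2)
  have "A = mat3 [[a, p ^ m * b $ 1, p ^ m * b $ 2], [c $ 1, D $ 1 $ 1, D $ 1 $ 2], [c $ 2, D $ 2 $ 1, D $ 2 $ 2]]"
    by (simp add: A block_def)
  moreover have "moves a (vector [b $ 1, b $ 2]) (vector [c $ 1, c $ 2])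
     (vector [vector [D $ 1 $ 1, D $ 1 $ 2], vector [D $ 2 $ 1, D $ 2 $ 2]]) E E" unfolding v by (rule h)
  moreover have "red (D $ 1 $ 1) * red (D $ 2 $ 2) \<noteq> red (D $ 1 $ 2) * red (D $ 2 $ 1)" using h(5) by (simp add: det2_def)
  ultimately show "A \<in> ?R" using h unfolding vecK_def matK_def by blast
next
  fix A assume "A \<in> ?R"
  then obtain a b1 b2 c1 c2 d11 d12 d21 d22 where A: "A = mat3 [[a, p ^ m * b1, p ^ m * b2], [c1, d11, d12], [c2, d21, d22]]"
    and h: "a \<in> S_units" "b1 \<in> resid p" "b2 \<in> resid p" "c1 \<in> resid p" "c2 \<in> resid p"
     "d11 \<in> resid p" "d12 \<in> resid p" "d21 \<in> resid p" "d22 \<in> resid p"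
     "red d11 * red d22 \<noteq> red d12 * red d21"
     "moves a (vector [b1, b2]) (vector [c1, c2]) (vector [vector [d11, d12], vector [d21, d22]]) E E" by blast
  define b :: "'k poly ^ 2" where "b = vector [b1, b2]"
  define c :: "'k poly ^ 2" where "c = vector [c1, c2]"
  define D :: "'k poly ^ 2 ^ 2" where "D = vector [vector [d11, d12], vector [d21, d22]]"
  have "A = block a (p ^ m *s b) c D" by (simp add: A block_def b_def c_def D_def vector_2)
  moreover have "b \<in> vecK p" "c \<in> vecK p" "D \<in> GL2K p"
    using h by (simp_all add: vecK_def matK_def GL2K_iff det2_def forall_2 b_def c_def D_def vector_2)
  moreover have "moves a b c D E E" using h(11) by (simp only: b_def c_def D_def)
  ultimately show "A \<in> isotropy_matrices E" using h(1) unfolding isotropy_matrices_def by blast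
qed

lemma isotropy_matricesI:
  assumes "A = mat3 [[a, p ^ m * b1, p ^ m * b2], [c1, d11, d12], [c2, d21, d22]]"
    "a \<in> S_units \<and> b1 \<in> resid p \<and> b2 \<in> resid p \<and> c1 \<in> resid p \<and> c2 \<in> resid p \<and>
     d11 \<in> resid p \<and> d12 \<in> resid p \<and> d21 \<in> resid p \<and> d22 \<in> resid p"
     "red d11 * red d22 \<noteq> red d12 * red d21"
     "moves a (vector [b1, b2]) (vector [c1, c2]) (vector [vector [d11, d12], vector [d21, d22]]) E E"
  shows "A \<in> isotropy_matrices E"
  unfolding isotropy_matrices_flat using assms by blast

lemma isotropy_matricesE:
  assumes "A \<in> isotropy_matrices E"
  obtains a b1 b2 c1 c2 d11 d12 d21 d22 where
    "A = mat3 [[a, p ^ m * b1, p ^ m * b2], [c1, d11, d12], [c2, d21, d22]]"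
    "a \<in> S_units" "b1 \<in> resid p" "b2 \<in> resid p" "c1 \<in> resid p" "c2 \<in> resid p"
    "d11 \<in> resid p" "d12 \<in> resid p" "d21 \<in> resid p" "d22 \<in> resid p"
    "red d11 * red d22 \<noteq> red d12 * red d21"
    "moves a (vector [b1, b2]) (vector [c1, c2]) (vector [vector [d11, d12], vector [d21, d22]]) E E"
  using assms unfolding isotropy_matrices_flat by blast

lemma resid_eq_mod: "f \<in> resid p \<Longrightarrow> red f = red g \<Longrightarrow> f = g mod p"
  by (rule red_inj) simp_all

lemma resid_eq_0: "f \<in> resid p \<Longrightarrow> red f = 0 \<Longrightarrow> f = 0"
  by (rule red_inj) simp_all

lemma unit1_iff: "d \<in> resid_units p \<longleftrightarrow> d \<in> resid p \<and> red d \<noteq> 0"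
  using resid_units_iff[OF irr, of 1 d] by (simp add: red_eq_0_iff)

lemmas moves_mat3 = mat3_nth vector_2 red_0 red_1 mult_zero_left mult_zero_right add_0_left add_0_right mult_1_left mult_1_right

lemma isotropy_diag_nonunit:
  assumes x: "p dvd x"
  shows "isotropy_matrices (block x 0 0 W) = {block a (p ^ m *s b) c D | a b c D.
         a \<in> S_units \<and> b \<in> vecK p \<and> c \<in> vecK p \<and> D \<in> centralizerK p W}"
proof -
  have x0: "red x = 0" using x red_eq_0_iff by blast
  have *: "D \<in> GL2K p \<and> moves a b c D (block x 0 0 W) (block x 0 0 W) \<longleftrightarrow> D \<in> centralizerK p W" for a b c D
  proof -
    have "mulK p D W = mulK p W D \<longleftrightarrow> (\<forall>i j. red ((D ** W) $ i $ j) = red ((W ** D) $ i $ j))"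
      unfolding mulK_def vec_eq_iff vec_lambda_beta red_eq_iff mod_eq_dvd_iff ..
    then show ?thesis
      by (auto simp: centralizerK_def moves_self_iff moves_mod_p_def x0 forall_2 matrix_matrix_mult_def sum_2)
  qed
  show ?thesis unfolding isotropy_matrices_def * ..
qed

lemma coprime_iff: "coprime f p \<longleftrightarrow> red f \<noteq> 0"
proof
  assume "coprime f p"
  then have "\<not> p dvd f" using irr irreducible_not_unit by (metis coprime_common_divisor dvd_refl)
  then show "red f \<noteq> 0" using red_eq_0_iff by blast
next
  assume "red f \<noteq> 0"
  then obtain u v where uv: "u * p + v * f = 1" using field_poly_bezout[OF irr] red_eq_0_iff by blast
  show "coprime f p"
  proof (rule coprimeI)
    fix c assume "c dvd f" "c dvd p"
    then have "c dvd u * p + v * f" by simp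
    then show "is_unit c" unfolding uv .
  qed
qed

lemma isotropy_diag_unit:
  assumes x: "coprime x p"
  shows "isotropy_matrices (block x 0 0 W) = {block a 0 0 D | a D.
         a \<in> S_units \<and> D \<in> centralizerK p W}"
proof -
  have x0: "red x \<noteq> 0" using x coprime_iff by blast
  have *: "b \<in> vecK p \<and> c \<in> vecK p \<and> D \<in> GL2K p \<and> moves a b c D (block x 0 0 W) (block x 0 0 W) \<longleftrightarrow>
      b = 0 \<and> c = 0 \<and> D \<in> centralizerK p W" for a b c D
  proof -
    have "mulK p D W = mulK p W D \<longleftrightarrow> (\<forall>i j. red ((D ** W) $ i $ j) = red ((W ** D) $ i $ j))"
      unfolding mulK_def vec_eq_iff vec_lambda_beta red_eq_iff mod_eq_dvd_iff ..
    moreover have "v = 0 \<longleftrightarrow> red (v $ 1) = 0 \<and> red (v $ 2) = 0" if "v \<in> vecK p" for v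
      using that resid_eq_0 by (auto simp: vecK_def vec_eq_iff forall_2)
    moreover have "0 \<in> vecK p" by (simp add: vecK_def)
    ultimately show ?thesis
      by (auto simp: centralizerK_def moves_self_iff moves_mod_p_def x0 forall_2 matrix_matrix_mult_def sum_2)
  qed
  have "p ^ m *s (0 :: 'k poly ^ 2) = 0" by (simp add: vec_eq_iff)
  then show ?thesis unfolding isotropy_matrices_def * by auto
qed

text \<open>
  In the six cases with \<open>p\<close> dividing \<open>x\<close> and \<open>y\<close> or \<open>z\<close> nonzero, each of the nine equations of \<open>moves_selfD\<close>
  either follows from the others or determines one entry of the automorphism in terms of the free ones.
  The numbers refer to the order of the equations there: first the corner, then the rest of the
  first row, the rest of the first column, and the four entries of the lower block.
\<close>

lemma isotropy_both_nonorthogonal: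
  assumes x: "red x = 0" and r: "r \<in> resid p" "r \<noteq> 0"
  shows "isotropy_matrices (mat3 [[x, 1, 0], [r, u, 0], [0, 0, v]]) =
      {mat3 [[a, p ^ m * b, 0], [(b * r) mod p, a mod p, 0], [0, 0, d]] | a b d.
         a \<in> S_units \<and> b \<in> resid p \<and> d \<in> resid_units p}" (is "?L = ?R")
proof (intro equalityI subsetI)
  have r0: "red r \<noteq> 0" using resid_eq_0 r by blast
  fix A assume "A \<in> ?L"
  then show "A \<in> ?R"
  proof (cases rule: isotropy_matricesE)
    case (1 a b1 b2 c1 c2 d11 d12 d21 d22)
    note A = 1(1) and res = 1(2-10)
    note eq = moves_selfD[OF 1(12), unfolded moves_mat3 x]
    have n1: "red d11 = red a" using eq(2) by simp
    have n2: "red d12 = 0" using eq(3) by simp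
    have n3: "red d21 = 0" using eq(5) r0 by simp
    have n4: "red b2 = 0" using eq(7) n2 r0 by simp
    have n5: "red c1 = red (b1 * r)" using eq(1) by simp
    have n6: "red c2 = 0" using eq(8) n3 by simp
    note s = resid_eq_mod[OF res(6) n1] resid_eq_0[OF res(7) n2] resid_eq_0[OF res(8) n3]
      resid_eq_0[OF res(3) n4] resid_eq_mod[OF res(4) n5] resid_eq_0[OF res(5) n6]
    have un: "d22 \<in> resid_units p" unfolding unit1_iff using n1 n2 n3 1(11) res by auto
    have "A = mat3 [[a, p ^ m * b1, 0], [(b1 * r) mod p, a mod p, 0], [0, 0, d22]]"
      using A s by simp
    then show "A \<in> ?R" using res un by blast
  qed
next
  fix A assume "A \<in> ?R"
  then obtain a b d where h: "a \<in> S_units \<and> b \<in> resid p \<and> d \<in> resid_units p"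
    and A: "A = mat3 [[a, p ^ m * b, 0], [(b * r) mod p, a mod p, 0], [0, 0, d]]" by blast
  show "A \<in> ?L"
    by (rule isotropy_matricesI[of A a b 0 "(b * r) mod p" "a mod p" 0 0 0 d])
      (use A h in \<open>simp_all add: moves_self_iff moves_mod_p_def vector_2 x unit_iff[simplified] unit1_iff algebra_simps\<close>)
qed

lemma isotropy_both_orthogonal:
  assumes x: "red x = 0"
  shows "isotropy_matrices (mat3 [[x, 1, 0], [0, 0, u], [1, 0, v]]) =
      {mat3 [[a, p ^ m * b, p ^ m * ((u * d) mod p)], [(u * d) mod p, a mod p, 0], [(b + v * d) mod p, d, a mod p]] | a b d.
         a \<in> S_units \<and> b \<in> resid p \<and> d \<in> resid p}" (is "?L = ?R")
proof (intro equalityI subsetI)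
  fix A assume "A \<in> ?L"
  then show "A \<in> ?R"
  proof (cases rule: isotropy_matricesE)
    case (1 a b1 b2 c1 c2 d11 d12 d21 d22)
    note A = 1(1) and res = 1(2-10)
    note eq = moves_selfD[OF 1(12), unfolded moves_mat3 x]
    have n1: "red d11 = red a" using eq(2) by simp
    have n2: "red d12 = 0" using eq(3) by simp
    have n3: "red d22 = red a" using eq(5) by simp
    have n4: "red c1 = red (u * d21)" using eq(6) by simp
    have n5: "red b2 = red (u * d21)" using eq(1) n4 by simp
    have n6: "red c2 = red (b1 + v * d21)" using eq(8) by simp
    note s = resid_eq_mod[OF res(6) n1] resid_eq_0[OF res(7) n2] resid_eq_mod[OF res(9) n3]
      resid_eq_mod[OF res(4) n4] resid_eq_mod[OF res(3) n5] resid_eq_mod[OF res(5) n6]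
    have "A = mat3 [[a, p ^ m * b1, p ^ m * ((u * d21) mod p)], [(u * d21) mod p, a mod p, 0], [(b1 + v * d21) mod p, d21, a mod p]]"
      using A s by simp
    then show "A \<in> ?R" using res by blast
  qed
next
  fix A assume "A \<in> ?R"
  then obtain a b d where h: "a \<in> S_units \<and> b \<in> resid p \<and> d \<in> resid p"
    and A: "A = mat3 [[a, p ^ m * b, p ^ m * ((u * d) mod p)], [(u * d) mod p, a mod p, 0], [(b + v * d) mod p, d, a mod p]]" by blast
  show "A \<in> ?L"
    by (rule isotropy_matricesI[of A a b "(u * d) mod p" "(u * d) mod p" "a mod p" 0 "(b + v * d) mod p" d "a mod p"])
      (use A h in \<open>simp_all add: moves_self_iff moves_mod_p_def vector_2 x unit_iff[simplified] unit1_iff algebra_simps\<close>)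
qed

lemma isotropy_row_nondiag:
  assumes x: "red x = 0"
  shows "isotropy_matrices (mat3 [[x, 1, 0], [0, 0, 1], [0, 0, w]]) =
      {mat3 [[a, p ^ m * b1, p ^ m * b2], [0, a mod p, 0], [0, 0, a mod p]] | a b1 b2.
         a \<in> S_units \<and> b1 \<in> resid p \<and> b2 \<in> resid p}" (is "?L = ?R")
proof (intro equalityI subsetI)
  fix A assume "A \<in> ?L"
  then show "A \<in> ?R"
  proof (cases rule: isotropy_matricesE)
    case (1 a b1 b2 c1 c2 d11 d12 d21 d22)
    note A = 1(1) and res = 1(2-10)
    note eq = moves_selfD[OF 1(12), unfolded moves_mat3 x]
    have n1: "red d11 = red a" using eq(2) by simp
    have n2: "red d12 = 0" using eq(3) by simp
    have n3: "red c1 = 0" using eq(1) by simp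
    have n4: "red d21 = 0" using eq(6) n3 by simp
    have n5: "red d22 = red a" using eq(7) n1 n2 by simp
    have n6: "red c2 = 0" using eq(8) n4 by simp
    note s = resid_eq_mod[OF res(6) n1] resid_eq_0[OF res(7) n2] resid_eq_0[OF res(4) n3]
      resid_eq_0[OF res(8) n4] resid_eq_mod[OF res(9) n5] resid_eq_0[OF res(5) n6]
    have "A = mat3 [[a, p ^ m * b1, p ^ m * b2], [0, a mod p, 0], [0, 0, a mod p]]"
      using A s by simp
    then show "A \<in> ?R" using res by blast
  qed
next
  fix A assume "A \<in> ?R"
  then obtain a b1 b2 where h: "a \<in> S_units \<and> b1 \<in> resid p \<and> b2 \<in> resid p"
    and A: "A = mat3 [[a, p ^ m * b1, p ^ m * b2], [0, a mod p, 0], [0, 0, a mod p]]" by blast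
  show "A \<in> ?L"
    by (rule isotropy_matricesI[of A a b1 b2 0 "a mod p" 0 0 0 "a mod p"])
      (use A h in \<open>simp_all add: moves_self_iff moves_mod_p_def vector_2 x unit_iff[simplified] unit1_iff algebra_simps\<close>)
qed

lemma isotropy_row_diag:
  assumes x: "red x = 0"
  shows "isotropy_matrices (mat3 [[x, 1, 0], [0, u, 0], [0, 0, w]]) =
      {mat3 [[a, p ^ m * b1, p ^ m * b2], [0, a mod p, 0], [(d * (w - u)) mod p, d, e]] | a b1 b2 d e.
         a \<in> S_units \<and> b1 \<in> resid p \<and> b2 \<in> resid p \<and> d \<in> resid p \<and>
         e \<in> resid_units p}" (is "?L = ?R")
proof (intro equalityI subsetI)
  fix A assume "A \<in> ?L"
  then show "A \<in> ?R"
  proof (cases rule: isotropy_matricesE)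
    case (1 a b1 b2 c1 c2 d11 d12 d21 d22)
    note A = 1(1) and res = 1(2-10)
    note eq = moves_selfD[OF 1(12), unfolded moves_mat3 x]
    have n1: "red d11 = red a" using eq(2) by simp
    have n2: "red d12 = 0" using eq(3) by simp
    have n3: "red c1 = 0" using eq(1) by simp
    have n4: "red c2 = red (d21 * (w - u))" using eq(8) by (simp add: algebra_simps)
    note s = resid_eq_mod[OF res(6) n1] resid_eq_0[OF res(7) n2] resid_eq_0[OF res(4) n3]
      resid_eq_mod[OF res(5) n4]
    have un: "d22 \<in> resid_units p" unfolding unit1_iff using n1 n2 n3 1(11) res by auto
    have "A = mat3 [[a, p ^ m * b1, p ^ m * b2], [0, a mod p, 0], [(d21 * (w - u)) mod p, d21, d22]]"
      using A s by simp
    then show "A \<in> ?R" using res un by blast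
  qed
next
  fix A assume "A \<in> ?R"
  then obtain a b1 b2 d e where h: "a \<in> S_units \<and> b1 \<in> resid p \<and> b2 \<in> resid p \<and> d \<in> resid p \<and>
         e \<in> resid_units p"
    and A: "A = mat3 [[a, p ^ m * b1, p ^ m * b2], [0, a mod p, 0], [(d * (w - u)) mod p, d, e]]" by blast
  show "A \<in> ?L"
    by (rule isotropy_matricesI[of A a b1 b2 0 "a mod p" 0 "(d * (w - u)) mod p" d e])
      (use A h in \<open>simp_all add: moves_self_iff moves_mod_p_def vector_2 x unit_iff[simplified] unit1_iff algebra_simps\<close>)
qed

lemma isotropy_column_nondiag:
  assumes x: "red x = 0"
  shows "isotropy_matrices (mat3 [[x, 0, 0], [1, 0, 0], [0, 1, w]]) =
      {mat3 [[a, 0, 0], [c1, a mod p, 0], [c2, 0, a mod p]] | a c1 c2.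
         a \<in> S_units \<and> c1 \<in> resid p \<and> c2 \<in> resid p}" (is "?L = ?R")
proof (intro equalityI subsetI)
  fix A assume "A \<in> ?L"
  then show "A \<in> ?R"
  proof (cases rule: isotropy_matricesE)
    case (1 a b1 b2 c1 c2 d11 d12 d21 d22)
    note A = 1(1) and res = 1(2-10)
    note eq = moves_selfD[OF 1(12), unfolded moves_mat3 x]
    have n1: "red d11 = red a" using eq(4) by simp
    have n2: "red d21 = 0" using eq(5) by simp
    have n3: "red b1 = 0" using eq(1) by simp
    have n4: "red d12 = 0" using eq(6) n3 by simp
    have n5: "red b2 = 0" using eq(7) n4 by simp
    have n6: "red d22 = red a" using eq(8) n1 n2 by simp
    note s = resid_eq_mod[OF res(6) n1] resid_eq_0[OF res(8) n2] resid_eq_0[OF res(2) n3]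
      resid_eq_0[OF res(7) n4] resid_eq_0[OF res(3) n5] resid_eq_mod[OF res(9) n6]
    have "A = mat3 [[a, 0, 0], [c1, a mod p, 0], [c2, 0, a mod p]]"
      using A s by simp
    then show "A \<in> ?R" using res by blast
  qed
next
  fix A assume "A \<in> ?R"
  then obtain a c1 c2 where h: "a \<in> S_units \<and> c1 \<in> resid p \<and> c2 \<in> resid p"
    and A: "A = mat3 [[a, 0, 0], [c1, a mod p, 0], [c2, 0, a mod p]]" by blast
  show "A \<in> ?L"
    by (rule isotropy_matricesI[of A a 0 0 c1 "a mod p" 0 c2 0 "a mod p"])
      (use A h in \<open>simp_all add: moves_self_iff moves_mod_p_def vector_2 x unit_iff[simplified] unit1_iff algebra_simps\<close>)
qed

lemma isotropy_column_diag:
  assumes x: "red x = 0"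
  shows "isotropy_matrices (mat3 [[x, 0, 0], [1, u, 0], [0, 0, w]]) =
      {mat3 [[a, 0, p ^ m * ((d * (w - u)) mod p)], [c1, a mod p, d], [c2, 0, e]] | a c1 c2 d e.
         a \<in> S_units \<and> c1 \<in> resid p \<and> c2 \<in> resid p \<and> d \<in> resid p \<and>
         e \<in> resid_units p}" (is "?L = ?R")
proof (intro equalityI subsetI)
  fix A assume "A \<in> ?L"
  then show "A \<in> ?R"
  proof (cases rule: isotropy_matricesE)
    case (1 a b1 b2 c1 c2 d11 d12 d21 d22)
    note A = 1(1) and res = 1(2-10)
    note eq = moves_selfD[OF 1(12), unfolded moves_mat3 x]
    have n1: "red d11 = red a" using eq(4) by simp
    have n2: "red d21 = 0" using eq(5) by simp
    have n3: "red b1 = 0" using eq(1) by simp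
    have n4: "red b2 = red (d12 * (w - u))" using eq(7) by (simp add: algebra_simps)
    note s = resid_eq_mod[OF res(6) n1] resid_eq_0[OF res(8) n2] resid_eq_0[OF res(2) n3]
      resid_eq_mod[OF res(3) n4]
    have un: "d22 \<in> resid_units p" unfolding unit1_iff using n1 n2 n3 1(11) res by auto
    have "A = mat3 [[a, 0, p ^ m * ((d12 * (w - u)) mod p)], [c1, a mod p, d12], [c2, 0, d22]]"
      using A s by simp
    then show "A \<in> ?R" using res un by blast
  qed
next
  fix A assume "A \<in> ?R"
  then obtain a c1 c2 d e where h: "a \<in> S_units \<and> c1 \<in> resid p \<and> c2 \<in> resid p \<and> d \<in> resid p \<and>
         e \<in> resid_units p"
    and A: "A = mat3 [[a, 0, p ^ m * ((d * (w - u)) mod p)], [c1, a mod p, d], [c2, 0, e]]" by blast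
  show "A \<in> ?L"
    by (rule isotropy_matricesI[of A a 0 "(d * (w - u)) mod p" c1 "a mod p" d c2 0 e])
      (use A h in \<open>simp_all add: moves_self_iff moves_mod_p_def vector_2 x unit_iff[simplified] unit1_iff algebra_simps\<close>)
qed

section \<open>Reduction to the representatives\<close>

lemma same_orbit_mat3I:
  assumes "red a \<noteq> 0" "red d11 * red d22 \<noteq> red d12 * red d21"
    and "p ^ (m + 1) dvd a * (x - x') + p ^ m * (b1 * z1 + b2 * z2 - (y1' * c1 + y2' * c2))"
    and "red a * red y1 = red x' * red b1 + red y1' * red d11 + red y2' * red d21"
      "red a * red y2 = red x' * red b2 + red y1' * red d12 + red y2' * red d22"
      "red c1 * red x + red d11 * red z1 + red d12 * red z2 = red z1' * red a"
      "red c2 * red x + red d21 * red z1 + red d22 * red z2 = red z2' * red a"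
      "red c1 * red y1 + red d11 * red w11 + red d12 * red w21 = red z1' * red b1 + red w11' * red d11 + red w12' * red d21"
      "red c1 * red y2 + red d11 * red w12 + red d12 * red w22 = red z1' * red b2 + red w11' * red d12 + red w12' * red d22"
      "red c2 * red y1 + red d21 * red w11 + red d22 * red w21 = red z2' * red b1 + red w21' * red d11 + red w22' * red d21"
      "red c2 * red y2 + red d21 * red w12 + red d22 * red w22 = red z2' * red b2 + red w21' * red d12 + red w22' * red d22"
  shows "same_orbit (mat3 [[x, y1, y2], [z1, w11, w12], [z2, w21, w22]])
    (mat3 [[x', y1', y2'], [z1', w11', w12'], [z2', w21', w22']])"
proof (rule same_orbitI[of a "vector [vector [d11, d12], vector [d21, d22]]" "vector [b1, b2]" "vector [c1, c2]"])
  show "red (det2 (vector [vector [d11, d12], vector [d21, d22]])) \<noteq> 0"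
    using assms(2) by (simp add: det2_def vector_2)
qed (use assms in \<open>simp_all only: moves_def moves_mod_p_def mat3_nth vector_2 simp_thms\<close>)

lemma adjugate_solve:
  fixes A B :: "'a::comm_ring_1"
  assumes "i * (a * d - b * c) = 1"
  shows adjugate_solve_1: "A = i * (A * d - B * c) * a + i * (B * a - A * b) * c"
    and adjugate_solve_2: "B = i * (A * d - B * c) * b + i * (B * a - A * b) * d"
proof -
  have "i * (A * d - B * c) * a + i * (B * a - A * b) * c = A * (i * (a * d - b * c))"
    "i * (A * d - B * c) * b + i * (B * a - A * b) * d = B * (i * (a * d - b * c))"
    by (simp_all add: algebra_simps)
  then show "A = i * (A * d - B * c) * a + i * (B * a - A * b) * c" "B = i * (A * d - B * c) * b + i * (B * a - A * b) * d"
    using assms by simp_all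
qed

text \<open>
  The automorphism with the diagonal blocks \<open>1\<close> and \<open>D\<close> replaces \<open>y\<close> by \<open>y D\<^sup>-\<^sup>1\<close>, \<open>z\<close> by \<open>D z\<close>, and \<open>W\<close> by
  a conjugate, whose entries do not matter for the purposes below.
\<close>

lemma base_change:
  assumes det: "red d11 * red d22 \<noteq> red d12 * red d21"
    and y: "red y1 = red y1' * red d11 + red y2' * red d21" "red y2 = red y1' * red d12 + red y2' * red d22"
    and z: "red z1' = red d11 * red z1 + red d12 * red z2" "red z2' = red d21 * red z1 + red d22 * red z2"
  obtains w11' w12' w21' w22' where
    "same_orbit (mat3 [[x, y1, y2], [z1, w11, w12], [z2, w21, w22]])
      (mat3 [[x, y1', y2'], [z1', w11', w12'], [z2', w21', w22']])"
proof -
  obtain i where i: "red i = inverse (red (d11 * d22 - d12 * d21))" using red_inverse by blast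
  have i1: "red i * (red d11 * red d22 - red d12 * red d21) = 1" using det by (simp add: i)
  \<comment> \<open>The product \<open>D W adj(D)\<close> divided by the determinant.\<close>
  define v11 where "v11 = d11 * w11 + d12 * w21"
  define v12 where "v12 = d11 * w12 + d12 * w22"
  define v21 where "v21 = d21 * w11 + d22 * w21"
  define v22 where "v22 = d21 * w12 + d22 * w22"
  note r = adjugate_solve_1[OF i1, of "red v11" "red v12"] adjugate_solve_2[OF i1, of "red v12" "red v11"]
    adjugate_solve_1[OF i1, of "red v21" "red v22"] adjugate_solve_2[OF i1, of "red v22" "red v21"]
  show thesis
    by (rule that[of "i * (v11 * d22 - v12 * d21)" "i * (v12 * d11 - v11 * d12)"
          "i * (v21 * d22 - v22 * d21)" "i * (v22 * d11 - v21 * d12)"],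
        rule same_orbit_mat3I[of 1 d11 d22 d12 d21 _ _ 0 _ 0 _ _ 0 _ 0])
      (use det y z r in \<open>simp_all add: v11_def v12_def v21_def v22_def\<close>)
qed

text \<open>
  The automorphisms with \<open>a = 1\<close> and \<open>D = 1\<close>, for a corner divisible by \<open>p\<close>: they fix \<open>y\<close> and \<open>z\<close>, change \<open>W\<close> by
  \<open>c y - z b\<close>, and change \<open>x\<close> by a multiple of \<open>p\<^sup>m\<close>. The parameters are also allowed to be replaced by congruent
  ones, as needed for passing to remainders.
\<close>

lemma unipotent_change:
  assumes x: "red x = 0" and s: "x - x' = p ^ m * s"
    and corner: "red s + red b1 * red z1 + red b2 * red z2 = red y1 * red c1 + red y2 * red c2"
    and w: "red w11' = red w11 + red c1 * red y1 - red z1 * red b1" "red w12' = red w12 + red c1 * red y2 - red z1 * red b2"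
      "red w21' = red w21 + red c2 * red y1 - red z2 * red b1" "red w22' = red w22 + red c2 * red y2 - red z2 * red b2"
    and yz: "red y1' = red y1" "red y2' = red y2" "red z1' = red z1" "red z2' = red z2"
  shows "same_orbit (mat3 [[x, y1, y2], [z1, w11, w12], [z2, w21, w22]])
    (mat3 [[x', y1', y2'], [z1', w11', w12'], [z2', w21', w22']])"
proof -
  have "red (x - x') = 0" unfolding s by simp
  then have x': "red x' = 0" using x by simp
  have "1 * (x - x') + p ^ m * (b1 * z1 + b2 * z2 - (y1' * c1 + y2' * c2)) =
      p ^ m * (s + b1 * z1 + b2 * z2 - (y1' * c1 + y2' * c2))"
    unfolding s by (simp add: algebra_simps)
  moreover have "red (s + b1 * z1 + b2 * z2 - (y1' * c1 + y2' * c2)) = 0" using corner yz by simp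
  ultimately have "p ^ (m + 1) dvd 1 * (x - x') + p ^ m * (b1 * z1 + b2 * z2 - (y1' * c1 + y2' * c2))"
    using pm1_dvd_pm_mult by metis
  then show ?thesis
    by (intro same_orbit_mat3I[of 1 1 1 0 0 _ _ b1 _ b2 _ _ c1 _ c2]) (simp_all add: x x' w yz)
qed

text \<open>
  Unless \<open>W\<close> is a scalar, one of the vectors \<open>(1, 0)\<close>, \<open>(0, 1)\<close> and \<open>(1, 1)\<close> forms a basis together with its
  image, and in this basis \<open>W\<close> is a companion matrix. The matrix \<open>D\<close> is the adjugate of that basis, which
  avoids division by the determinant.
\<close>

lemma rational_form_exists:
  obtains d11 d12 d21 d22 W' where "W' \<in> rational_forms p" "red d11 * red d22 \<noteq> red d12 * red d21"
    "red d11 * red w11 + red d12 * red w21 = red (W' $ 1 $ 1) * red d11 + red (W' $ 1 $ 2) * red d21"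
    "red d11 * red w12 + red d12 * red w22 = red (W' $ 1 $ 1) * red d12 + red (W' $ 1 $ 2) * red d22"
    "red d21 * red w11 + red d22 * red w21 = red (W' $ 2 $ 1) * red d11 + red (W' $ 2 $ 2) * red d21"
    "red d21 * red w12 + red d22 * red w22 = red (W' $ 2 $ 1) * red d12 + red (W' $ 2 $ 2) * red d22"
proof -
  define C :: "'k poly ^ 2 ^ 2" where
    "C = vector [vector [0, (w12 * w21 - w11 * w22) mod p], vector [1, (w11 + w22) mod p]]"
  have C: "C \<in> rational_forms p" unfolding rational_forms_def C_def using resid_mod by blast
  have Cn: "red (C $ 1 $ 1) = 0" "red (C $ 1 $ 2) = red w12 * red w21 - red w11 * red w22" "red (C $ 2 $ 1) = 1"
    "red (C $ 2 $ 2) = red w11 + red w22"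
    by (simp_all add: C_def vector_2)
  show thesis
  proof (cases "red w21 = 0")
    case False
    show thesis by (rule that[OF C, of w21 1 "- w11" 0]) (use False in \<open>simp_all add: Cn algebra_simps\<close>)
  next
    case w21: True
    show thesis
    proof (cases "red w12 = 0")
      case False
      show thesis by (rule that[OF C, of w22 0 "- w12" "- 1"]) (use False w21 in \<open>simp_all add: Cn algebra_simps\<close>)
    next
      case w12: True
      show thesis
      proof (cases "red w11 = red w22")
        case False
        show thesis by (rule that[OF C, of w22 1 "- w11" "- 1"]) (use False w12 w21 in \<open>simp_all add: Cn algebra_simps\<close>)
      next
        case True
        have "vector [vector [w11 mod p, 0], vector [0, w11 mod p]] \<in> rational_forms p"
          unfolding rational_forms_def using resid_mod by blast
        then show thesis by (rule that[of _ 1 1 0 0]) (use True w12 w21 in \<open>simp_all add: vector_2\<close>)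
      qed
    qed
  qed
qed

lemma mat3_eta: "E = mat3 [[E $ 1 $ 1, E $ 1 $ 2, E $ 1 $ 3], [E $ 2 $ 1, E $ 2 $ 2, E $ 2 $ 3], [E $ 3 $ 1, E $ 3 $ 2, E $ 3 $ 3]]"
  for E :: "'k poly ^ 3 ^ 3"
  unfolding vec_eq_iff forall_3 mat3_nth by simp

lemma block_zero_eq: "block x 0 0 W = mat3 [[x, 0, 0], [0, W $ 1 $ 1, W $ 1 $ 2], [0, W $ 2 $ 1, W $ 2 $ 2]]"
  by (simp add: block_def)

lemma dvd_diff_mod: "q dvd f - f mod q" for f q :: "'k poly"
  by (simp add: minus_mod_eq_mult_div)

lemma reduce_diagonal:
  assumes "red y1 = 0" "red y2 = 0" "red z1 = 0" "red z2 = 0"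
  obtains W where "W \<in> rational_forms p"
    "same_orbit (mat3 [[x, y1, y2], [z1, w11, w12], [z2, w21, w22]]) (block (x mod p ^ (m + 1)) 0 0 W)"
proof (rule rational_form_exists[of w11 w21 w12 w22])
  fix d11 d12 d21 d22 W'
  assume W': "W' \<in> rational_forms p" and h: "red d11 * red d22 \<noteq> red d12 * red d21"
    "red d11 * red w11 + red d12 * red w21 = red (W' $ 1 $ 1) * red d11 + red (W' $ 1 $ 2) * red d21"
    "red d11 * red w12 + red d12 * red w22 = red (W' $ 1 $ 1) * red d12 + red (W' $ 1 $ 2) * red d22"
    "red d21 * red w11 + red d22 * red w21 = red (W' $ 2 $ 1) * red d11 + red (W' $ 2 $ 2) * red d21"
    "red d21 * red w12 + red d22 * red w22 = red (W' $ 2 $ 1) * red d12 + red (W' $ 2 $ 2) * red d22"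
  have "same_orbit (mat3 [[x, y1, y2], [z1, w11, w12], [z2, w21, w22]]) (block (x mod p ^ (m + 1)) 0 0 W')"
    unfolding block_zero_eq
    by (rule same_orbit_mat3I[of 1 d11 d22 d12 d21 _ _ 0 _ 0 _ _ 0 _ 0])
      (use h assms dvd_diff_mod[of "p ^ (m + 1)" x] in \<open>simp_all\<close>)
  then show thesis using W' that by blast
qed

text \<open>
  Elimination with the pivot \<open>x\<close>: the choices \<open>b = y/x\<close> and \<open>c = - z/x\<close> clear \<open>y\<close> and \<open>z\<close> and replace \<open>W\<close>
  by \<open>W - z y/x\<close>.
\<close>

lemma reduce_unit_corner:
  assumes x: "red x \<noteq> 0"
  obtains x' W where "x' \<in> resid (p ^ (m + 1))" "coprime x' p" "W \<in> rational_forms p"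
    "same_orbit (mat3 [[x, y1, y2], [z1, w11, w12], [z2, w21, w22]]) (block x' 0 0 W)"
proof -
  obtain i where i: "red i = inverse (red x)" using red_inverse by blast
  define x1 where "x1 = x + p ^ m * (i * y1 * z1 + i * y2 * z2)"
  have x1: "red x1 = red x" by (simp add: x1_def)
  have "same_orbit (mat3 [[x, y1, y2], [z1, w11, w12], [z2, w21, w22]])
     (mat3 [[x1, 0, 0], [0, w11 - i * z1 * y1, w12 - i * z1 * y2], [0, w21 - i * z2 * y1, w22 - i * z2 * y2]])"
    by (rule same_orbit_mat3I[of 1 1 1 0 0 _ _ "i * y1" _ "i * y2" _ _ "- i * z1" _ "- i * z2"])
      (use x i in \<open>simp_all add: x1 field_simps\<close>, simp add: x1_def algebra_simps)
  moreover obtain W where W: "W \<in> rational_forms p"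
    "same_orbit (mat3 [[x1, 0, 0], [0, w11 - i * z1 * y1, w12 - i * z1 * y2], [0, w21 - i * z2 * y1, w22 - i * z2 * y2]])
      (block (x1 mod p ^ (m + 1)) 0 0 W)"
    using reduce_diagonal[of 0 0 0 0] by (metis red_0)
  ultimately have "same_orbit (mat3 [[x, y1, y2], [z1, w11, w12], [z2, w21, w22]]) (block (x1 mod p ^ (m + 1)) 0 0 W)"
    using same_orbit_trans by blast
  moreover have "coprime (x1 mod p ^ (m + 1)) p"
  proof -
    have "p dvd p ^ (m + 1)" by simp
    then have "p dvd x1 mod p ^ (m + 1) \<longleftrightarrow> p dvd x1" by (simp add: dvd_mod_iff)
    then show ?thesis unfolding coprime_iff red_eq_0_iff using x x1 red_eq_0_iff by metis
  qed
  ultimately show thesis using W(1) that resid_mod by blast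
qed

end

locale hook_representatives = hook p m for p :: "'k::field poly" and m +
  fixes T
  assumes T: "T \<subseteq> resid (p ^ (m + 1))" "bij_betw (\<lambda>x. x mod p ^ m) T {c \<in> resid (p ^ m). p dvd c}"
begin

lemma representative_exists:
  assumes x: "red x = 0"
  obtains t s where "t \<in> T" "x - t = p ^ m * s"
proof -
  have "p dvd x" "p dvd p ^ m" using x m red_eq_0_iff by auto
  then have "p dvd x mod p ^ m" by (simp add: dvd_mod)
  then have "x mod p ^ m \<in> (\<lambda>x. x mod p ^ m) ` T" using T(2) unfolding bij_betw_def by simp
  then obtain t where t: "t \<in> T" "x mod p ^ m = t mod p ^ m" by blast
  then have "p ^ m dvd x - t" by (simp add: mod_eq_dvd_iff)
  then show thesis using t that by (auto elim: dvdE)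
qed

lemma T_nonunit: "t \<in> T \<Longrightarrow> red t = 0"
proof -
  assume "t \<in> T"
  then have "p dvd t mod p ^ m" using T(2) by (auto simp: bij_betw_def)
  moreover have "p dvd p ^ m" using m by simp
  ultimately show "red t = 0" unfolding red_eq_0_iff using dvd_mod_iff by blast
qed

definition represented where
  "represented E \<longleftrightarrow> (\<exists>(E', H)\<in>orbit_table p m T. same_orbit E E')"

lemma representedI: "same_orbit E E' \<Longrightarrow> (E', H) \<in> orbit_table p m T \<Longrightarrow> represented E"
  unfolding represented_def by blast

lemma represented_trans: "same_orbit E E' \<Longrightarrow> represented E' \<Longrightarrow> represented E"
  unfolding represented_def using same_orbit_trans by blast

text \<open>
  The three cases are those of \<open>y z \<noteq> 0\<close>, of \<open>y z = 0\<close> with \<open>z \<noteq> 0\<close>, and of \<open>z = 0\<close>. For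
  \<open>z \<noteq> 0\<close> a change of basis fixing \<open>y = (1, 0)\<close> first normalizes \<open>z\<close>. A unipotent change then moves \<open>x\<close> to the
  representative \<open>t\<close> at the expense of one diagonal entry of \<open>W\<close> and clears what it can. For \<open>z = 0\<close> the upper
  right entry of \<open>W\<close> survives; if it is not zero, a further automorphism makes it \<open>1\<close> and the entry to its
  left \<open>0\<close>.
\<close>

lemma represented_row_nonzero:
  assumes x: "red x = 0"
  shows "represented (mat3 [[x, 1, 0], [z1, w11, w12], [z2, w21, w22]])"
proof -
  consider "red z1 \<noteq> 0" | "red z1 = 0" "red z2 \<noteq> 0" | "red z1 = 0" "red z2 = 0" by blast
  then show ?thesis
  proof cases
    case 1
    obtain v11 v12 v21 v22 where "same_orbit (mat3 [[x, 1, 0], [z1, w11, w12], [z2, w21, w22]])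
        (mat3 [[x, 1, 0], [z1, v11, v12], [0, v21, v22]])"
      by (rule base_change[of 1 z1 0 "- z2" 1 1 0 0 z1 z1 z2 0 x w11 w12 w21 w22]) (use 1 in simp_all)
    moreover have "represented (mat3 [[x, 1, 0], [z1, v11, v12], [0, v21, v22]])"
    proof -
      obtain t s where t: "t \<in> T" "x - t = p ^ m * s" using representative_exists[OF x] by blast
      obtain i where i: "red i = inverse (red z1)" using red_inverse by blast
      have "same_orbit (mat3 [[x, 1, 0], [z1, v11, v12], [0, v21, v22]])
         (mat3 [[t, 1, 0], [z1 mod p, (v11 + s) mod p, 0], [0, 0, v22 mod p]])"
        by (rule unipotent_change[OF x t(2), of 0 z1 "i * v12" 0 1 s 0 "- v21"]) (use 1 i in simp_all)
      moreover have "z1 mod p \<noteq> 0" using 1 red_mod[of z1] by auto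
      ultimately show ?thesis
        by (intro representedI[OF _ both_nonorthogonal[OF t(1) resid_mod resid_mod resid_mod]])
    qed
    ultimately show ?thesis by (rule represented_trans)
  next
    case 2
    obtain i where i: "red i = inverse (red z2)" using red_inverse by blast
    obtain v11 v12 v21 v22 where "same_orbit (mat3 [[x, 1, 0], [z1, w11, w12], [z2, w21, w22]])
        (mat3 [[x, 1, 0], [0, v11, v12], [1, v21, v22]])"
      by (rule base_change[of 1 i 0 0 1 1 0 0 0 z1 z2 1 x w11 w12 w21 w22]) (use 2 i in simp_all)
    moreover have "represented (mat3 [[x, 1, 0], [0, v11, v12], [1, v21, v22]])"
    proof -
      obtain t s where t: "t \<in> T" "x - t = p ^ m * s" using representative_exists[OF x] by blast
      have "same_orbit (mat3 [[x, 1, 0], [0, v11, v12], [1, v21, v22]])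
         (mat3 [[t, 1, 0], [0, 0, v12 mod p], [1, 0, (v22 + v11 + s) mod p]])"
        by (rule unipotent_change[OF x t(2), of 0 0 "- v11 - s" 1 1 "- v11" 0 "- v21"]) simp_all
      then show ?thesis by (rule representedI[OF _ both_orthogonal[OF t(1) resid_mod resid_mod]])
    qed
    ultimately show ?thesis by (rule represented_trans)
  next
    case 3
    obtain t s where t: "t \<in> T" "x - t = p ^ m * s" using representative_exists[OF x] by blast
    have t0: "red t = 0" by (rule T_nonunit[OF t(1)])
    have 1: "same_orbit (mat3 [[x, 1, 0], [z1, w11, w12], [z2, w21, w22]])
       (mat3 [[t, 1, 0], [0, (w11 + s) mod p, w12 mod p], [0, 0, w22 mod p]])"
      by (rule unipotent_change[OF x t(2), of 0 z1 0 z2 1 s 0 "- w21"]) (use 3 in simp_all)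
    show ?thesis
    proof (cases "red w12 = 0")
      case True
      then have "w12 mod p = 0" using red_eq_0_iff by auto
      with 1 have "same_orbit (mat3 [[x, 1, 0], [z1, w11, w12], [z2, w21, w22]])
          (mat3 [[t, 1, 0], [0, (w11 + s) mod p, 0], [0, 0, w22 mod p]])" by simp
      then show ?thesis by (rule representedI[OF _ row_diag[OF t(1) resid_mod resid_mod]])
    next
      case False
      let ?u = "w11 + s"
      have "same_orbit (mat3 [[t, 1, 0], [0, ?u mod p, w12 mod p], [0, 0, w22 mod p]])
         (mat3 [[t, 1, 0], [0, 0, 1], [0, 0, (?u + w22) mod p]])"
        by (rule same_orbit_mat3I[of 1 1 w12 0 ?u _ _ 0 _ 0 _ _ 0 _ "w22 * ?u"])
          (use False in \<open>simp_all add: t0 algebra_simps\<close>)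
      then have "represented (mat3 [[t, 1, 0], [0, ?u mod p, w12 mod p], [0, 0, w22 mod p]])"
        by (rule representedI[OF _ row_nondiag[OF t(1) resid_mod]])
      then show ?thesis by (rule represented_trans[OF 1])
    qed
  qed
qed

text \<open>
  The transposed situation of \<open>y\<close> nonzero and \<open>z\<close> zero, with the lower left entry of \<open>W\<close> surviving.
\<close>

lemma represented_column_nonzero:
  assumes x: "red x = 0"
  shows "represented (mat3 [[x, 0, 0], [1, w11, w12], [0, w21, w22]])"
proof -
  obtain t s where t: "t \<in> T" "x - t = p ^ m * s" using representative_exists[OF x] by blast
  have t0: "red t = 0" by (rule T_nonunit[OF t(1)])
  have 1: "same_orbit (mat3 [[x, 0, 0], [1, w11, w12], [0, w21, w22]])
     (mat3 [[t, 0, 0], [1, (w11 + s) mod p, 0], [0, w21 mod p, w22 mod p]])"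
    by (rule unipotent_change[OF x t(2), of "- s" 1 w12 0 0 0 0 0]) simp_all
  show ?thesis
  proof (cases "red w21 = 0")
    case True
    then have "w21 mod p = 0" using red_eq_0_iff by auto
    with 1 have "same_orbit (mat3 [[x, 0, 0], [1, w11, w12], [0, w21, w22]])
        (mat3 [[t, 0, 0], [1, (w11 + s) mod p, 0], [0, 0, w22 mod p]])" by simp
    then show ?thesis by (rule representedI[OF _ column_diag[OF t(1) resid_mod resid_mod]])
  next
    case False
    let ?u = "w11 + s"
    have "same_orbit (mat3 [[t, 0, 0], [1, ?u mod p, 0], [0, w21 mod p, w22 mod p]])
       (mat3 [[t, 0, 0], [1, 0, 0], [0, 1, (?u + w22) mod p]])"
      by (rule same_orbit_mat3I[of w21 w21 1 "- ?u" 0 _ _ 0 _ "- ?u * w22" _ _ 0 _ 0])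
        (use False in \<open>simp_all add: t0 algebra_simps\<close>)
    then have "represented (mat3 [[t, 0, 0], [1, ?u mod p, 0], [0, w21 mod p, w22 mod p]])"
      by (rule representedI[OF _ column_nondiag[OF t(1) resid_mod]])
    then show ?thesis by (rule represented_trans[OF 1])
  qed
qed

lemma every_matrix_represented: "represented E"
proof -
  define x y1 y2 z1 z2 w11 w12 w21 w22 where defs: "x = E $ 1 $ 1" "y1 = E $ 1 $ 2" "y2 = E $ 1 $ 3"
    "z1 = E $ 2 $ 1" "z2 = E $ 3 $ 1" "w11 = E $ 2 $ 2" "w12 = E $ 2 $ 3" "w21 = E $ 3 $ 2" "w22 = E $ 3 $ 3"
  have E: "E = mat3 [[x, y1, y2], [z1, w11, w12], [z2, w21, w22]]" unfolding defs by (rule mat3_eta)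
  consider "red x \<noteq> 0" | "red x = 0" "red y1 \<noteq> 0 \<or> red y2 \<noteq> 0" | "red x = 0" "red y1 = 0" "red y2 = 0" "red z1 \<noteq> 0 \<or> red z2 \<noteq> 0"
    | "red x = 0" "red y1 = 0" "red y2 = 0" "red z1 = 0" "red z2 = 0" by blast
  then show ?thesis
  proof cases
    case 1
    obtain x' W where "x' \<in> resid (p ^ (m + 1))" "coprime x' p" "W \<in> rational_forms p" "same_orbit E (block x' 0 0 W)"
      using reduce_unit_corner[OF 1] unfolding E by metis
    then show ?thesis by (blast intro: representedI diag_unit)
  next
    case 2
    define d21 d22 where "d21 = (if red y1 = 0 then 1 else 0 :: 'k poly)" and "d22 = (if red y1 = 0 then 0 else 1 :: 'k poly)"
    have "red y1 * red d22 \<noteq> red y2 * red d21" using 2 by (simp add: d21_def d22_def)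
    then obtain v11 v12 v21 v22 where "same_orbit E
        (mat3 [[x, 1, 0], [y1 * z1 + y2 * z2, v11, v12], [d21 * z1 + d22 * z2, v21, v22]])"
      unfolding E by (rule base_change[of y1 d22 y2 d21 y1 1 0 y2 "y1 * z1 + y2 * z2" z1 z2 "d21 * z1 + d22 * z2" x w11 w12 w21 w22]) simp_all
    then show ?thesis by (rule represented_trans) (rule represented_row_nonzero[OF 2(1)])
  next
    case 3
    have "\<exists>d11 d12 d21 d22. red d11 * red d22 \<noteq> red d12 * red d21 \<and> red d11 * red z1 + red d12 * red z2 = 1 \<and> red d21 * red z1 + red d22 * red z2 = 0"
    proof (cases "red z1 = 0")
      case False
      obtain i where i: "red i = inverse (red z1)" using red_inverse by blast
      show ?thesis by (rule exI[of _ i], rule exI[of _ 0], rule exI[of _ "- z2"], rule exI[of _ z1]) (use False i in simp)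
    next
      case True
      obtain i where i: "red i = inverse (red z2)" using red_inverse by blast
      show ?thesis by (rule exI[of _ 0], rule exI[of _ i], rule exI[of _ 1], rule exI[of _ 0]) (use True 3 i in simp)
    qed
    then obtain d11 d12 d21 d22 where d: "red d11 * red d22 \<noteq> red d12 * red d21"
      "red d11 * red z1 + red d12 * red z2 = 1" "red d21 * red z1 + red d22 * red z2 = 0" by blast
    obtain v11 v12 v21 v22 where "same_orbit E (mat3 [[x, 0, 0], [1, v11, v12], [0, v21, v22]])"
      unfolding E by (rule base_change[of d11 d22 d12 d21 y1 0 0 y2 1 z1 z2 0 x w11 w12 w21 w22]) (use d 3 in simp_all)
    then show ?thesis by (rule represented_trans) (rule represented_column_nonzero[OF 3(1)])
  next
    case 4
    obtain W where W: "W \<in> rational_forms p" "same_orbit E (block (x mod p ^ (m + 1)) 0 0 W)"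
      using reduce_diagonal[OF 4(2-5)] unfolding E by metis
    have "p dvd x" using 4(1) red_eq_0_iff by blast
    moreover have "p dvd p ^ (m + 1)" by simp
    ultimately have "p dvd x mod p ^ (m + 1)" by (rule dvd_mod)
    then show ?thesis by (rule representedI[OF W(2) diag_nonunit[OF resid_mod _ W(1)]])
  qed
qed

section \<open>Inequivalence of the representatives\<close>

lemma table_isotropy:
  assumes "(E, H) \<in> orbit_table p m T"
  shows "isotropy_matrices E = H"
  using assms
proof cases
  case (diag_nonunit x W)
  then show ?thesis using isotropy_diag_nonunit by simp
next
  case (diag_unit x W)
  then show ?thesis using isotropy_diag_unit by simp
next
  case (both_nonorthogonal x r u v)
  then show ?thesis using isotropy_both_nonorthogonal T_nonunit by blast
next
  case (both_orthogonal x u v)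
  then show ?thesis using isotropy_both_orthogonal T_nonunit by blast
next
  case (row_nondiag x w)
  then show ?thesis using isotropy_row_nondiag T_nonunit by blast
next
  case (row_diag x u w)
  then show ?thesis using isotropy_row_diag T_nonunit by blast
next
  case (column_nondiag x w)
  then show ?thesis using isotropy_column_nondiag T_nonunit by blast
next
  case (column_diag x u w)
  then show ?thesis using isotropy_column_diag T_nonunit by blast
qed

text \<open>
  The corner equation modulo \<open>p\<close> is \<open>a x = x' a\<close>.
\<close>

lemma corner_invariant:
  assumes "moves a b c D E E'" "red a \<noteq> 0"
  shows "red (E $ 1 $ 1) = red (E' $ 1 $ 1)"
proof -
  let ?Y = "b $ 1 * E $ 2 $ 1 + b $ 2 * E $ 3 $ 1 - (E' $ 1 $ 2 * c $ 1 + E' $ 1 $ 3 * c $ 2)"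
  have "p dvd a * (E $ 1 $ 1 - E' $ 1 $ 1) + p ^ m * ?Y"
    by (rule dvd_trans[OF _ movesD(1)[OF assms(1)]]) simp
  then have "red (a * (E $ 1 $ 1 - E' $ 1 $ 1) + p ^ m * ?Y) = 0" using red_eq_0_iff by blast
  then show ?thesis using assms(2) by simp
qed

lemma adjugate_cancel:
  fixes a b c d y1 y2 :: "'a::idom"
  assumes "a * d \<noteq> b * c"
  shows "y1 * a + y2 * c = 0 \<and> y1 * b + y2 * d = 0 \<longleftrightarrow> y1 = 0 \<and> y2 = 0"
proof
  assume h: "y1 * a + y2 * c = 0 \<and> y1 * b + y2 * d = 0"
  have "y1 * (a * d - b * c) = (y1 * a + y2 * c) * d - (y1 * b + y2 * d) * c"
    "y2 * (a * d - b * c) = (y1 * b + y2 * d) * a - (y1 * a + y2 * c) * b" by (simp_all add: algebra_simps)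
  then have "y1 * (a * d - b * c) = 0" "y2 * (a * d - b * c) = 0"
    by (simp_all only: h mult_zero_left diff_self)
  then show "y1 = 0 \<and> y2 = 0" using assms by simp
qed simp

lemma row_invariant:
  assumes mv: "moves a b c D E E'" and a: "red a \<noteq> 0" and det: "red (det2 D) \<noteq> 0"
    and x: "red (E $ 1 $ 1) = 0"
  shows "red (E $ 1 $ 2) = 0 \<and> red (E $ 1 $ 3) = 0 \<longleftrightarrow> red (E' $ 1 $ 2) = 0 \<and> red (E' $ 1 $ 3) = 0"
proof -
  have x': "red (E' $ 1 $ 1) = 0" using corner_invariant[OF mv a] x by simp
  have d: "red (D $ 1 $ 1) * red (D $ 2 $ 2) \<noteq> red (D $ 1 $ 2) * red (D $ 2 $ 1)" using det by (simp add: det2_def)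
  show ?thesis using movesD(2,3)[OF mv] adjugate_cancel[OF d, of "red (E' $ 1 $ 2)" "red (E' $ 1 $ 3)"] a
    unfolding x' by (metis add_0 mult_eq_0_iff)
qed

lemma column_invariant:
  assumes mv: "moves a b c D E E'" and a: "red a \<noteq> 0" and det: "red (det2 D) \<noteq> 0"
    and x: "red (E $ 1 $ 1) = 0"
  shows "red (E $ 2 $ 1) = 0 \<and> red (E $ 3 $ 1) = 0 \<longleftrightarrow> red (E' $ 2 $ 1) = 0 \<and> red (E' $ 3 $ 1) = 0"
proof -
  have d: "red (D $ 1 $ 1) * red (D $ 2 $ 2) \<noteq> red (D $ 2 $ 1) * red (D $ 1 $ 2)" using det by (simp add: det2_def mult.commute)
  have "red (E $ 2 $ 1) * red (D $ 1 $ 1) + red (E $ 3 $ 1) * red (D $ 1 $ 2) = red (E' $ 2 $ 1) * red a"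
    "red (E $ 2 $ 1) * red (D $ 2 $ 1) + red (E $ 3 $ 1) * red (D $ 2 $ 2) = red (E' $ 3 $ 1) * red a"
    using movesD(4,5)[OF mv] unfolding x by (simp_all add: mult.commute)
  then show ?thesis using adjugate_cancel[OF d, of "red (E $ 2 $ 1)" "red (E $ 3 $ 1)"] a by (metis mult_eq_0_iff)
qed

text \<open>
  With \<open>a y = y' D\<close> and \<open>D z = z' a\<close>, evaluation of \<open>y' D z\<close> in two ways shows that \<open>y z = y' z'\<close>.
\<close>

lemma pairing_invariant:
  assumes mv: "moves a b c D E E'" and a: "red a \<noteq> 0" and x: "red (E $ 1 $ 1) = 0"
  shows "red (E $ 1 $ 2) * red (E $ 2 $ 1) + red (E $ 1 $ 3) * red (E $ 3 $ 1) =
     red (E' $ 1 $ 2) * red (E' $ 2 $ 1) + red (E' $ 1 $ 3) * red (E' $ 3 $ 1)"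
proof -
  have x': "red (E' $ 1 $ 1) = 0" using corner_invariant[OF mv a] x by simp
  have "red a * (red (E $ 1 $ 2) * red (E $ 2 $ 1) + red (E $ 1 $ 3) * red (E $ 3 $ 1)) =
     (red a * red (E $ 1 $ 2)) * red (E $ 2 $ 1) + (red a * red (E $ 1 $ 3)) * red (E $ 3 $ 1)" by (simp add: algebra_simps)
  also have "\<dots> = red (E' $ 1 $ 2) * (red (c $ 1) * red (E $ 1 $ 1) + red (D $ 1 $ 1) * red (E $ 2 $ 1) + red (D $ 1 $ 2) * red (E $ 3 $ 1)) +
     red (E' $ 1 $ 3) * (red (c $ 2) * red (E $ 1 $ 1) + red (D $ 2 $ 1) * red (E $ 2 $ 1) + red (D $ 2 $ 2) * red (E $ 3 $ 1))"
    unfolding movesD(2,3)[OF mv] x x' by (simp add: algebra_simps)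
  also have "\<dots> = red a * (red (E' $ 1 $ 2) * red (E' $ 2 $ 1) + red (E' $ 1 $ 3) * red (E' $ 3 $ 1))"
    unfolding movesD(4,5)[OF mv] by (simp add: algebra_simps)
  finally show ?thesis using a by simp
qed

text \<open>
  As \<open>a\<close> is a unit, the corner equation says \<open>x \<equiv> x'\<close> modulo \<open>p\<^sup>m\<close>, and \<open>T\<close> has one element for each class. What remains
  of the corner equation is an equation over \<open>K\<close>.
\<close>

lemma T_unique:
  assumes "x \<in> T" "x' \<in> T" and a: "red a \<noteq> 0" and d: "p ^ (m + 1) dvd a * (x - x') + p ^ m * f"
  shows "x = x'" "red f = 0"
proof -
  have "p ^ m dvd a * (x - x') + p ^ m * f" by (rule dvd_trans[OF _ d]) simp
  then have 1: "p ^ m dvd a * (x - x')" using dvd_add_left_iff[of "p ^ m" "p ^ m * f" "a * (x - x')"] by simp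
  obtain h where h: "p ^ m dvd a * h - 1" using unit_mod_power[OF irr] a red_eq_0_iff by blast
  have "x - x' = (a * (x - x')) * h - (a * h - 1) * (x - x')" by (simp add: algebra_simps)
  moreover have "p ^ m dvd (a * (x - x')) * h - (a * h - 1) * (x - x')"
    by (rule dvd_diff[OF dvd_mult2[OF 1] dvd_mult2[OF h]])
  ultimately have "p ^ m dvd x - x'" by metis
  then have "x mod p ^ m = x' mod p ^ m" by (simp add: mod_eq_dvd_iff)
  then show "x = x'" using T(2) assms(1,2) by (auto simp: bij_betw_def dest: inj_onD)
  then show "red f = 0" using d pm1_dvd_pm_mult by simp
qed

lemma diagonal_unique:
  assumes x: "x \<in> resid (p ^ (m + 1))" "x' \<in> resid (p ^ (m + 1))" and a: "red a \<noteq> 0"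
    and d: "p ^ (m + 1) dvd a * (x - x')"
  shows "x = x'"
proof -
  obtain h where h: "p ^ (m + 1) dvd a * h - 1" using unit_mod_power[OF irr] a red_eq_0_iff by blast
  have "x - x' = (a * (x - x')) * h - (a * h - 1) * (x - x')" by (simp add: algebra_simps)
  moreover have "p ^ (m + 1) dvd (a * (x - x')) * h - (a * h - 1) * (x - x')"
    by (rule dvd_diff[OF dvd_mult2[OF d] dvd_mult2[OF h]])
  ultimately have "p ^ (m + 1) dvd x - x'" by metis
  then show ?thesis by (rule resid_eqI[OF x])
qed

text \<open>
  The four equations say that \<open>D\<close>, with the rows \<open>(a, b)\<close> and \<open>(c, d)\<close>, intertwines the companion matrices of
  \<open>z\<^sup>2 - s z - r\<close> and \<open>z\<^sup>2 - s' z - r'\<close>. The first and the third one express \<open>b\<close> and \<open>d\<close>, and the other two become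
  \<open>D (r - r', s - s') = 0\<close>.
\<close>

lemma companion_unique:
  fixes a b c d :: "'a::idom"
  assumes det: "a * d \<noteq> b * c"
    and e: "b = r' * c" "a * r + b * s = r' * d" "d = a + s' * c" "c * r + d * s = b + s' * d"
  shows "r = r' \<and> s = s'"
proof -
  have 1: "a * (r - r') + b * (s - s') = 0" using e(2) unfolding e(1,3) by (simp add: algebra_simps)
  have 2: "c * (r - r') + d * (s - s') = 0" using e(4) unfolding e(1) by (simp add: algebra_simps)
  have "(r - r') * a + (s - s') * b = 0 \<and> (r - r') * c + (s - s') * d = 0" using 1 2 by (simp add: mult.commute)
  then show ?thesis using adjugate_cancel[of a d c b "r - r'" "s - s'"] det by (simp add: mult.commute)
qed

text \<open>
  A scalar commutes with every \<open>D\<close>, so it is similar to no other matrix. Two companion matrices are compared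
  by the preceding lemma.
\<close>

lemma rational_form_unique:
  assumes W: "W \<in> rational_forms p" "W' \<in> rational_forms p" and det: "red (det2 D) \<noteq> 0"
    and e: "red (D $ 1 $ 1) * red (W $ 1 $ 1) + red (D $ 1 $ 2) * red (W $ 2 $ 1) = red (W' $ 1 $ 1) * red (D $ 1 $ 1) + red (W' $ 1 $ 2) * red (D $ 2 $ 1)"
    "red (D $ 1 $ 1) * red (W $ 1 $ 2) + red (D $ 1 $ 2) * red (W $ 2 $ 2) = red (W' $ 1 $ 1) * red (D $ 1 $ 2) + red (W' $ 1 $ 2) * red (D $ 2 $ 2)"
    "red (D $ 2 $ 1) * red (W $ 1 $ 1) + red (D $ 2 $ 2) * red (W $ 2 $ 1) = red (W' $ 2 $ 1) * red (D $ 1 $ 1) + red (W' $ 2 $ 2) * red (D $ 2 $ 1)"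
    "red (D $ 2 $ 1) * red (W $ 1 $ 2) + red (D $ 2 $ 2) * red (W $ 2 $ 2) = red (W' $ 2 $ 1) * red (D $ 1 $ 2) + red (W' $ 2 $ 2) * red (D $ 2 $ 2)"
  shows "W = W'"
proof -
  have d: "red (D $ 1 $ 1) * red (D $ 2 $ 2) \<noteq> red (D $ 1 $ 2) * red (D $ 2 $ 1)" using det by (simp add: det2_def)
  let ?S = "\<lambda>w. vector [vector [w, 0], vector [0, w]] :: 'k poly ^ 2 ^ 2"
  let ?C = "\<lambda>c d. vector [vector [0, c], vector [1, d]] :: 'k poly ^ 2 ^ 2"
  from W consider w w' where "W = ?S w" "W' = ?S w'" "w \<in> resid p" "w' \<in> resid p"
    | w r s where "W = ?S w" "W' = ?C r s" | w r s where "W = ?C r s" "W' = ?S w"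
    | r s r' s' where "W = ?C r s" "W' = ?C r' s'" "r \<in> resid p" "s \<in> resid p" "r' \<in> resid p" "s' \<in> resid p"
    unfolding rational_forms_def by blast
  then show ?thesis
  proof cases
    case 1
    have "red w = red w'"
    proof (rule ccontr)
      assume "red w \<noteq> red w'"
      then have "red (D $ 1 $ 1) = 0" "red (D $ 1 $ 2) = 0" using e(1,2) by (simp_all add: 1 vector_2 mult.commute)
      then show False using d by simp
    qed
    then show ?thesis using 1 red_inj by blast
  next
    case 2
    \<comment> \<open>The second row of \<open>D W = W' D\<close> makes the first row of \<open>D\<close> a multiple of the second.\<close>
    have "red (D $ 1 $ 1) = (red w - red s) * red (D $ 2 $ 1)" "red (D $ 1 $ 2) = (red w - red s) * red (D $ 2 $ 2)"
      using e(3,4) by (simp_all add: 2 vector_2 algebra_simps)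
    then show ?thesis using d by simp
  next
    case 3
    have "red (D $ 1 $ 2) = red w * red (D $ 1 $ 1)" "red (D $ 2 $ 2) = red w * red (D $ 2 $ 1)"
      using e(1,3) by (simp_all add: 3 vector_2)
    then show ?thesis using d by (simp add: mult.commute mult.left_commute)
  next
    case 4
    have "red r = red r' \<and> red s = red s'"
      by (rule companion_unique[OF d]) (use e in \<open>simp_all add: 4 vector_2\<close>)
    then show ?thesis using 4 red_inj by blast
  qed
qed

lemma both_nonorthogonal_unique:
  assumes T1: "x \<in> T" and T2: "x' \<in> T" and res: "r \<in> resid p" "u \<in> resid p" "v \<in> resid p" "r' \<in> resid p" "u' \<in> resid p" "v' \<in> resid p" and r: "r \<noteq> 0"
    and a: "red a \<noteq> 0" and det: "red (det2 D) \<noteq> 0"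
    and mv: "moves a b c D (mat3 [[x, 1, 0], [r, u, 0], [0, 0, v]]) (mat3 [[x', 1, 0], [r', u', 0], [0, 0, v']])"
  shows "x = x' \<and> r = r' \<and> u = u' \<and> v = v'"
proof -
  note eq = movesD[OF mv, unfolded moves_mat3 T_nonunit[OF T1] T_nonunit[OF T2]]
  note x = T_unique[OF T1 T2 a eq(1)]
  have d: "red (D $ 1 $ 1) * red (D $ 2 $ 2) \<noteq> red (D $ 1 $ 2) * red (D $ 2 $ 1)" using det by (simp add: det2_def)
  have r0: "red r \<noteq> 0" using r res(1) resid_eq_0 by blast
  have n1: "red (D $ 1 $ 1) = red a" using eq(2) by simp
  have n2: "red (D $ 1 $ 2) = 0" using eq(3) by simp
  have n3: "red r = red r'" using eq(4) n1 a by simp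
  have n4: "red (D $ 2 $ 1) = 0" using eq(5) r0 by simp
  have n5: "red (c $ 1) = red r * red (b $ 1)" using x(2) by (simp add: moves_mat3 mult.commute)
  have n6: "red u = red u'" using eq(6) n1 n3 n4 n5 a by simp
  have n7: "red (D $ 2 $ 2) \<noteq> 0" using d n2 by auto
  have n8: "red v = red v'" using eq(9) n4 n7 n2 by simp
  show ?thesis using x n3 n6 n8 res by (auto intro: red_inj)
qed

lemma both_orthogonal_unique:
  assumes T1: "x \<in> T" and T2: "x' \<in> T" and res: "u \<in> resid p" "v \<in> resid p" "u' \<in> resid p" "v' \<in> resid p"
    and a: "red a \<noteq> 0"
    and mv: "moves a b c D (mat3 [[x, 1, 0], [0, 0, u], [1, 0, v]]) (mat3 [[x', 1, 0], [0, 0, u'], [1, 0, v']])"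
  shows "x = x' \<and> u = u' \<and> v = v'"
proof -
  note eq = movesD[OF mv, unfolded moves_mat3 T_nonunit[OF T1] T_nonunit[OF T2]]
  note x = T_unique[OF T1 T2 a eq(1)]
  have n1: "red (D $ 1 $ 1) = red a" using eq(2) by simp
  have n2: "red (D $ 1 $ 2) = 0" using eq(3) by simp
  have n3: "red (D $ 2 $ 2) = red a" using eq(5) by simp
  have n4: "red u = red u'" using eq(7) n1 n2 n3 a by simp
  have n5: "red (c $ 1) = red u' * red (D $ 2 $ 1)" using eq(6) n2 by simp
  have n6: "red (b $ 2) = red (c $ 1)" using x(2) by (simp add: moves_mat3)
  have n7: "red v = red v'" using eq(9) n2 n3 n4 n5 n6 a by (simp add: mult.commute)
  show ?thesis using x n4 n7 res by (auto intro: red_inj)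
qed

lemma row_nondiag_unique:
  assumes T1: "x \<in> T" and T2: "x' \<in> T" and res: "w \<in> resid p" "w' \<in> resid p"
    and a: "red a \<noteq> 0"
    and mv: "moves a b c D (mat3 [[x, 1, 0], [0, 0, 1], [0, 0, w]]) (mat3 [[x', 1, 0], [0, 0, 1], [0, 0, w']])"
  shows "x = x' \<and> w = w'"
proof -
  note eq = movesD[OF mv, unfolded moves_mat3 T_nonunit[OF T1] T_nonunit[OF T2]]
  note x = T_unique[OF T1 T2 a eq(1)]
  have n1: "red (D $ 1 $ 1) = red a" using eq(2) by simp
  have n2: "red (D $ 1 $ 2) = 0" using eq(3) by simp
  have n3: "red (c $ 1) = 0" using x(2) by (simp add: moves_mat3)
  have n4: "red (D $ 2 $ 1) = 0" using eq(6) n2 n3 by simp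
  have n5: "red (D $ 2 $ 2) = red a" using eq(7) n1 n2 by simp
  have n6: "red w = red w'" using eq(9) n4 n5 a by simp
  show ?thesis using x n6 res by (auto intro: red_inj)
qed

lemma row_diag_unique:
  assumes T1: "x \<in> T" and T2: "x' \<in> T" and res: "u \<in> resid p" "w \<in> resid p" "u' \<in> resid p" "w' \<in> resid p"
    and a: "red a \<noteq> 0" and det: "red (det2 D) \<noteq> 0"
    and mv: "moves a b c D (mat3 [[x, 1, 0], [0, u, 0], [0, 0, w]]) (mat3 [[x', 1, 0], [0, u', 0], [0, 0, w']])"
  shows "x = x' \<and> u = u' \<and> w = w'"
proof -
  note eq = movesD[OF mv, unfolded moves_mat3 T_nonunit[OF T1] T_nonunit[OF T2]]
  note x = T_unique[OF T1 T2 a eq(1)]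
  have d: "red (D $ 1 $ 1) * red (D $ 2 $ 2) \<noteq> red (D $ 1 $ 2) * red (D $ 2 $ 1)" using det by (simp add: det2_def)
  have n1: "red (D $ 1 $ 1) = red a" using eq(2) by simp
  have n2: "red (D $ 1 $ 2) = 0" using eq(3) by simp
  have n3: "red (c $ 1) = 0" using x(2) by (simp add: moves_mat3)
  have n4: "red (D $ 2 $ 2) \<noteq> 0" using d n2 by auto
  have n5: "red u = red u'" using eq(6) n1 n3 a by simp
  have n6: "red w = red w'" using eq(9) n4 by simp
  show ?thesis using x n5 n6 res by (auto intro: red_inj)
qed

lemma column_nondiag_unique:
  assumes T1: "x \<in> T" and T2: "x' \<in> T" and res: "w \<in> resid p" "w' \<in> resid p"
    and a: "red a \<noteq> 0"
    and mv: "moves a b c D (mat3 [[x, 0, 0], [1, 0, 0], [0, 1, w]]) (mat3 [[x', 0, 0], [1, 0, 0], [0, 1, w']])"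
  shows "x = x' \<and> w = w'"
proof -
  note eq = movesD[OF mv, unfolded moves_mat3 T_nonunit[OF T1] T_nonunit[OF T2]]
  note x = T_unique[OF T1 T2 a eq(1)]
  have n1: "red (D $ 1 $ 1) = red a" using eq(4) by simp
  have n2: "red (D $ 2 $ 1) = 0" using eq(5) by simp
  have n3: "red (b $ 1) = 0" using x(2) by (simp add: moves_mat3)
  have n4: "red (D $ 1 $ 2) = 0" using eq(6) n3 by simp
  have n5: "red (D $ 2 $ 2) = red a" using eq(8) n1 n2 by simp
  have n6: "red w = red w'" using eq(9) n2 n4 n5 a by simp
  show ?thesis using x n6 res by (auto intro: red_inj)
qed

lemma column_diag_unique:
  assumes T1: "x \<in> T" and T2: "x' \<in> T" and res: "u \<in> resid p" "w \<in> resid p" "u' \<in> resid p" "w' \<in> resid p"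
    and a: "red a \<noteq> 0" and det: "red (det2 D) \<noteq> 0"
    and mv: "moves a b c D (mat3 [[x, 0, 0], [1, u, 0], [0, 0, w]]) (mat3 [[x', 0, 0], [1, u', 0], [0, 0, w']])"
  shows "x = x' \<and> u = u' \<and> w = w'"
proof -
  note eq = movesD[OF mv, unfolded moves_mat3 T_nonunit[OF T1] T_nonunit[OF T2]]
  note x = T_unique[OF T1 T2 a eq(1)]
  have d: "red (D $ 1 $ 1) * red (D $ 2 $ 2) \<noteq> red (D $ 1 $ 2) * red (D $ 2 $ 1)" using det by (simp add: det2_def)
  have n1: "red (D $ 1 $ 1) = red a" using eq(4) by simp
  have n2: "red (D $ 2 $ 1) = 0" using eq(5) by simp
  have n3: "red (b $ 1) = 0" using x(2) by (simp add: moves_mat3)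
  have n4: "red (D $ 2 $ 2) \<noteq> 0" using d n2 by auto
  have n5: "red u = red u'" using eq(6) n1 n2 n3 a by simp
  have n6: "red w = red w'" using eq(9) n2 n4 by simp
  show ?thesis using x n5 n6 res by (auto intro: red_inj)
qed

text \<open>
  The two families with \<open>z = 0\<close> differ by the upper right entry of \<open>W\<close>, those with \<open>y = 0\<close> by the lower left
  one. A change of basis preserving \<open>y\<close>, respectively \<open>z\<close>, multiplies it by a unit.
\<close>

lemma row_families_disjoint:
  assumes T1: "x \<in> T" and T2: "x' \<in> T" and a: "red a \<noteq> 0" and det: "red (det2 D) \<noteq> 0"
    and mv: "moves a b c D (mat3 [[x, 1, 0], [0, u, f], [0, 0, w]]) (mat3 [[x', 1, 0], [0, u', f'], [0, 0, w']])"
  shows "red f = 0 \<longleftrightarrow> red f' = 0"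
proof -
  note eq = movesD[OF mv, unfolded moves_mat3 T_nonunit[OF T1] T_nonunit[OF T2]]
  have n: "red (D $ 1 $ 1) = red a" "red (D $ 1 $ 2) = 0" using eq(2,3) by simp_all
  then have "red (D $ 2 $ 2) \<noteq> 0" using det by (simp add: det2_def)
  then show ?thesis using eq(7) n a by auto
qed

lemma column_families_disjoint:
  assumes T1: "x \<in> T" and T2: "x' \<in> T" and a: "red a \<noteq> 0" and det: "red (det2 D) \<noteq> 0"
    and mv: "moves a b c D (mat3 [[x, 0, 0], [1, u, 0], [0, f, w]]) (mat3 [[x', 0, 0], [1, u', 0], [0, f', w']])"
  shows "red f = 0 \<longleftrightarrow> red f' = 0"
proof -
  note eq = movesD[OF mv, unfolded moves_mat3 T_nonunit[OF T1] T_nonunit[OF T2]]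
  have n: "red (D $ 1 $ 1) = red a" "red (D $ 2 $ 1) = 0" using eq(4,5) by simp_all
  then have "red (D $ 2 $ 2) \<noteq> 0" using det by (simp add: det2_def)
  then show ?thesis using eq(8) n a by auto
qed

lemma block_diagonal_unique:
  assumes "x \<in> resid (p ^ (m + 1))" "x' \<in> resid (p ^ (m + 1))" "W \<in> rational_forms p" "W' \<in> rational_forms p"
    and a: "red a \<noteq> 0" and det: "red (det2 D) \<noteq> 0" and mv: "moves a b c D (block x 0 0 W) (block x' 0 0 W')"
  shows "block x 0 0 W = block x' 0 0 W'"
proof -
  note eq = movesD[OF mv, unfolded block_nth zero_index red_0 mult_zero_left mult_zero_right add_0_left add_0_right]
  have "x = x'" by (rule diagonal_unique[OF assms(1,2) a]) (use eq(1) in simp)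
  moreover have "W = W'"
    by (rule rational_form_unique[OF assms(3,4) det]) (use eq in simp_all)
  ultimately show ?thesis by simp
qed

text \<open>
  The invariants leave only pairs of representatives in the same row of the table, or in two rows that
  differ by the surviving entry of \<open>W\<close>.
\<close>

lemma table_unique:
  assumes t1: "(E, H) \<in> orbit_table p m T" and t2: "(E', H') \<in> orbit_table p m T" and so: "same_orbit E E'"
  shows "(E, H) = (E', H')"
proof -
  obtain a b c D where a: "red a \<noteq> 0" and det: "red (det2 D) \<noteq> 0" and mv: "moves a b c D E E'"
    using same_orbitE[OF so] by metis
  note inv = corner_invariant[OF mv a] row_invariant[OF mv a det] column_invariant[OF mv a det] pairing_invariant[OF mv a]
  have nz: "red f \<noteq> 0" if "f \<in> resid p" "f \<noteq> 0" for f using that resid_eq_0 by blast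
  have nu: "red f = 0" if "p dvd f" for f using that red_eq_0_iff by blast
  have co: "red f \<noteq> 0" if "coprime f p" for f using that coprime_iff by blast
  note facts = inv T_nonunit nz nu co
  have "E = E'"
    using t1
  proof cases
    case E: (diag_nonunit x W)
    show ?thesis using t2
    proof cases
      case E': (diag_nonunit x' W')
      show ?thesis unfolding E(1) E'(1)
        by (rule block_diagonal_unique[OF E(3) E'(3) E(5) E'(5) a det mv[unfolded E(1) E'(1)]])
    qed (use facts E in auto)
  next
    case E: (diag_unit x W)
    show ?thesis using t2
    proof cases
      case E': (diag_unit x' W')
      show ?thesis unfolding E(1) E'(1)
        by (rule block_diagonal_unique[OF E(3) E'(3) E(5) E'(5) a det mv[unfolded E(1) E'(1)]])
    qed (use facts E in auto)
  next
    case E: (both_nonorthogonal x r u v)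
    show ?thesis using t2
    proof cases
      case E': (both_nonorthogonal x' r' u' v')
      show ?thesis unfolding E(1) E'(1)
        using both_nonorthogonal_unique[OF E(3) E'(3) E(4-6) E'(4-6) E(7) a det mv[unfolded E(1) E'(1)]] by simp
    qed (use facts E in auto)
  next
    case E: (both_orthogonal x u v)
    show ?thesis using t2
    proof cases
      case E': (both_orthogonal x' u' v')
      show ?thesis unfolding E(1) E'(1)
        using both_orthogonal_unique[OF E(3) E'(3) E(4-5) E'(4-5) a mv[unfolded E(1) E'(1)]] by simp
    qed (use facts E in auto)
  next
    case E: (row_nondiag x w)
    show ?thesis using t2
    proof cases
      case E': (row_nondiag x' w')
      show ?thesis unfolding E(1) E'(1)
        using row_nondiag_unique[OF E(3) E'(3) E(4) E'(4) a mv[unfolded E(1) E'(1)]] by simp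
    next
      case E': (row_diag x' u' w')
      show ?thesis using row_families_disjoint[OF E(3) E'(3) a det mv[unfolded E(1) E'(1)]] by simp
    qed (use facts E in auto)
  next
    case E: (row_diag x u w)
    show ?thesis using t2
    proof cases
      case E': (row_diag x' u' w')
      show ?thesis unfolding E(1) E'(1)
        using row_diag_unique[OF E(3) E'(3) E(4-5) E'(4-5) a det mv[unfolded E(1) E'(1)]] by simp
    next
      case E': (row_nondiag x' w')
      show ?thesis using row_families_disjoint[OF E(3) E'(3) a det mv[unfolded E(1) E'(1)]] by simp
    qed (use facts E in auto)
  next
    case E: (column_nondiag x w)
    show ?thesis using t2
    proof cases
      case E': (column_nondiag x' w')
      show ?thesis unfolding E(1) E'(1)
        using column_nondiag_unique[OF E(3) E'(3) E(4) E'(4) a mv[unfolded E(1) E'(1)]] by simp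
    next
      case E': (column_diag x' u' w')
      show ?thesis using column_families_disjoint[OF E(3) E'(3) a det mv[unfolded E(1) E'(1)]] by simp
    qed (use facts E in auto)
  next
    case E: (column_diag x u w)
    show ?thesis using t2
    proof cases
      case E': (column_diag x' u' w')
      show ?thesis unfolding E(1) E'(1)
        using column_diag_unique[OF E(3) E'(3) E(4-5) E'(4-5) a det mv[unfolded E(1) E'(1)]] by simp
    next
      case E': (column_nondiag x' w')
      show ?thesis using column_families_disjoint[OF E(3) E'(3) a det mv[unfolded E(1) E'(1)]] by simp
    qed (use facts E in auto)
  qed
  then show ?thesis using table_isotropy[OF t1] table_isotropy[OF t2] by simp
qed

end

section \<open>The classification\<close>

theorem theorem8p6:
  fixes p :: "'k::field poly" and m :: nat and T :: "'k poly set"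
  assumes "irreducible p" and "lead_coeff p = 1" and "m \<ge> 1"
    and "T \<subseteq> resid (p ^ (m + 1))"
    and "bij_betw (\<lambda>x. x mod p ^ m) T {c \<in> resid (p ^ m). p dvd c}"
  shows "(\<forall>(E, H) \<in> orbit_table p m T.
            ext_of_matrix p (lam m) E \<in> E_lam p m \<and>
            bij_betw (\<lambda>g. aut_matrix g (gen p (lam m)))
              (stabilizer (G_lam p m) (act_lam p m) (ext_of_matrix p (lam m) E)) H)
       \<and> (\<forall>Ob \<in> orbits (G_lam p m) (E_lam p m) (act_lam p m).
            \<exists>!(E, H). (E, H) \<in> orbit_table p m T \<and> ext_of_matrix p (lam m) E \<in> Ob)"
proof -
  interpret hook_representatives p m T using assms by unfold_locales auto
  have "\<exists>!(E, H). (E, H) \<in> orbit_table p m T \<and> cls E \<in> Ob"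
    if Ob: "Ob \<in> orbits (G_lam p m) (E_lam p m) (act_lam p m)" for Ob
  proof -
    obtain \<xi> where \<xi>: "\<xi> \<in> E_lam p m" "Ob = orbit (G_lam p m) (act_lam p m) \<xi>" using Ob by (auto simp: orbits_def)
    obtain E0 where E0: "\<xi> = cls E0" using tor.Ext1_matrix[OF \<xi>(1)] by metis
    obtain E H where t: "(E, H) \<in> orbit_table p m T" and so: "same_orbit E0 E"
      using every_matrix_represented[of E0] unfolding represented_def by blast
    have E: "cls E \<in> Ob" using so unfolding \<xi>(2) E0 orbit_def same_orbit_def by (auto intro: sym)
    have uniq: "(E', H') = (E, H)" if "(E', H') \<in> orbit_table p m T" "cls E' \<in> Ob" for E' H'
    proof -
      have "same_orbit E' E"
        using orbit_transitive[OF module_tmod Ob that(2) E] unfolding same_orbit_def .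
      then show ?thesis by (rule table_unique[OF that(1) t])
    qed
    show ?thesis
    proof (rule ex1I[of _ "(E, H)"])
      show "case (E, H) of (E, H) \<Rightarrow> (E, H) \<in> orbit_table p m T \<and> cls E \<in> Ob" using t E by simp
      show "z = (E, H)" if "case z of (E, H) \<Rightarrow> (E, H) \<in> orbit_table p m T \<and> cls E \<in> Ob" for z
        using that uniq[of "fst z" "snd z"] by (simp add: split_def)
    qed
  qed
  moreover have "cls E \<in> E_lam p m \<and>
      bij_betw (\<lambda>g. aut_matrix g (gen p (lam m))) (stabilizer (G_lam p m) (act_lam p m) (cls E)) H"
    if "(E, H) \<in> orbit_table p m T" for E H
    using tor.ext_of_matrix_in_Ext1[of E] stabilizer_bij[of E]
    unfolding table_isotropy[OF that] by blast
  ultimately show ?thesis by blast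
qed

end
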